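(* Let $X$ be an affine process relative to its natural filtration $(\mathcal F_t^0)$. Then there exists a process $\widetilde X$ such that, for each $x\in D_\Delta$, $\widetilde X$ is a $\mathbb P_x$-version of $X$ which is càdlàg in $D_\Delta\cup\{\infty\}$ (in $D_\Delta$, respectively, if $D$ is compact) and which is an affine process relative to $(\mathcal F_t^x)$.
   Context: Spaces. $V$ is an $n$-dimensional real vector space with scalar product $\langle\cdot,\cdot\rangle$ and norm $\|\cdot\|$; $\langle\cdot,\cdot\rangle$ is extended bilinearly (without complex conjugation) to $V+\mathrm iV$. The state space $D\subseteq V$ is closed, non-empty and contains $n+1$ affinely independent elements; $\mathcal D$ is its Borel $\sigma$-algebra. $\Delta\notin D$ is a cemetery state, $D_\Delta=D\cup\{\Delta\}$, $\mathcal D_\Delta=\sigma(\mathcal D,\{\Delta\})$, with the conventions $\|\Delta\|=\infty$ and $f(\Delta)=0$ for any other function $f$ on $D$. If $D$ is non-compact, $\infty$ denotes a "point at infinity" and $D_\Delta\cup\{\infty\}$ is the one-point compactification of $D_\Delta$; if $D$ is compact, $\infty$ is not adjoined. $\mathbb R_+=[0,\infty)$. Put $\mathcal U=\{u\in V+\mathrm iV: x\mapsto e^{\langle u,x\rangle}\text{ is bounded on }D\}$ and $\mathcal U^m=\{u\in V+\mathrm iV:\sup_{x\in D}e^{\langle\mathrm{Re}\,u,x\rangle}\le m\}$, $m\ge1$. Markov processes. $X=(X_t)_{t\ge0}$ is a $D_\Delta$-valued process on a space $\Omega$ such that $X_s(\omega)=\Delta$ implies $X_t(\omega)=\Delta$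 for $t\ge s$; $\mathcal F_t^0=\sigma(X_s,s\le t)$, $\mathcal F^0=\bigvee_t\mathcal F_t^0$; $(\mathbb P_x)_{x\in D_\Delta}$ are probability measures on $(\Omega,\mathcal F^0)$. $X$ is a time-homogeneous Markov process relative to a filtration $(\mathcal F_t)$ with $\mathcal F_t\supseteq\mathcal F_t^0$ if $\mathbb E_x[f(X_{t+s})|\mathcal F_s]=\mathbb E_{X_s}[f(X_t)]=\int_D f(\xi)p_t(X_s,d\xi)$ $\mathbb P_x$-a.s. for all $s,t\ge0$, $x\in D_\Delta$ and bounded measurable $f:D_\Delta\to\mathbb R$, where $(p_t)$ is a transition function: kernels $p_t:D_\Delta\times\mathcal D_\Delta\to[0,1]$ such that $p_t(x,\cdot)$ is a measure with $p_t(x,D)\le1$, $p_t(x,\{\Delta\})=1-p_t(x,D)$, $p_t(\Delta,\{\Delta\})=1$, $p_0(x,\cdot)=\delta_x$, $x\mapsto p_t(x,\Gamma)$ is measurable, and the Chapman–Kolmogorov equation holds. Affine processes. Such an $X$ is affine if (1) it is stochastically continuous: $\lim_{s\to t}p_s(x,\cdot)=p_t(x,\cdot)$ weakly on $D$ for all $t\ge0$, $x\in D$; (2) there are functions $\Phi:\mathbb R_+\times\mathcal U\to\mathbb C$, $\psi:\mathbb R_+\times\mathcal U\to V+\mathrm iV$ such that for every $x\in D$, $m\ge1$ the map $(t,u)\mapsto\langle\psi(t,u),x\rangle$ is locally continuous on the subset of $\mathbb R_+\times\mathcal U^m$ where $\Phi$ does not vanish, denoted $\mathcal Q^m=\{(t,u)\in\mathbb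 R_+\times\mathcal U^m:\Phi(s,u)\ne0\ \forall s\in[0,t]\}$, and $\mathbb E_x[e^{\langle u,X_t\rangle}]=\int_De^{\langle u,\xi\rangle}p_t(x,d\xi)=\Phi(t,u)e^{\langle\psi(t,u),x\rangle}$ for all $x\in D$, $(t,u)\in\mathbb R_+\times\mathcal U$. Augmentation and versions. $\mathcal F^x$ is the completion of $\mathcal F^0$ with respect to $\mathbb P_x$, and $\mathcal F_t^x=\sigma(\mathcal F_t^0,\mathcal N(\mathcal F^x))$ with $\mathcal N(\mathcal F^x)$ the $\mathbb P_x$-null sets in $\mathcal F^x$. $\widetilde X$ is a $\mathbb P_x$-version of $X$ if $\mathbb P_x[\widetilde X_t=X_t]=1$ for every $t\ge0$. *)

theory Defs
  imports "HOL-Probability.Probability"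
begin

section \<open>State space with cemetery\<close>

datatype 'v state = Pt 'v | Cemetery

definition cem :: "'v set \<Rightarrow> 'v state set" where
  "cem D = insert Cemetery (Pt ` D)"

(* The convention that functions on D vanish at the cemetery. *)
primrec zext :: "('v \<Rightarrow> 'b::zero) \<Rightarrow> 'v state \<Rightarrow> 'b" where
  "zext h (Pt x) = h x"
| "zext h Cemetery = 0"

definition cem_algebra :: "'v::topological_space set \<Rightarrow> 'v state measure" where
  "cem_algebra D =
     sigma (cem D) (insert {Cemetery} (image Pt ` sets (restrict_space borel D)))"

(* The cemetery is an isolated point; it differs from the point at infinity, which is
   added to this space by Alexandroff_compactification. *)
definition cem_topology :: "'v::topological_space set \<Rightarrow> 'v state topology" where
  "cem_topology D =
     topology (\<lambda>S. S \<subseteq> cem D \<and> openin (top_of_set D) (Pt -` S))"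

lemma istopology_cem:
  "istopology (\<lambda>S. S \<subseteq> cem D \<and> openin (top_of_set D) (Pt -` S))"
proof -
  have "openin (top_of_set D) (Pt -` \<Union>K)"
    if "\<forall>S\<in>K. openin (top_of_set D) (Pt -` S)" for K :: "'a state set set"
    using that by (auto simp: vimage_Union intro: openin_Union)
  then show ?thesis
    unfolding istopology_def by (auto intro: openin_Int)
qed

lemma openin_cem_topology:
  "openin (cem_topology D) S \<longleftrightarrow> S \<subseteq> cem D \<and> openin (top_of_set D) (Pt -` S)"
  by (simp add: cem_topology_def istopology_cem)

lemma topspace_cem_topology: "topspace (cem_topology D) = cem D"
proof -
  have "Pt -` cem D = D"
    by (auto simp: cem_def)
  then have "openin (cem_topology D) (cem D)"
    by (simp add: openin_cem_topology)
  then show ?thesis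
    unfolding topspace_def by (auto simp: openin_cem_topology)
qed

definition cadlag_in :: "'a topology \<Rightarrow> (real \<Rightarrow> 'a) \<Rightarrow> bool" where
  "cadlag_in T f \<longleftrightarrow>
     (\<forall>t\<ge>0. limitin T f (f t) (at_right t)) \<and>
     (\<forall>t>0. \<exists>l. limitin T f l (at_left t))"

(* A path in the cemetery-augmented state space is viewed as a path in its one-point
   compactification; the point at infinity is None. *)
definition cadlag_path :: "'v::topological_space set \<Rightarrow> (real \<Rightarrow> 'v state) \<Rightarrow> bool" where
  "cadlag_path D f \<longleftrightarrow>
     (if compact D then cadlag_in (cem_topology D) f
      else cadlag_in (Alexandroff_compactification (cem_topology D)) (\<lambda>t. Some (f t)))"


section \<open>Exponentials with complexified parameters\<close>

(* An element a + i b of the complexification V + i V is the pair (a, b). *)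
definition pairing :: "'v::real_inner \<times> 'v \<Rightarrow> 'v \<Rightarrow> complex" where
  "pairing u x = Complex (fst u \<bullet> x) (snd u \<bullet> x)"

definition U_set :: "'v::real_inner set \<Rightarrow> ('v \<times> 'v) set" where
  "U_set D = {u. bounded ((\<lambda>x. exp (pairing u x)) ` D)}"

definition U_level :: "'v::real_inner set \<Rightarrow> real \<Rightarrow> ('v \<times> 'v) set" where
  "U_level D m = {u. \<forall>x\<in>D. exp (fst u \<bullet> x) \<le> m}"

definition Q_level ::
    "'v::real_inner set \<Rightarrow> (real \<Rightarrow> 'v \<times> 'v \<Rightarrow> complex) \<Rightarrow> real \<Rightarrow> (real \<times> ('v \<times> 'v)) set" where
  "Q_level D \<Phi> m = {(t, u). 0 \<le> t \<and> u \<in> U_level D m \<and> (\<forall>s\<in>{0..t}. \<Phi> s u \<noteq> 0)}"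


section \<open>Filtrations\<close>

definition nat_filt ::
    "'v::topological_space set \<Rightarrow> 'w set \<Rightarrow> (real \<Rightarrow> 'w \<Rightarrow> 'v state) \<Rightarrow> real \<Rightarrow> 'w measure" where
  "nat_filt D \<Omega> X t =
     sigma \<Omega> {X s -` A \<inter> \<Omega> | s A. 0 \<le> s \<and> s \<le> t \<and> A \<in> sets (cem_algebra D)}"

definition nat_algebra ::
    "'v::topological_space set \<Rightarrow> 'w set \<Rightarrow> (real \<Rightarrow> 'w \<Rightarrow> 'v state) \<Rightarrow> 'w measure" where
  "nat_algebra D \<Omega> X =
     sigma \<Omega> {X s -` A \<inter> \<Omega> | s A. 0 \<le> s \<and> A \<in> sets (cem_algebra D)}"

definition aug_filt ::
    "'v::topological_space set \<Rightarrow> 'w set \<Rightarrow> ('v state \<Rightarrow> 'w measure) \<Rightarrow> (real \<Rightarrow> 'w \<Rightarrow> 'v state) \<Rightarrow>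
     'v state \<Rightarrow> real \<Rightarrow> 'w measure" where
  "aug_filt D \<Omega> P X x t =
     sigma \<Omega> (sets (nat_filt D \<Omega> X t) \<union> null_sets (completion (P x)))"


section \<open>Markov and affine processes\<close>

definition transition_function ::
    "'v::topological_space set \<Rightarrow> (real \<Rightarrow> 'v state \<Rightarrow> 'v state measure) \<Rightarrow> bool" where
  "transition_function D p \<longleftrightarrow>
     (\<forall>t\<ge>0. \<forall>x\<in>cem D. sets (p t x) = sets (cem_algebra D) \<and>
        emeasure (p t x) (Pt ` D) \<le> 1 \<and>
        emeasure (p t x) {Cemetery} = 1 - emeasure (p t x) (Pt ` D)) \<and>
     (\<forall>t\<ge>0. emeasure (p t Cemetery) {Cemetery} = 1) \<and>
     (\<forall>x\<in>cem D. p 0 x = return (cem_algebra D) x) \<and>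
     (\<forall>t\<ge>0. \<forall>\<Gamma>\<in>sets (cem_algebra D).
        (\<lambda>x. emeasure (p t x) \<Gamma>) \<in> borel_measurable (cem_algebra D)) \<and>
     (\<forall>s\<ge>0. \<forall>t\<ge>0. \<forall>x\<in>cem D. \<forall>\<Gamma>\<in>sets (cem_algebra D).
        emeasure (p (t + s) x) \<Gamma> = (\<integral>\<^sup>+\<xi>. emeasure (p t \<xi>) \<Gamma> \<partial>(p s x)))"

(* The filtration F x may depend on the initial state x, as the augmented ones do.
   Test functions f satisfy f Cemetery = 0, in accordance with the convention above. *)
definition markov_process ::
    "'v::topological_space set \<Rightarrow> 'w set \<Rightarrow> ('v state \<Rightarrow> 'w measure) \<Rightarrow>
     ('v state \<Rightarrow> real \<Rightarrow> 'w measure) \<Rightarrow> (real \<Rightarrow> 'w \<Rightarrow> 'v state) \<Rightarrow>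
     (real \<Rightarrow> 'v state \<Rightarrow> 'v state measure) \<Rightarrow> bool" where
  "markov_process D \<Omega> P F X p \<longleftrightarrow>
     transition_function D p \<and>
     (\<forall>s\<ge>0. \<forall>\<omega>\<in>\<Omega>. X s \<omega> \<in> cem D) \<and>
     (\<forall>s\<ge>0. \<forall>t\<ge>s. \<forall>\<omega>\<in>\<Omega>. X s \<omega> = Cemetery \<longrightarrow> X t \<omega> = Cemetery) \<and>
     (\<forall>x\<in>cem D. prob_space (P x) \<and> space (P x) = \<Omega> \<and>
        (\<forall>t\<ge>0. subalgebra (P x) (F x t)) \<and>
        (\<forall>s\<ge>0. \<forall>t\<ge>s. sets (F x s) \<subseteq> sets (F x t)) \<and>
        (\<forall>t\<ge>0. X t \<in> measurable (F x t) (cem_algebra D)) \<and>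
        (\<forall>s\<ge>0. \<forall>t\<ge>0. \<forall>f :: 'v state \<Rightarrow> real.
           f \<in> borel_measurable (cem_algebra D) \<longrightarrow> bounded (f ` cem D) \<longrightarrow> f Cemetery = 0 \<longrightarrow>
           (AE \<omega> in P x.
              real_cond_exp (P x) (F x s) (\<lambda>\<omega>'. f (X (t + s) \<omega>')) \<omega>
                = (\<integral>\<omega>'. f (X t \<omega>') \<partial>(P (X s \<omega>))) \<and>
              (\<integral>\<omega>'. f (X t \<omega>') \<partial>(P (X s \<omega>)))
                = set_lebesgue_integral (p t (X s \<omega>)) (Pt ` D) f)))"

(* Weak convergence on D is tested against bounded continuous functions. *)
definition stoch_continuous ::
    "'v::topological_space set \<Rightarrow> (real \<Rightarrow> 'v state \<Rightarrow> 'v state measure) \<Rightarrow> bool" where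
  "stoch_continuous D p \<longleftrightarrow>
     (\<forall>t\<ge>0. \<forall>x\<in>D. \<forall>g :: 'v \<Rightarrow> real. continuous_on D g \<longrightarrow> bounded (g ` D) \<longrightarrow>
        ((\<lambda>s. set_lebesgue_integral (p s (Pt x)) (Pt ` D) (zext g)) \<longlongrightarrow>
          set_lebesgue_integral (p t (Pt x)) (Pt ` D) (zext g)) (at t within {0..}))"

(* Local continuity on a set is continuity at each of its points, hence continuous_on. *)
definition affine_process ::
    "'v::euclidean_space set \<Rightarrow> 'w set \<Rightarrow> ('v state \<Rightarrow> 'w measure) \<Rightarrow>
     ('v state \<Rightarrow> real \<Rightarrow> 'w measure) \<Rightarrow> (real \<Rightarrow> 'w \<Rightarrow> 'v state) \<Rightarrow>
     (real \<Rightarrow> 'v state \<Rightarrow> 'v state measure) \<Rightarrow> bool" where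
  "affine_process D \<Omega> P F X p \<longleftrightarrow>
     markov_process D \<Omega> P F X p \<and>
     stoch_continuous D p \<and>
     (\<exists>(\<Phi> :: real \<Rightarrow> 'v \<times> 'v \<Rightarrow> complex) (\<psi> :: real \<Rightarrow> 'v \<times> 'v \<Rightarrow> 'v \<times> 'v).
        (\<forall>x\<in>D. \<forall>m\<ge>1. continuous_on (Q_level D \<Phi> m) (\<lambda>(t, u). pairing (\<psi> t u) x)) \<and>
        (\<forall>x\<in>D. \<forall>t\<ge>0. \<forall>u\<in>U_set D.
           (\<integral>\<omega>. zext (\<lambda>\<xi>. exp (pairing u \<xi>)) (X t \<omega>) \<partial>(P (Pt x)))
             = set_lebesgue_integral (p t (Pt x)) (Pt ` D) (zext (\<lambda>\<xi>. exp (pairing u \<xi>))) \<and>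
           set_lebesgue_integral (p t (Pt x)) (Pt ` D) (zext (\<lambda>\<xi>. exp (pairing u \<xi>)))
             = \<Phi> t u * exp (pairing (\<psi> t u) x)))"

end

theory Submission
  imports Defs
begin

text \<open>
The process is regularized by taking right limits along rational times. That these limits exist, and lie
in the augmented state space rather than at infinity, rests on the fact that an affine process is a
Feller process for small times: its transition operators are strongly continuous on the functions on \<open>D\<close>
that are continuous and vanish at infinity (\<open>feller_strongly_continuous\<close>), and uniformly for small times they map such
functions to functions vanishing at infinity (\<open>feller_vanishing\<close>).

The Feller property is obtained from the Fourier transforms of the transition kernels at purely
imaginary arguments, \<open>\<Phi> s v * exp \<langle>\<psi> s v, x\<rangle>\<close>. For small \<open>s\<close> the function \<open>\<Phi>\<close> does not vanish for \<open>v\<close> in a ball, and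
\<open>\<psi> s v\<close> is close to \<open>\<i> v\<close> up to a constant. Consequently the kernels are concentrated near their starting point,
uniformly for starting points in a bounded set. The behaviour at infinity is the deeper part
(\<open>vanishing_at_infinity\<close>): if the kernels of a sequence of starting points tending to infinity kept some mass in a
bounded set, then positive definiteness would force their projections to a line to be tight; their
Fourier transforms would be equicontinuous with moduli bounded below, so that their arguments would
change by a bounded amount only. But the argument is the pairing of the imaginary part of \<open>\<psi> s v\<close>, nearly \<open>v\<close>, with the
starting point, and it is unbounded.

Given the Feller property, let \<open>h\<close> vanish at infinity. The conditional expectations of \<open>h\<close> at a rational time \<open>T\<close>
form a bounded martingale, which oscillates only finitely often along rational times; the expected number of its
oscillations is bounded by an elementary argument with squares (\<open>greedy_count_expectation\<close>). By strong continuity it is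
uniformly close to \<open>h\<close> along the path when \<open>T\<close> is close, so \<open>h\<close> has one-sided limits along the path. Finitely many such
functions, stereographic coordinates, determine the states and their convergence. The path cannot enter from
infinity: the martingale of a strictly positive \<open>h\<close> would come arbitrarily close to 0 and yet end at a positive value,
which a nonnegative martingale does with probability 0 (\<open>positive_terminal_value_bounded_below\<close>).

The set of paths on which all this holds, and hence the regularized process, does not depend on the
initial state. It is a version of the given process because the coordinates are right-continuous in mean square. As
events and values change by null sets only, the Markov property and the affine formula carry
over to the completed measures and the augmented filtration.
\<close>

section \<open>Gaussian smoothing of characteristic functions\<close>

abbreviation "gauss \<equiv> std_normal_distribution"

lemma prob_space_gauss: "prob_space gauss"
  by (simp add: prob_space_normal_density)

text \<open>Averaging a characteristic function against a Gaussian amounts, by Fubini, to integrating a Gaussian: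
the oscillating integrand becomes a positive one. Lower bounds and tail bounds for masses are read off
characteristic functions in this way.\<close>

lemma integral_gaussian_char:
  fixes Y :: "'a \<Rightarrow> real"
  assumes "finite_measure M" and [measurable]: "Y \<in> borel_measurable M"
  shows "(CLINT w|gauss. CLINT x|M. iexp (w * Y x)) = complex_of_real (LINT x|M. exp (- (Y x)\<^sup>2 / 2))"
proof -
  interpret M: finite_measure M by fact
  interpret G: prob_space gauss by (rule prob_space_gauss)
  interpret P: pair_sigma_finite gauss M ..
  have "finite_measure (gauss \<Otimes>\<^sub>M M)"
    by (intro finite_measure_pair_measure) (auto intro: M.finite_measure_axioms G.finite_measure_axioms)
  then have int: "integrable (gauss \<Otimes>\<^sub>M M) (\<lambda>(w, x). iexp (w * Y x))"
    by (intro finite_measure.integrable_const_bound[where B=1]) (auto simp: case_prod_beta)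
  have "(CLINT w|gauss. CLINT x|M. iexp (w * Y x)) = (CLINT x|M. CLINT w|gauss. iexp (w * Y x))"
    using P.Fubini_integral[OF int] by simp
  also have "\<dots> = (CLINT x|M. complex_of_real (exp (- (Y x)\<^sup>2 / 2)))"
  proof (rule Bochner_Integration.integral_cong[OF refl])
    show "(CLINT w|gauss. iexp (w * Y x)) = complex_of_real (exp (- (Y x)\<^sup>2 / 2))" for x
      using fun_cong[OF char_std_normal_distribution, of "Y x"] by (simp add: char_def mult.commute)
  qed
  finally show ?thesis by simp
qed

lemma gauss_tail:
  assumes "\<eta> > 0"
  obtains W where "W > 0" "measure gauss {w. \<bar>w\<bar> > W} < \<eta>"
proof -
  interpret G: prob_space gauss by (rule prob_space_gauss)
  have "(\<lambda>n. measure gauss {w. \<bar>w\<bar> > real n}) \<longlonglongrightarrow> measure gauss (\<Inter>n. {w. \<bar>w\<bar> > real n})"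
    by (rule G.finite_Lim_measure_decseq) (auto simp: decseq_def)
  also have "(\<Inter>n. {w::real. \<bar>w\<bar> > real n}) = {}"
    by (auto simp: not_less) (meson not_less real_arch_simple)
  finally have "(\<lambda>n. measure gauss {w. \<bar>w\<bar> > real n}) \<longlonglongrightarrow> 0" by simp
  from order_tendstoD(2)[OF this assms] obtain N where N: "\<And>n. n \<ge> N \<Longrightarrow> measure gauss {w. \<bar>w\<bar> > real n} < \<eta>"
    by (auto simp: eventually_sequentially)
  show ?thesis by (rule that[of "real (Suc N)"]) (use N[of "Suc N"] in auto)
qed

lemma norm_iexp_diff_le: "norm (iexp a - iexp b) \<le> \<bar>a - b\<bar>"
proof -
  have "norm (iexp a - iexp b) = norm (iexp b * (iexp (a - b) - 1))"
    by (simp add: algebra_simps flip: exp_add)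
  also have "\<dots> = norm (iexp (a - b) - 1)"
    by (simp only: norm_mult norm_exp_i_times)
  also have "\<dots> \<le> \<bar>a - b\<bar>"
    using iexp_approx1[of "a - b" 0] by simp
  finally show ?thesis .
qed

text \<open>Rotating by the phase \<open>a\<close> of \<open>\<phi> v\<close> turns the defect \<open>m - norm (\<phi> v)\<close> into the integral of
\<open>1 - cos (v * Y - a)\<close>. The bound then follows from the inequality
\<open>1 - cos (s + t) \<le> 2 * (1 - cos s) + 2 * (1 - cos t)\<close>, because the phases add up.\<close>

lemma char_defect_subadditive:
  fixes Y :: "'a \<Rightarrow> real"
  assumes "finite_measure M" and [measurable]: "Y \<in> borel_measurable M"
  defines "m \<equiv> measure M (space M)" and "\<phi> \<equiv> \<lambda>w. CLINT x|M. iexp (w * Y x)"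
  shows "m - norm (\<phi> (v + w)) \<le> 2 * (m - norm (\<phi> v)) + 2 * (m - norm (\<phi> w))"
proof -
  interpret M: finite_measure M by fact
  have int: "integrable M (\<lambda>x. iexp (u * Y x - a))" for u a
    by (intro M.integrable_const_bound[where B=1]) (auto simp del: of_real_diff)
  have intc: "integrable M (\<lambda>x. cos (u * Y x - a))" for u a
    by (intro M.integrable_const_bound[where B=1]) auto
  have Re: "(LINT x|M. cos (u * Y x - a)) = Re (iexp (- a) * \<phi> u)" for u a
  proof -
    have "iexp (- a) * \<phi> u = (CLINT x|M. iexp (u * Y x - a))"
      unfolding \<phi>_def by (subst integral_mult_right_zero[symmetric])
        (auto simp: exp_diff exp_minus field_simps intro!: Bochner_Integration.integral_cong)
    then have "Re (iexp (- a) * \<phi> u) = (LINT x|M. Re (iexp (u * Y x - a)))"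
      using int[of u a] by (simp add: integral_Re)
    then show ?thesis by (simp add: Re_exp)
  qed
  have phase: "\<exists>a. (LINT x|M. cos (u * Y x - a)) = norm (\<phi> u)" for u
  proof (intro exI)
    let ?a = "Arg (\<phi> u)"
    have "\<phi> u = norm (\<phi> u) * iexp ?a"
      by (metis Arg_zero cis_Arg cis_conv_exp mult_zero_left norm_zero of_real_0 rcis_cmod_Arg rcis_def)
    then have "iexp (- ?a) * \<phi> u = norm (\<phi> u) * (iexp (- ?a) * iexp ?a)"
      by (metis mult.assoc mult.commute)
    also have "iexp (- ?a) * iexp ?a = 1"
      by (simp flip: exp_add)
    finally show "(LINT x|M. cos (u * Y x - ?a)) = norm (\<phi> u)"
      unfolding Re by simp
  qed
  obtain a where a: "(LINT x|M. cos (v * Y x - a)) = norm (\<phi> v)" using phase by blast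
  obtain b where b: "(LINT x|M. cos (w * Y x - b)) = norm (\<phi> w)" using phase by blast
  have cos_sum: "1 - cos (s + t) \<le> 2 * (1 - cos s) + 2 * (1 - cos t)" for s t :: real
  proof -
    have "sin s * sin t \<le> 1 - cos s * cos t + (1 - cos s) * (1 - cos t)"
    proof -
      have "2 * (sin s * sin t) \<le> (sin s)\<^sup>2 + (sin t)\<^sup>2"
        using sum_squares_bound[of "sin s" "sin t"] by simp
      moreover have "(sin s)\<^sup>2 = 1 - (cos s)\<^sup>2" "(sin t)\<^sup>2 = 1 - (cos t)\<^sup>2"
        by (simp_all add: sin_squared_eq)
      moreover have "2 * cos s \<le> 1 + (cos s)\<^sup>2" "2 * cos t \<le> 1 + (cos t)\<^sup>2"
        using sum_squares_bound[of 1 "cos s"] sum_squares_bound[of 1 "cos t"] by simp_all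
      ultimately have "sin s * sin t \<le> 2 - cos s - cos t"
        by linarith
      then show ?thesis by (simp add: algebra_simps)
    qed
    moreover have "(1 - cos s) * (1 - cos t) \<ge> 0" by simp
    ultimately show ?thesis by (simp add: cos_add algebra_simps)
  qed
  have "m - norm (\<phi> (v + w)) \<le> m - (LINT x|M. cos ((v + w) * Y x - (a + b)))"
  proof -
    have "Re (iexp (- (a + b)) * \<phi> (v + w)) \<le> norm (iexp (- (a + b)) * \<phi> (v + w))"
      by (rule complex_Re_le_cmod)
    also have "\<dots> = norm (\<phi> (v + w))"
      by (simp only: norm_mult norm_exp_i_times mult_1)
    finally show ?thesis by (simp only: Re diff_left_mono)
  qed
  also have "\<dots> = (LINT x|M. 1 - cos ((v * Y x - a) + (w * Y x - b)))"
  proof -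
    have *: "(v * Y x - a) + (w * Y x - b) = (v + w) * Y x - (a + b)" for x
      by (simp add: algebra_simps)
    show ?thesis
      unfolding * using intc[of "v + w" "a + b"] by (simp add: m_def)
  qed
  also have "\<dots> \<le> (LINT x|M. 2 * (1 - cos (v * Y x - a)) + 2 * (1 - cos (w * Y x - b)))"
  proof (rule integral_mono)
    have *: "(v * Y x - a) + (w * Y x - b) = (v + w) * Y x - (a + b)" for x
      by (simp add: algebra_simps)
    show "integrable M (\<lambda>x. 1 - cos ((v * Y x - a) + (w * Y x - b)))"
      unfolding * using intc[of "v + w" "a + b"] by simp
  qed (use intc[of v a] intc[of w b] cos_sum in auto)
  also have "\<dots> = 2 * (m - norm (\<phi> v)) + 2 * (m - norm (\<phi> w))"
    using intc[of v a] intc[of w b] a b by (simp add: m_def)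
  finally show ?thesis .
qed

lemma exp_minus_2_le_half: "exp (- 2 :: real) \<le> 1 / 2"
proof -
  have "1 + (2::real) \<le> exp 2" by (rule exp_ge_add_one_self)
  then show ?thesis by (simp add: exp_minus field_simps)
qed

text \<open>Where \<open>\<bar>Y\<bar> \<ge> 2 / \<tau>\<close>, the function \<open>1 - exp (- (\<tau> * Y)\<^sup>2 / 2)\<close> is at least \<open>1 - exp (- 2) \<ge> 1 / 2\<close>.\<close>

lemma measure_tail_le_gaussian:
  fixes Y :: "'a \<Rightarrow> real"
  assumes "finite_measure M" and [measurable]: "Y \<in> borel_measurable M" and "\<tau> > 0"
  shows "measure M {x \<in> space M. \<bar>Y x\<bar> \<ge> 2 / \<tau>}
           \<le> 2 * (measure M (space M) - Re (CLINT w|gauss. CLINT x|M. iexp (w * (\<tau> * Y x))))"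
proof -
  interpret M: finite_measure M by fact
  let ?g = "\<lambda>x. exp (- (\<tau> * Y x)\<^sup>2 / 2)"
  have int: "integrable M ?g"
    by (intro M.integrable_const_bound[where B=1]) auto
  have "Re (CLINT w|gauss. CLINT x|M. iexp (w * (\<tau> * Y x))) = (LINT x|M. ?g x)"
    using integral_gaussian_char[OF assms(1), of "\<lambda>x. \<tau> * Y x"] by simp
  then have "2 * (measure M (space M) - Re (CLINT w|gauss. CLINT x|M. iexp (w * (\<tau> * Y x))))
      = (LINT x|M. 2 * (1 - ?g x))"
    using int by simp
  also have "\<dots> \<ge> (LINT x|M. indicator {x \<in> space M. \<bar>Y x\<bar> \<ge> 2 / \<tau>} x)"
  proof (rule integral_mono)
    show "indicator {x \<in> space M. \<bar>Y x\<bar> \<ge> 2 / \<tau>} x \<le> 2 * (1 - ?g x)" if x: "x \<in> space M" for x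
    proof (cases "\<bar>Y x\<bar> \<ge> 2 / \<tau>")
      case True
      then have "2 \<le> \<bar>\<tau> * Y x\<bar>"
        using \<open>\<tau> > 0\<close> by (simp add: abs_mult field_simps)
      then have "2\<^sup>2 \<le> (\<tau> * Y x)\<^sup>2"
        by (metis abs_numeral power2_le_iff_abs_le abs_ge_zero abs_le_square_iff)
      then have "?g x \<le> exp (- 2)" by simp
      then have "?g x \<le> 1 / 2" using exp_minus_2_le_half by (rule order_trans)
      then show ?thesis using x True by (simp add: indicator_def)
    qed (simp add: indicator_def)
    show "integrable M (\<lambda>x. indicator {x \<in> space M. \<bar>Y x\<bar> \<ge> 2 / \<tau>} x :: real)"
      by (intro M.integrable_const_bound[where B=1]) (auto simp: indicator_def)
  qed (use int in auto)
  finally show ?thesis by simp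
qed

section \<open>Limits of moduli of characteristic functions\<close>

text \<open>Sub-probability measures on the line, all of which charge a fixed interval with mass \<open>e\<close>, such that the
moduli of their characteristic functions converge on \<open>[0, 1]\<close> to a positive continuous function on a
closed set \<open>E\<close> and to 0 off \<open>E\<close>. Moduli of the form \<open>norm (\<Phi> w) * exp (r w \<bullet> x\<^sub>k)\<close> with an unbounded
sequence \<open>x\<^sub>k\<close> behave like this. The outcome is that \<open>E\<close> is the whole interval and that the measures are
tight: positive definiteness does not allow the limit to jump to 0.\<close>

locale modulus_limit =
  fixes \<mu> :: "nat \<Rightarrow> real measure" and E :: "real set" and \<gamma> :: "real \<Rightarrow> real" and a e :: real
  assumes fin: "\<And>k. finite_measure (\<mu> k)"
    and sets_mu [measurable_cong, simp]: "\<And>k. sets (\<mu> k) = sets borel"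
    and mass: "\<And>k. measure (\<mu> k) UNIV \<le> 1"
    and core: "\<And>k. measure (\<mu> k) {-a..a} \<ge> e" and e: "e > 0"
    and \<gamma>_cont: "continuous_on {0..1} \<gamma>" and \<gamma>_pos: "\<And>w. w \<in> {0..1} \<Longrightarrow> \<gamma> w > 0"
    and E: "E \<subseteq> {0..1}" "closed E"
    and lim: "\<And>w. w \<in> {0..1} \<Longrightarrow> (\<lambda>k. norm (char (\<mu> k) w)) \<longlonglongrightarrow> (if w \<in> E then \<gamma> w else 0)"
begin

definition "f w = (if w \<in> E then \<gamma> w else 0)"

lemma space_mu [simp]: "space (\<mu> k) = UNIV"
  using sets_eq_imp_space_eq[OF sets_mu] by simp

lemma lim_f: "w \<in> {0..1} \<Longrightarrow> (\<lambda>k. norm (char (\<mu> k) w)) \<longlonglongrightarrow> f w"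
  using lim by (simp add: f_def)

lemma int_iexp: "integrable (\<mu> k) (\<lambda>y. iexp (w * y))"
  by (intro finite_measure.integrable_const_bound[where B=1] fin) auto

lemma char_minus: "char (\<mu> k) (- w) = cnj (char (\<mu> k) w)"
proof -
  have "cnj (char (\<mu> k) w) = (CLINT y|\<mu> k. cnj (iexp (w * y)))"
    unfolding char_def by (rule Bochner_Integration.integral_cnj[symmetric])
  also have "\<dots> = char (\<mu> k) (- w)"
    unfolding char_def by (simp add: exp_cnj)
  finally show ?thesis ..
qed

lemma norm_char_abs: "norm (char (\<mu> k) \<bar>w\<bar>) = norm (char (\<mu> k) w)"
  by (cases "w \<ge> 0") (simp_all add: char_minus)

lemma char_zero: "char (\<mu> k) 0 = measure (\<mu> k) UNIV"
  by (simp add: char_def scaleR_conv_of_real)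

lemma norm_char_le: "norm (char (\<mu> k) w) \<le> 1"
proof -
  have "norm (char (\<mu> k) w) \<le> (LINT y|\<mu> k. norm (iexp (w * y)))"
    unfolding char_def by (rule integral_norm_bound)
  also have "\<dots> = measure (\<mu> k) UNIV"
    by (simp only: norm_exp_i_times) simp
  finally show ?thesis using mass[of k] by simp
qed

lemma char_cont: "continuous_on UNIV (char (\<mu> k))"
  unfolding continuous_on_eq_continuous_within
proof (safe, unfold continuous_within_sequentially, safe)
  fix t X assume X: "X \<longlonglongrightarrow> (t::real)"
  show "(char (\<mu> k) \<circ> X) \<longlonglongrightarrow> char (\<mu> k) t"
    unfolding comp_def char_def
    by (rule integral_dominated_convergence[where w="\<lambda>_. 1"])
       (auto intro!: tendsto_intros X finite_measure.integrable_const fin)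
qed

lemma char_meas [measurable]: "char (\<mu> k) \<in> borel_measurable borel"
  by (rule borel_measurable_continuous_onI[OF char_cont])

lemma gauss_char:
  "(CLINT w|gauss. char (\<mu> k) (\<tau> * w)) = complex_of_real (LINT y|\<mu> k. exp (- (\<tau> * y)\<^sup>2 / 2))"
  using integral_gaussian_char[OF fin, of "\<lambda>y. \<tau> * y" k] by (simp add: char_def mult_ac)

lemma f_le_1: "w \<in> {0..1} \<Longrightarrow> f w \<le> 1"
  using norm_char_le by (intro LIMSEQ_le_const2[OF lim_f]) auto

lemma zero_in_E: "0 \<in> E"
proof -
  have "e \<le> norm (char (\<mu> k) 0)" for k
  proof -
    interpret finite_measure "\<mu> k" by (rule fin)
    have "e \<le> measure (\<mu> k) UNIV"
      using core[of k] finite_measure_mono[of "{-a..a}" UNIV] by simp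
    then show ?thesis by (simp add: char_zero)
  qed
  then have "e \<le> f 0"
    by (intro LIMSEQ_le_const[OF lim_f]) auto
  then show ?thesis using e by (auto simp: f_def split: if_splits)
qed

lemma f_zero: "f 0 = \<gamma> 0"
  using zero_in_E by (simp add: f_def)

lemma f_subadditive:
  assumes "v \<in> {0..1}" "w \<in> {0..1}" "v + w \<in> {0..1}"
  shows "f 0 - f (v + w) \<le> 2 * (f 0 - f v) + 2 * (f 0 - f w)"
proof (rule LIMSEQ_le)
  let ?n = "\<lambda>k w. norm (char (\<mu> k) w)"
  show "(\<lambda>k. ?n k 0 - ?n k (v + w)) \<longlonglongrightarrow> f 0 - f (v + w)"
    using assms by (intro tendsto_intros lim_f) auto
  show "(\<lambda>k. 2 * (?n k 0 - ?n k v) + 2 * (?n k 0 - ?n k w)) \<longlonglongrightarrow> 2 * (f 0 - f v) + 2 * (f 0 - f w)"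
    using assms by (intro tendsto_intros lim_f) auto
  have "?n k 0 - ?n k (v + w) \<le> 2 * (?n k 0 - ?n k v) + 2 * (?n k 0 - ?n k w)" for k
    using char_defect_subadditive[OF fin, of "\<lambda>y. y" k v w]
    by (simp add: char_zero) (simp add: char_def)
  then show "\<exists>N. \<forall>k\<ge>N. ?n k 0 - ?n k (v + w) \<le> 2 * (?n k 0 - ?n k v) + 2 * (?n k 0 - ?n k w)"
    by blast
qed

text \<open>If the limit vanished on \<open>(0, \<rho>]\<close>, then the averages of the characteristic functions against a Gaussian of
small variance would become small. But these averages are integrals of a Gaussian, which the mass \<open>e\<close>
near the origin keeps away from 0.\<close>

lemma E_small_elements:
  assumes "\<rho> > 0"
  shows "\<exists>w\<in>E. 0 < w \<and> w \<le> \<rho>"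
proof (rule ccontr)
  assume none: "\<not> ?thesis"
  interpret G: prob_space gauss by (rule prob_space_gauss)
  define \<rho>' where "\<rho>' = min \<rho> 1"
  have \<rho>': "0 < \<rho>'" "\<rho>' \<le> 1" "\<rho>' \<le> \<rho>" using assms by (auto simp: \<rho>'_def)
  obtain W where W: "W > 0" "measure gauss {w. \<bar>w\<bar> > W} < e / 2"
    using gauss_tail[of "e / 2"] e by auto
  \<comment> \<open>The first bound keeps the Gaussian above 1/2 on the core, the second one keeps \<open>\<tau> * w\<close> in \<open>[-\<rho>', \<rho>']\<close> for \<open>\<bar>w\<bar> \<le> W\<close>.\<close>
  define \<tau> where "\<tau> = min (1 / (\<bar>a\<bar> + 1)) (\<rho>' / W)"
  have \<tau>: "\<tau> > 0" "\<tau> * \<bar>a\<bar> \<le> 1" "\<tau> * W \<le> \<rho>'"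
  proof -
    show "\<tau> > 0" using \<rho>' W by (simp add: \<tau>_def)
    have "\<tau> * \<bar>a\<bar> \<le> (1 / (\<bar>a\<bar> + 1)) * \<bar>a\<bar>"
      by (intro mult_right_mono) (auto simp: \<tau>_def)
    also have "\<dots> \<le> 1" by (simp add: field_simps)
    finally show "\<tau> * \<bar>a\<bar> \<le> 1" .
    have "\<tau> * W \<le> (\<rho>' / W) * W"
      using W by (intro mult_right_mono) (auto simp: \<tau>_def)
    then show "\<tau> * W \<le> \<rho>'" using W by simp
  qed
  let ?I = "\<lambda>k. LINT w|gauss. indicator {-W..W} w * norm (char (\<mu> k) (\<tau> * w))"
  have low: "e / 2 \<le> ?I k + measure gauss {w. \<bar>w\<bar> > W}" for k
  proof -
    interpret M: finite_measure "\<mu> k" by (rule fin)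
    have half: "1 / 2 \<le> exp (- (1 / 2) :: real)"
      using exp_ge_add_one_self[of "- (1/2)"] by simp
    have "e / 2 \<le> measure (\<mu> k) {-a..a} * (1 / 2)"
      using core[of k] by simp
    also have "\<dots> = (LINT y|\<mu> k. indicator {-a..a} y * (1 / 2))"
      by simp
    also have "\<dots> \<le> (LINT y|\<mu> k. exp (- (\<tau> * y)\<^sup>2 / 2))"
    proof (rule integral_mono)
      show "integrable (\<mu> k) (\<lambda>y. exp (- (\<tau> * y)\<^sup>2 / 2))"
        by (intro M.integrable_const_bound[where B=1]) auto
      show "indicator {-a..a} y * (1 / 2) \<le> exp (- (\<tau> * y)\<^sup>2 / 2)" for y :: real
      proof (cases "y \<in> {-a..a}")
        case True
        then have "\<bar>\<tau> * y\<bar> \<le> \<tau> * \<bar>a\<bar>"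
          using \<tau> by (auto simp: abs_mult)
        then have "\<bar>\<tau> * y\<bar> \<le> 1" using \<tau> by linarith
        then have "(\<tau> * y)\<^sup>2 \<le> 1"
          by (metis abs_square_le_1)
        then have "exp (- (1 / 2)) \<le> exp (- (\<tau> * y)\<^sup>2 / 2)" by simp
        with half have "1 / 2 \<le> exp (- (\<tau> * y)\<^sup>2 / 2)" by (rule order_trans)
        then show ?thesis using True by simp
      qed simp
      show "integrable (\<mu> k) (\<lambda>y. indicator {-a..a} y * (1 / 2 :: real))"
        by (intro M.integrable_const_bound[where B=1]) (auto simp: indicator_def)
    qed
    also have "\<dots> = norm (CLINT w|gauss. char (\<mu> k) (\<tau> * w))"
      unfolding gauss_char norm_of_real by (intro abs_of_nonneg[symmetric] Bochner_Integration.integral_nonneg) auto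
    also have "\<dots> \<le> (LINT w|gauss. norm (char (\<mu> k) (\<tau> * w)))"
      by (rule integral_norm_bound)
    also have "\<dots> \<le> (LINT w|gauss. indicator {-W..W} w * norm (char (\<mu> k) (\<tau> * w)) + indicator {w. \<bar>w\<bar> > W} w)"
    proof (rule integral_mono)
      show "integrable gauss (\<lambda>w. norm (char (\<mu> k) (\<tau> * w)))"
        using norm_char_le by (intro G.integrable_const_bound[where B=1]) auto
      show "integrable gauss (\<lambda>w. indicator {-W..W} w * norm (char (\<mu> k) (\<tau> * w)) + indicator {w. \<bar>w\<bar> > W} w)"
        using norm_char_le by (intro G.integrable_const_bound[where B=2]) (auto simp: indicator_def intro!: add_mono order_trans[OF norm_char_le])
    qed (use norm_char_le in \<open>auto simp: indicator_def\<close>)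
    also have "\<dots> = ?I k + measure gauss {w. \<bar>w\<bar> > W}"
    proof (subst Bochner_Integration.integral_add)
      show "integrable gauss (\<lambda>w. indicator {-W..W} w * norm (char (\<mu> k) (\<tau> * w)))"
        using norm_char_le by (intro G.integrable_const_bound[where B=1]) (auto simp: indicator_def)
      show "integrable gauss (indicator {w. \<bar>w\<bar> > W} :: real \<Rightarrow> real)"
        by (intro G.integrable_const_bound[where B=1]) (auto simp: indicator_def)
    qed auto
    finally show ?thesis .
  qed
  have "?I \<longlonglongrightarrow> (LINT w|gauss. 0)"
  proof (rule integral_dominated_convergence[where w="\<lambda>_. 1"])
    have "AE w in lborel. w \<noteq> (0::real)"
      by (rule AE_lborel_singleton)
    then have "AE w in gauss. w \<noteq> 0"
      by (subst AE_density) auto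
    then show "AE w in gauss. (\<lambda>k. indicator {-W..W} w * norm (char (\<mu> k) (\<tau> * w))) \<longlonglongrightarrow> 0"
    proof eventually_elim
      case (elim w)
      show ?case
      proof (cases "w \<in> {-W..W}")
        case True
        then have "\<bar>\<tau> * w\<bar> \<le> \<tau> * W" using \<tau> by (auto simp: abs_mult)
        then have *: "0 < \<bar>\<tau> * w\<bar>" "\<bar>\<tau> * w\<bar> \<le> \<rho>'" using \<tau> elim by auto
        then have "\<bar>\<tau> * w\<bar> \<notin> E" using none \<rho>' by force
        then have "(\<lambda>k. norm (char (\<mu> k) \<bar>\<tau> * w\<bar>)) \<longlonglongrightarrow> 0"
          using lim_f[of "\<bar>\<tau> * w\<bar>"] * \<rho>' by (simp add: f_def)
        then show ?thesis
          unfolding norm_char_abs by (rule tendsto_mult_right_zero)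
      qed simp
    qed
  qed (use norm_char_le in \<open>auto simp: indicator_def\<close>)
  then have "(\<lambda>k. ?I k + measure gauss {w. \<bar>w\<bar> > W}) \<longlonglongrightarrow> 0 + measure gauss {w. \<bar>w\<bar> > W}"
    by (intro tendsto_intros) simp
  then have "e / 2 \<le> 0 + measure gauss {w. \<bar>w\<bar> > W}"
    by (rule LIMSEQ_le_const) (use low in auto)
  with W show False by simp
qed

text \<open>Near 0 the function \<open>\<gamma>\<close> is close to \<open>\<gamma> 0\<close>, and subadditivity of the defect prevents the limit from
vanishing at a sum of two elements of \<open>E\<close>. So \<open>E\<close> is a closed local semigroup with arbitrarily small
positive elements, and their multiples are dense in an interval.\<close>

lemma E_contains_interval: "\<exists>\<rho>\<in>{0<..1}. {0..\<rho>} \<subseteq> E"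
proof -
  obtain \<rho> where \<rho>: "\<rho> > 0" "\<rho> \<le> 1" and close: "\<And>w. w \<in> {0..\<rho>} \<Longrightarrow> \<gamma> w \<ge> 7 / 8 * \<gamma> 0"
  proof -
    have pos: "\<gamma> 0 / 8 > 0" using \<gamma>_pos[of 0] by simp
    then obtain d where d: "d > 0" "\<And>w. w \<in> {0..1} \<Longrightarrow> dist w 0 < d \<Longrightarrow> dist (\<gamma> w) (\<gamma> 0) < \<gamma> 0 / 8"
      using \<gamma>_cont[unfolded continuous_on_iff, rule_format, of 0 "\<gamma> 0 / 8"] by auto
    show ?thesis
    proof (rule that[of "min (d / 2) 1"])
      fix w assume w: "w \<in> {0..min (d / 2) 1}"
      then have "dist (\<gamma> w) (\<gamma> 0) < \<gamma> 0 / 8"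
        using d by (intro d) (auto simp: dist_real_def)
      then show "\<gamma> w \<ge> 7 / 8 * \<gamma> 0" unfolding dist_real_def by linarith
    qed (use d in auto)
  qed
  have add: "v + w \<in> E" if "v \<in> E" "w \<in> E" "v \<ge> 0" "w \<ge> 0" "v + w \<le> \<rho>" for v w
  proof (rule ccontr)
    assume "v + w \<notin> E"
    then have "f (v + w) = 0" by (simp add: f_def)
    moreover have "f v \<ge> 7 / 8 * \<gamma> 0" "f w \<ge> 7 / 8 * \<gamma> 0"
      using that close[of v] close[of w] by (auto simp: f_def)
    moreover have "f 0 - f (v + w) \<le> 2 * (f 0 - f v) + 2 * (f 0 - f w)"
      using that \<rho> by (intro f_subadditive) auto
    ultimately show False using \<gamma>_pos[of 0] by (simp add: f_zero)
  qed
  have mult: "real j * w \<in> E" if "w \<in> E" "w \<ge> 0" "real j * w \<le> \<rho>" for w j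
    using that
  proof (induction j)
    case (Suc j)
    have le: "real j * w \<le> real (Suc j) * w" using Suc.prems by (intro mult_right_mono) auto
    have "real j * w + w \<in> E"
    proof (rule add)
      show "real j * w \<in> E" using Suc le by simp
      show "real j * w + w \<le> \<rho>" using Suc.prems by (simp add: algebra_simps)
    qed (use Suc.prems in auto)
    then show ?case by (simp add: algebra_simps)
  qed (simp add: zero_in_E)
  have "w \<in> E" if w: "w \<in> {0..\<rho>}" for w
  proof (rule ccontr)
    assume "w \<notin> E"
    moreover have "closure E = E" using E by simp
    ultimately have "w \<notin> closure E" by simp
    then obtain d where d: "d > 0" "\<And>v. v \<in> E \<Longrightarrow> dist v w \<ge> d"
      unfolding closure_approachable by (auto simp: not_less)
    obtain u where u: "u \<in> E" "0 < u" "u \<le> d / 2"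
      using E_small_elements[of "d / 2"] d by auto
    define j where "j = nat \<lfloor>w / u\<rfloor>"
    have "real j = of_int \<lfloor>w / u\<rfloor>" using u w by (simp add: j_def)
    then have "real j \<le> w / u" "w / u < real j + 1" by linarith+
    then have j: "real j * u \<le> w" "w < real j * u + u" using u by (simp_all add: field_simps)
    then have "real j * u \<in> E" using u w by (intro mult) auto
    from d(2)[OF this] have "d \<le> \<bar>real j * u - w\<bar>" by (simp add: dist_real_def)
    then show False using j u d by linarith
  qed
  then show ?thesis using \<rho> by (intro bexI[of _ \<rho>]) auto
qed

text \<open>The squared modulus is the characteristic function of the symmetrized measure, the law of the difference
of two independent copies.\<close>

lemma gauss_char_sq:
  "(CLINT w|gauss. CLINT z|(\<mu> k \<Otimes>\<^sub>M \<mu> k). iexp (w * (\<tau> * (fst z - snd z))))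
     = complex_of_real (LINT w|gauss. (norm (char (\<mu> k) (\<tau> * w)))\<^sup>2)"
proof -
  interpret M: finite_measure "\<mu> k" by (rule fin)
  interpret PP: pair_sigma_finite "\<mu> k" "\<mu> k" ..
  have finP: "finite_measure (\<mu> k \<Otimes>\<^sub>M \<mu> k)"
    by (intro finite_measure_pair_measure fin)
  have "(CLINT z|(\<mu> k \<Otimes>\<^sub>M \<mu> k). iexp (w * (\<tau> * (fst z - snd z)))) = complex_of_real ((norm (char (\<mu> k) (\<tau> * w)))\<^sup>2)" for w
  proof -
    have int: "integrable (\<mu> k \<Otimes>\<^sub>M \<mu> k) (\<lambda>(x, y). iexp ((\<tau> * w) * x) * iexp (- (\<tau> * w) * y))"
    proof (rule finite_measure.integrable_const_bound[OF finP, where B=1])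
      have "norm (iexp ((\<tau> * w) * x) * iexp (- (\<tau> * w) * y)) = 1" for x y
        by (simp only: norm_mult norm_exp_i_times)
      then show "AE z in \<mu> k \<Otimes>\<^sub>M \<mu> k. norm (case z of (x, y) \<Rightarrow> iexp ((\<tau> * w) * x) * iexp (- (\<tau> * w) * y)) \<le> 1"
        by (intro AE_I2) (simp only: case_prod_beta order_refl)
    qed (simp add: case_prod_beta)
    have "(CLINT z|(\<mu> k \<Otimes>\<^sub>M \<mu> k). iexp (w * (\<tau> * (fst z - snd z))))
        = (CLINT z|(\<mu> k \<Otimes>\<^sub>M \<mu> k). (case z of (x, y) \<Rightarrow> iexp ((\<tau> * w) * x) * iexp (- (\<tau> * w) * y)))"
      by (intro Bochner_Integration.integral_cong refl) (simp add: case_prod_beta algebra_simps flip: exp_add)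
    also have "\<dots> = (CLINT x|\<mu> k. CLINT y|\<mu> k. iexp ((\<tau> * w) * x) * iexp (- (\<tau> * w) * y))"
      using PP.integral_fst'[OF int] by simp
    also have "\<dots> = char (\<mu> k) (\<tau> * w) * char (\<mu> k) (- (\<tau> * w))"
      by (simp only: integral_mult_right_zero integral_mult_left_zero char_def)
    also have "\<dots> = complex_of_real ((norm (char (\<mu> k) (\<tau> * w)))\<^sup>2)"
      by (simp only: char_minus complex_norm_square)
    finally show ?thesis .
  qed
  then show ?thesis by (simp only: integral_complex_of_real)
qed

text \<open>The squared moduli have a limit that is continuous near 0, so the symmetrized measures are tight. One of
the two copies lies in the core \<open>[- \<bar>a\<bar>, \<bar>a\<bar>]\<close> with mass at least \<open>e\<close>; if the other copy is far out, then so is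
the difference.\<close>

lemma tight:
  assumes "\<eta> > 0"
  shows "\<exists>B. \<forall>\<^sub>F k in sequentially. measure (\<mu> k) {y. \<bar>y\<bar> > B} \<le> \<eta>"
proof -
  interpret G: prob_space gauss by (rule prob_space_gauss)
  obtain \<rho> where \<rho>: "0 < \<rho>" "\<rho> \<le> 1" "{0..\<rho>} \<subseteq> E" using E_contains_interval by auto
  \<comment> \<open>Three errors of size \<open>\<eta>'\<close>, a factor 2 from the tail bound and the division by \<open>e\<close> add up to \<open>\<eta>\<close>.\<close>
  define \<eta>' where "\<eta>' = e * \<eta> / 6"
  have \<eta>': "\<eta>' > 0" using e assms by (simp add: \<eta>'_def)
  obtain W where W: "W > 0" "measure gauss {w. \<bar>w\<bar> > W} < \<eta>'"
    using gauss_tail[OF \<eta>'] by auto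
  have "continuous_on {0..1} (\<lambda>w. (\<gamma> w)\<^sup>2)"
    by (intro continuous_intros \<gamma>_cont)
  then obtain d where d: "d > 0" "\<And>w. w \<in> {0..1} \<Longrightarrow> dist w 0 < d \<Longrightarrow> dist ((\<gamma> w)\<^sup>2) ((\<gamma> 0)\<^sup>2) < \<eta>'"
    using \<eta>' unfolding continuous_on_iff by (metis atLeastAtMost_iff order_refl zero_le_one)
  define \<tau> where "\<tau> = min \<rho> (d / 2) / W"
  have \<tau>: "\<tau> > 0" "\<tau> * W \<le> \<rho>" "\<tau> * W < d"
    using W d \<rho> by (auto simp: \<tau>_def)
  let ?J = "\<lambda>k. LINT w|gauss. indicator {-W..W} w * (norm (char (\<mu> k) (\<tau> * w)))\<^sup>2"
  let ?J' = "LINT w|gauss. indicator {-W..W} w * (\<gamma> \<bar>\<tau> * w\<bar>)\<^sup>2"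
  have in_range: "\<bar>\<tau> * w\<bar> \<in> {0..\<rho>}" "\<bar>\<tau> * w\<bar> < d" if "w \<in> {-W..W}" for w
  proof -
    have "\<bar>\<tau> * w\<bar> \<le> \<tau> * W" using \<tau> that by (auto simp: abs_mult)
    then show "\<bar>\<tau> * w\<bar> \<in> {0..\<rho>}" "\<bar>\<tau> * w\<bar> < d" using \<tau> by auto
  qed
  have \<gamma>_le: "\<gamma> w \<le> 1" if "w \<in> {0..\<rho>}" for w
    using f_le_1[of w] that \<rho> by (auto simp: f_def split: if_splits)
  have meas: "(\<lambda>w. indicator {-W..W} w * (\<gamma> \<bar>\<tau> * w\<bar>)\<^sup>2) \<in> borel_measurable gauss"
  proof -
    have "continuous_on {-W..W} (\<lambda>w. (\<gamma> \<bar>\<tau> * w\<bar>)\<^sup>2)"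
      using in_range \<rho> by (intro continuous_intros continuous_on_compose2[OF \<gamma>_cont]) force
    then have "(\<lambda>w. indicator {-W..W} w *\<^sub>R (\<gamma> \<bar>\<tau> * w\<bar>)\<^sup>2) \<in> borel_measurable borel"
      by (intro borel_measurable_continuous_on_indicator) auto
    then show ?thesis by simp
  qed
  have J: "?J \<longlonglongrightarrow> ?J'"
  proof (rule integral_dominated_convergence[where w="\<lambda>_. 1"])
    show "AE w in gauss. (\<lambda>k. indicator {-W..W} w * (norm (char (\<mu> k) (\<tau> * w)))\<^sup>2)
            \<longlonglongrightarrow> indicator {-W..W} w * (\<gamma> \<bar>\<tau> * w\<bar>)\<^sup>2"
    proof (rule AE_I2)
      fix w
      show "(\<lambda>k. indicator {-W..W} w * (norm (char (\<mu> k) (\<tau> * w)))\<^sup>2)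
            \<longlonglongrightarrow> indicator {-W..W} w * (\<gamma> \<bar>\<tau> * w\<bar>)\<^sup>2"
      proof (cases "w \<in> {-W..W}")
        case True
        have "(\<lambda>k. norm (char (\<mu> k) \<bar>\<tau> * w\<bar>)) \<longlonglongrightarrow> \<gamma> \<bar>\<tau> * w\<bar>"
        proof -
          have "\<bar>\<tau> * w\<bar> \<in> E" "\<bar>\<tau> * w\<bar> \<in> {0..1}" using in_range[OF True] \<rho> by auto
          then show ?thesis using lim_f[of "\<bar>\<tau> * w\<bar>"] by (simp only: f_def if_True)
        qed
        then show ?thesis unfolding norm_char_abs by (intro tendsto_intros)
      qed simp
    qed
  qed (use meas norm_char_le in \<open>auto simp: indicator_def power_le_one\<close>)
  have m: "(\<lambda>k. (measure (\<mu> k) UNIV)\<^sup>2) \<longlonglongrightarrow> (\<gamma> 0)\<^sup>2"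
    using lim_f[of 0] by (intro tendsto_power) (simp add: char_zero f_zero)
  have "(\<lambda>k. (measure (\<mu> k) UNIV)\<^sup>2 - ?J k) \<longlonglongrightarrow> (\<gamma> 0)\<^sup>2 - ?J'"
    by (intro tendsto_diff m J)
  moreover have "(\<gamma> 0)\<^sup>2 - ?J' < 3 * \<eta>'"
  proof -
    define P where "P = measure gauss {-W..W}"
    have "measure gauss {w. \<bar>w\<bar> > W} = 1 - P"
    proof -
      have "{w. \<bar>w\<bar> > W} = space gauss - {-W..W}" by auto
      then show ?thesis unfolding P_def by (simp only:) (rule G.prob_compl, simp)
    qed
    then have P: "1 - P < \<eta>'" "P \<le> 1" "P \<ge> 0" using W by (auto simp: P_def)
    have "((\<gamma> 0)\<^sup>2 - \<eta>') * P = (LINT w|gauss. indicator {-W..W} w * ((\<gamma> 0)\<^sup>2 - \<eta>'))"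
      by (simp add: P_def)
    also have "\<dots> \<le> ?J'"
    proof (rule integral_mono)
      show "integrable gauss (\<lambda>w. indicator {-W..W} w * ((\<gamma> 0)\<^sup>2 - \<eta>'))"
        by (intro G.integrable_const_bound[where B="\<bar>(\<gamma> 0)\<^sup>2 - \<eta>'\<bar>"]) (auto simp: indicator_def)
      show "integrable gauss (\<lambda>w. indicator {-W..W} w * (\<gamma> \<bar>\<tau> * w\<bar>)\<^sup>2)"
      proof (rule G.integrable_const_bound[where B=1])
        have "(\<gamma> \<bar>\<tau> * w\<bar>)\<^sup>2 \<le> 1" if "w \<in> {-W..W}" for w
        proof -
          have "\<bar>\<tau> * w\<bar> \<in> {0..1}" using in_range[OF that] \<rho> by auto
          then have "\<gamma> \<bar>\<tau> * w\<bar> \<ge> 0" by (intro less_imp_le \<gamma>_pos)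
          then show ?thesis using \<gamma>_le in_range[OF that] by (intro power_le_one) auto
        qed
        then show "AE w in gauss. norm (indicator {-W..W} w * (\<gamma> \<bar>\<tau> * w\<bar>)\<^sup>2) \<le> 1"
          by (intro AE_I2) (auto simp: indicator_def)
      qed (fact meas)
      show "indicator {-W..W} w * ((\<gamma> 0)\<^sup>2 - \<eta>') \<le> indicator {-W..W} w * (\<gamma> \<bar>\<tau> * w\<bar>)\<^sup>2" for w
      proof (cases "w \<in> {-W..W}")
        case True
        have "dist ((\<gamma> \<bar>\<tau> * w\<bar>)\<^sup>2) ((\<gamma> 0)\<^sup>2) < \<eta>'"
          using in_range[OF True] \<rho> by (intro d) (auto simp: dist_real_def)
        then show ?thesis using True by (simp add: dist_real_def)
      qed simp
    qed
    finally have "(\<gamma> 0)\<^sup>2 - ?J' \<le> (\<gamma> 0)\<^sup>2 * (1 - P) + \<eta>' * P" by (simp add: algebra_simps)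
    also have "\<dots> \<le> 1 * (1 - P) + \<eta>' * 1"
    proof (intro add_mono mult_mono)
      show "(\<gamma> 0)\<^sup>2 \<le> 1" using \<gamma>_le[of 0] \<gamma>_pos[of 0] \<rho> by (intro power_le_one) auto
    qed (use P \<eta>' in auto)
    finally show ?thesis using P \<eta>' by simp
  qed
  ultimately have ev: "\<forall>\<^sub>F k in sequentially. (measure (\<mu> k) UNIV)\<^sup>2 - ?J k < 3 * \<eta>'"
    by (rule order_tendstoD)
  have "measure (\<mu> k) {y. \<bar>y\<bar> > \<bar>a\<bar> + 2 / \<tau>} \<le> \<eta>" if k: "(measure (\<mu> k) UNIV)\<^sup>2 - ?J k < 3 * \<eta>'" for k
  proof -
    interpret M: finite_measure "\<mu> k" by (rule fin)
    interpret PP: pair_sigma_finite "\<mu> k" "\<mu> k" ..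
    let ?P = "\<mu> k \<Otimes>\<^sub>M \<mu> k"
    have finP: "finite_measure ?P" by (intro finite_measure_pair_measure fin)
    have times: "measure ?P (U \<times> V) = measure (\<mu> k) U * measure (\<mu> k) V" if "U \<in> sets borel" "V \<in> sets borel" for U V
      using that by (simp add: measure_def M.emeasure_pair_measure_Times enn2real_mult)
    have spP: "space ?P = UNIV" by (simp add: space_pair_measure)
    have "measure (\<mu> k) {y. \<bar>y\<bar> > \<bar>a\<bar> + 2 / \<tau>} * e \<le> measure (\<mu> k) {y. \<bar>y\<bar> > \<bar>a\<bar> + 2 / \<tau>} * measure (\<mu> k) {-a..a}"
      by (intro mult_left_mono core) auto
    also have "\<dots> = measure ?P ({y. \<bar>y\<bar> > \<bar>a\<bar> + 2 / \<tau>} \<times> {-a..a})"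
      by (subst times) auto
    also have "\<dots> \<le> measure ?P {z \<in> space ?P. \<bar>fst z - snd z\<bar> \<ge> 2 / \<tau>}"
    proof (rule finite_measure.finite_measure_mono[OF finP])
      show "{z \<in> space ?P. \<bar>fst z - snd z\<bar> \<ge> 2 / \<tau>} \<in> sets ?P" by measurable
    qed (auto simp: spP)
    also have "\<dots> \<le> 2 * (measure ?P (space ?P) - (LINT w|gauss. (norm (char (\<mu> k) (\<tau> * w)))\<^sup>2))"
      using measure_tail_le_gaussian[OF finP _ \<tau>(1), of "\<lambda>z. fst z - snd z"]
      unfolding gauss_char_sq by simp
    also have "measure ?P (space ?P) = (measure (\<mu> k) UNIV)\<^sup>2"
      using times[of UNIV UNIV] by (simp add: spP power2_eq_square)
    also have "2 * ((measure (\<mu> k) UNIV)\<^sup>2 - (LINT w|gauss. (norm (char (\<mu> k) (\<tau> * w)))\<^sup>2))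
        \<le> 2 * ((measure (\<mu> k) UNIV)\<^sup>2 - ?J k)"
    proof -
      have "?J k \<le> (LINT w|gauss. (norm (char (\<mu> k) (\<tau> * w)))\<^sup>2)"
        using norm_char_le by (intro integral_mono G.integrable_const_bound[where B=1]) (auto simp: indicator_def power_le_one)
      then show ?thesis by simp
    qed
    also have "\<dots> \<le> 2 * (3 * \<eta>')"
      by (rule mult_left_mono[OF less_imp_le[OF k]]) simp
    also have "\<dots> = e * \<eta>" by (simp add: \<eta>'_def)
    finally show ?thesis using e by (simp add: mult.commute)
  qed
  with ev show ?thesis by (intro exI) (erule eventually_mono)
qed

lemma asymptotically_equicontinuous:
  assumes "\<eta> > 0"
  shows "\<exists>d>0. \<forall>\<^sub>F k in sequentially. \<forall>v w. \<bar>v - w\<bar> \<le> d \<longrightarrow> norm (char (\<mu> k) v - char (\<mu> k) w) \<le> \<eta>"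
proof -
  obtain B where B: "\<forall>\<^sub>F k in sequentially. measure (\<mu> k) {y. \<bar>y\<bar> > B} \<le> \<eta> / 4"
    using tight[of "\<eta> / 4"] assms by auto
  define d where "d = \<eta> / (2 * (\<bar>B\<bar> + 1))"
  have d: "d > 0" "d * \<bar>B\<bar> \<le> \<eta> / 2"
    using assms by (auto simp: d_def field_simps)
  have "norm (char (\<mu> k) v - char (\<mu> k) w) \<le> \<eta>"
    if k: "measure (\<mu> k) {y. \<bar>y\<bar> > B} \<le> \<eta> / 4" and vw: "\<bar>v - w\<bar> \<le> d" for k v w
  proof -
    interpret M: finite_measure "\<mu> k" by (rule fin)
    have "norm (char (\<mu> k) v - char (\<mu> k) w) = norm (CLINT y|\<mu> k. iexp (v * y) - iexp (w * y))"
      unfolding char_def by (subst Bochner_Integration.integral_diff[OF int_iexp int_iexp]) simp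
    also have "\<dots> \<le> (LINT y|\<mu> k. norm (iexp (v * y) - iexp (w * y)))"
      by (rule integral_norm_bound)
    also have "\<dots> \<le> (LINT y|\<mu> k. d * \<bar>B\<bar> + 2 * indicator {y. \<bar>y\<bar> > B} y)"
    proof (rule integral_mono)
      show "integrable (\<mu> k) (\<lambda>y. norm (iexp (v * y) - iexp (w * y)))"
        using int_iexp by (intro integrable_norm Bochner_Integration.integrable_diff) auto
      show "integrable (\<mu> k) (\<lambda>y. d * \<bar>B\<bar> + 2 * indicator {y. \<bar>y\<bar> > B} y)"
        using d by (intro M.integrable_const_bound[where B="d * \<bar>B\<bar> + 2"]) (auto simp: indicator_def)
      show "norm (iexp (v * y) - iexp (w * y)) \<le> d * \<bar>B\<bar> + 2 * indicator {y. \<bar>y\<bar> > B} y" for y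
      proof (cases "\<bar>y\<bar> > B")
        case True
        have "norm (iexp (v * y) - iexp (w * y)) \<le> norm (iexp (v * y)) + norm (iexp (w * y))"
          by (rule norm_triangle_ineq4)
        also have "\<dots> = 2" by (simp only: norm_exp_i_times)
        also have "2 \<le> d * \<bar>B\<bar> + 2" using d by simp
        finally show ?thesis using True by simp
      next
        case False
        have "norm (iexp (v * y) - iexp (w * y)) \<le> \<bar>v * y - w * y\<bar>" by (rule norm_iexp_diff_le)
        also have "\<dots> = \<bar>v - w\<bar> * \<bar>y\<bar>" by (simp add: abs_mult flip: left_diff_distrib)
        also have "\<dots> \<le> d * \<bar>B\<bar>" using vw False d by (intro mult_mono) auto
        finally show ?thesis using False by simp
      qed
    qed
    also have "\<dots> = d * \<bar>B\<bar> * measure (\<mu> k) UNIV + 2 * measure (\<mu> k) {y. \<bar>y\<bar> > B}"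
    proof (subst Bochner_Integration.integral_add)
      show "integrable (\<mu> k) (\<lambda>y. 2 * indicator {y. \<bar>y\<bar> > B} y :: real)"
        by (intro M.integrable_const_bound[where B=2]) (auto simp: indicator_def)
    qed auto
    also have "\<dots> \<le> d * \<bar>B\<bar> * 1 + 2 * (\<eta> / 4)"
      using k d by (intro add_mono mult_left_mono mass) auto
    also have "\<dots> \<le> \<eta>" using d by simp
    finally show ?thesis .
  qed
  with B show ?thesis
    by (intro exI[of _ d] conjI d) (auto elim!: eventually_mono)
qed

lemma f_cont: "continuous_on {0..1} f"
  unfolding continuous_on_iff
proof (intro ballI allI impI)
  fix w \<eta> :: real assume w: "w \<in> {0..1}" and \<eta>: "\<eta> > 0"
  obtain d where d: "d > 0" and ev: "\<forall>\<^sub>F k in sequentially. \<forall>v w. \<bar>v - w\<bar> \<le> d \<longrightarrow> norm (char (\<mu> k) v - char (\<mu> k) w) \<le> \<eta> / 2"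
    using asymptotically_equicontinuous[of "\<eta> / 2"] \<eta> by auto
  show "\<exists>d>0. \<forall>v\<in>{0..1}. dist v w < d \<longrightarrow> dist (f v) (f w) < \<eta>"
  proof (intro exI[of _ d] conjI d ballI impI)
    fix v assume v: "v \<in> {0..1}" and vw: "dist v w < d"
    have "(\<lambda>k. \<bar>norm (char (\<mu> k) v) - norm (char (\<mu> k) w)\<bar>) \<longlonglongrightarrow> \<bar>f v - f w\<bar>"
      using v w by (intro tendsto_intros lim_f)
    moreover have "\<forall>\<^sub>F k in sequentially. \<bar>norm (char (\<mu> k) v) - norm (char (\<mu> k) w)\<bar> \<le> \<eta> / 2"
      using ev
    proof eventually_elim
      case (elim k)
      have "\<bar>norm (char (\<mu> k) v) - norm (char (\<mu> k) w)\<bar> \<le> norm (char (\<mu> k) v - char (\<mu> k) w)"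
        by (rule norm_triangle_ineq3)
      also have "\<dots> \<le> \<eta> / 2" using elim vw by (auto simp: dist_real_def)
      finally show ?case .
    qed
    ultimately have "\<bar>f v - f w\<bar> \<le> \<eta> / 2"
      by (rule tendsto_upperbound) simp
    then show "dist (f v) (f w) < \<eta>" using \<eta> by (simp add: dist_real_def)
  qed
qed

text \<open>The quotient of the limit by \<open>\<gamma>\<close> takes only the values 0 and 1, and it is continuous on an interval.\<close>

lemma E_eq: "E = {0..1}"
proof -
  let ?q = "\<lambda>w. f w / \<gamma> w"
  have q: "?q w = (if w \<in> E then 1 else 0)" if "w \<in> {0..1}" for w
    using \<gamma>_pos[OF that] by (simp add: f_def)
  have "continuous_on {0..1} ?q"
    using \<gamma>_pos by (intro continuous_intros f_cont \<gamma>_cont) force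
  moreover have "finite (?q ` {0..1})"
    by (rule finite_subset[of _ "{0, 1}"]) (auto simp: q)
  ultimately have "?q constant_on {0..1}"
    by (intro continuous_finite_range_constant) auto
  then have const: "?q w = ?q 0" if "w \<in> {0..1}" for w
    using that unfolding constant_on_def by (metis atLeastAtMost_iff order_refl zero_le_one)
  have "w \<in> E" if "w \<in> {0..1}" for w
  proof (rule ccontr)
    assume "w \<notin> E"
    then have "?q w = 0" using q[OF that] by simp
    moreover have "?q 0 = 1" using q[of 0] zero_in_E by simp
    ultimately show False using const[OF that] by simp
  qed
  then show ?thesis using E by auto
qed

text \<open>At the points of a finite grid the moduli approach values of \<open>\<gamma>\<close>; equicontinuity carries the resulting
lower bound to the points in between.\<close>

lemma bounded_below:
  "\<exists>c>0. \<forall>\<^sub>F k in sequentially. \<forall>w\<in>{0..1}. norm (char (\<mu> k) w) \<ge> c"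
proof -
  obtain w0 where w0: "w0 \<in> {0..1}" "\<And>w. w \<in> {0..1} \<Longrightarrow> \<gamma> w0 \<le> \<gamma> w"
    using continuous_attains_inf[OF _ _ \<gamma>_cont] by auto
  define c where "c = \<gamma> w0"
  have c: "c > 0" "\<And>w. w \<in> {0..1} \<Longrightarrow> f w \<ge> c"
  proof -
    show "c > 0" using \<gamma>_pos w0 by (simp add: c_def)
    fix w :: real assume w: "w \<in> {0..1}"
    then have "w \<in> E" using E_eq by simp
    then show "f w \<ge> c" using w0(2)[OF w] by (simp add: c_def f_def)
  qed
  obtain d where d: "d > 0" and ev: "\<forall>\<^sub>F k in sequentially. \<forall>v w. \<bar>v - w\<bar> \<le> d \<longrightarrow> norm (char (\<mu> k) v - char (\<mu> k) w) \<le> c / 4"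
    using asymptotically_equicontinuous[of "c / 4"] c by auto
  obtain N :: nat where N: "N > 0" "1 / real N < d"
    using reals_Archimedean[OF d] by (auto simp: inverse_eq_divide) (metis lessI of_nat_Suc zero_less_Suc)
  have grid: "\<forall>\<^sub>F k in sequentially. \<forall>i\<in>{..N}. norm (char (\<mu> k) (real i / real N)) > c / 2"
  proof (intro eventually_ball_finite ballI)
    fix i assume "i \<in> {..N}"
    then have i: "real i / real N \<in> {0..1}" using N by auto
    show "\<forall>\<^sub>F k in sequentially. norm (char (\<mu> k) (real i / real N)) > c / 2"
      using c(2)[OF i] c(1) by (intro order_tendstoD(1)[OF lim_f[OF i]]) linarith
  qed simp
  show ?thesis
  proof (intro exI[of _ "c / 4"] conjI)
    show "\<forall>\<^sub>F k in sequentially. \<forall>w\<in>{0..1}. norm (char (\<mu> k) w) \<ge> c / 4"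
      using ev grid
    proof eventually_elim
      case (elim k)
      show ?case
      proof
        fix w :: real assume w: "w \<in> {0..1}"
        define i where "i = nat \<lfloor>w * real N\<rfloor>"
        have "real i = of_int \<lfloor>w * real N\<rfloor>" using w by (simp add: i_def)
        then have i: "real i \<le> w * real N" "w * real N < real i + 1" by linarith+
        have "w * real N \<le> 1 * real N" using w by (intro mult_right_mono) auto
        then have "i \<le> N" using i by simp
        have "\<bar>w - real i / real N\<bar> \<le> 1 / real N"
        proof -
          have "w - real i / real N = (w * real N - real i) / real N"
            using N by (simp add: diff_divide_distrib)
          also have "\<bar>\<dots>\<bar> \<le> 1 / real N"
            using i N by (simp add: divide_right_mono)
          finally show ?thesis .
        qed
        then have "norm (char (\<mu> k) w - char (\<mu> k) (real i / real N)) \<le> c / 4"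
          using elim(1) N by auto
        moreover have "norm (char (\<mu> k) (real i / real N)) > c / 2"
          using elim(2) \<open>i \<le> N\<close> by auto
        moreover have "norm (char (\<mu> k) (real i / real N)) \<le> norm (char (\<mu> k) w) + norm (char (\<mu> k) w - char (\<mu> k) (real i / real N))"
          by (metis add.commute norm_minus_commute norm_triangle_sub)
        ultimately show "norm (char (\<mu> k) w) \<ge> c / 4" by linarith
      qed
    qed
  qed (use c in auto)
qed

end

section \<open>Phases and divergent sequences\<close>

text \<open>On a piece of length \<open>1 / N\<close> the quotients of the exponentials stay in the right half plane, so by the
intermediate value theorem the argument changes by less than \<open>pi / 2\<close> there.\<close>

lemma imaginary_part_variation_bounded:
  fixes z :: "real \<Rightarrow> complex" and N :: nat
  assumes cont: "continuous_on {0..1} z" and "N > 0"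
    and close: "\<And>v w. v \<in> {0..1} \<Longrightarrow> w \<in> {0..1} \<Longrightarrow> \<bar>v - w\<bar> \<le> 1 / N \<Longrightarrow> norm (exp (z v - z w) - 1) < 1"
  shows "\<bar>Im (z 1) - Im (z 0)\<bar> \<le> N * (pi / 2)"
proof -
  have step: "\<bar>Im (z v) - Im (z w)\<bar> < pi / 2" if vw: "v \<in> {0..1}" "w \<in> {0..1}" "w \<le> v" "v - w \<le> 1 / N" for v w
  proof (rule ccontr)
    let ?g = "\<lambda>u. \<bar>Im (z u) - Im (z w)\<bar>"
    assume "\<not> ?g v < pi / 2"
    moreover have "?g w = 0" by simp
    moreover have "continuous_on {w..v} ?g"
      using vw by (intro continuous_intros continuous_on_subset[OF cont]) auto
    ultimately obtain u where u: "w \<le> u" "u \<le> v" "?g u = pi / 2"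
      using IVT'[of ?g w "pi / 2" v] vw by (auto simp: not_less)
    then have "cos (Im (z u) - Im (z w)) = 0"
      by (metis cos_pi_half cos_minus abs_if)
    then have "Re (exp (z u - z w)) = 0" by (simp add: Re_exp)
    then have "1 \<le> norm (exp (z u - z w) - 1)"
      using abs_Re_le_cmod[of "exp (z u - z w) - 1"] by simp
    moreover have "norm (exp (z u - z w) - 1) < 1"
      using u vw by (intro close) auto
    ultimately show False by simp
  qed
  have "\<bar>Im (z (real i / N)) - Im (z 0)\<bar> \<le> i * (pi / 2)" if "i \<le> N" for i
    using that
  proof (induction i)
    case (Suc i)
    have "\<bar>Im (z (real (Suc i) / N)) - Im (z (real i / N))\<bar> < pi / 2"
      using Suc.prems \<open>N > 0\<close> by (intro step) (auto simp: field_simps)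
    moreover have "\<bar>Im (z (real i / N)) - Im (z 0)\<bar> \<le> i * (pi / 2)"
      using Suc by simp
    moreover have "real (Suc i) * (pi / 2) = i * (pi / 2) + pi / 2"
      by (simp add: algebra_simps)
    ultimately show ?case by linarith
  qed simp
  from this[of N] show ?thesis using \<open>N > 0\<close> by simp
qed

text \<open>Among all subsequences choose one for which the space of the vectors \<open>r\<close> with convergent \<open>r \<bullet> x\<^sub>k\<close> has the
largest dimension. If some \<open>r \<bullet> x\<^sub>k\<close> that is bounded above did not converge and did not tend to minus
infinity either, then it would converge along a further subsequence, whose space would be larger.\<close>

lemma inner_dichotomy_subsequence:
  fixes x :: "nat \<Rightarrow> 'v::euclidean_space"
  obtains \<sigma> :: "nat \<Rightarrow> nat" and S :: "'v set" and g :: "'v \<Rightarrow> real"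
  where "strict_mono \<sigma>" "subspace S" "linear g"
    "\<And>r. r \<in> S \<Longrightarrow> (\<lambda>k. r \<bullet> x (\<sigma> k)) \<longlonglongrightarrow> g r"
    "\<And>r C. r \<notin> S \<Longrightarrow> (\<And>k. r \<bullet> x (\<sigma> k) \<le> C) \<Longrightarrow> filterlim (\<lambda>k. r \<bullet> x (\<sigma> k)) at_bot sequentially"
proof -
  define Conv where "Conv \<sigma> = {r. convergent (\<lambda>k. r \<bullet> x (\<sigma> k))}" for \<sigma> :: "nat \<Rightarrow> nat"
  have sub: "subspace (Conv \<sigma>)" for \<sigma>
    unfolding Conv_def subspace_def
    by (auto simp: inner_add_left intro!: convergent_add convergent_mult convergent_const)
  have "\<exists>\<sigma>. strict_mono \<sigma> \<and> (\<forall>\<tau>. strict_mono \<tau> \<longrightarrow> dim (Conv \<tau>) \<le> dim (Conv \<sigma>))"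
  proof (rule ex_has_greatest_nat)
    show "strict_mono (id :: nat \<Rightarrow> nat)" by (simp add: strict_mono_def)
    show "\<forall>\<sigma>. strict_mono \<sigma> \<longrightarrow> dim (Conv \<sigma>) < Suc DIM('v)" by (simp add: dim_subset_UNIV less_Suc_eq_le)
  qed
  then obtain \<sigma> where \<sigma>: "strict_mono \<sigma>" and max: "\<And>\<tau>. strict_mono \<tau> \<Longrightarrow> dim (Conv \<tau>) \<le> dim (Conv \<sigma>)"
    by blast
  obtain B where B: "B \<subseteq> Conv \<sigma>" "independent B" "Conv \<sigma> \<subseteq> span B"
    using basis_exists[of "Conv \<sigma>"] by metis
  obtain g where g: "linear g" "\<And>b. b \<in> B \<Longrightarrow> g b = lim (\<lambda>k. b \<bullet> x (\<sigma> k))"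
    using linear_independent_extend[OF B(2), of "\<lambda>b. lim (\<lambda>k. b \<bullet> x (\<sigma> k))"] by metis
  show ?thesis
  proof (rule that[OF \<sigma> sub g(1)])
    fix r assume "r \<in> Conv \<sigma>"
    then have "r \<in> span B" using B by auto
    then show "(\<lambda>k. r \<bullet> x (\<sigma> k)) \<longlonglongrightarrow> g r"
    proof (induction r rule: span_induct)
      case base
      show ?case
        by (auto simp: subspace_def linear_0[OF g(1)] linear_add[OF g(1)] linear_scale[OF g(1)] inner_add_left
            intro!: tendsto_intros)
    next
      case (step b)
      then have "convergent (\<lambda>k. b \<bullet> x (\<sigma> k))" using B by (auto simp: Conv_def)
      then show ?case using step by (simp add: g convergent_LIMSEQ_iff)
    qed
  next
    fix r C assume r: "r \<notin> Conv \<sigma>" and C: "\<And>k. r \<bullet> x (\<sigma> k) \<le> C"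
    show "filterlim (\<lambda>k. r \<bullet> x (\<sigma> k)) at_bot sequentially"
    proof (rule ccontr)
      assume "\<not> ?thesis"
      then obtain Z where "\<not> (\<forall>\<^sub>F k in sequentially. r \<bullet> x (\<sigma> k) \<le> Z)"
        unfolding filterlim_at_bot by auto
      then obtain \<tau> :: "nat \<Rightarrow> nat" where \<tau>: "strict_mono \<tau>" "\<And>n. \<not> r \<bullet> x (\<sigma> (\<tau> n)) \<le> Z"
        using not_eventually_sequentiallyD by blast
      have "\<forall>n. r \<bullet> x (\<sigma> (\<tau> n)) \<in> {Z..C}"
        using \<tau> C by (auto simp: not_le less_imp_le)
      then obtain l \<rho> where \<rho>: "strict_mono \<rho>" "((\<lambda>n. r \<bullet> x (\<sigma> (\<tau> n))) \<circ> \<rho>) \<longlonglongrightarrow> l"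
        using compact_Icc[of Z C] unfolding compact_def by metis
      define \<sigma>' where "\<sigma>' = \<sigma> \<circ> (\<tau> \<circ> \<rho>)"
      have "strict_mono (\<tau> \<circ> \<rho>)" using \<tau> \<rho> by (intro strict_mono_o)
      then have sm: "strict_mono \<sigma>'" unfolding \<sigma>'_def by (rule strict_mono_o[OF \<sigma>])
      have "Conv \<sigma> \<subseteq> Conv \<sigma>'"
      proof
        fix q assume "q \<in> Conv \<sigma>"
        then have "convergent ((\<lambda>k. q \<bullet> x (\<sigma> k)) \<circ> (\<tau> \<circ> \<rho>))"
          using \<open>strict_mono (\<tau> \<circ> \<rho>)\<close> by (intro convergent_subseq_convergent) (auto simp: Conv_def)
        then show "q \<in> Conv \<sigma>'" by (simp add: Conv_def \<sigma>'_def comp_def)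
      qed
      moreover have "r \<in> Conv \<sigma>'"
        using \<rho>(2) by (auto simp: Conv_def \<sigma>'_def comp_def convergent_def)
      ultimately have "span (Conv \<sigma>) \<subset> span (Conv \<sigma>')"
        using r sub by (auto simp: span_eq_iff[THEN iffD2])
      then have "dim (Conv \<sigma>) < dim (Conv \<sigma>')" by (rule dim_psubset)
      with max[OF sm] show False by simp
    qed
  qed
qed

section \<open>The Feller property of affine kernels\<close>

text \<open>The transition kernels of an affine process on its finite states: \<open>\<kappa> s x\<close> is the law at time \<open>s\<close> of the
process that starts at \<open>x\<close>, restricted to \<open>D\<close>; the mass lost is the probability of the cemetery. The functions
\<open>\<Phi>\<close>, \<open>\<psi>R\<close> and \<open>\<psi>I\<close> are the affine parameters at the purely imaginary argument \<open>(0, v)\<close>, the last two being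
the real and the imaginary part of \<open>\<psi>\<close>.\<close>

locale affine_kernel =
  fixes D :: "'v::euclidean_space set"
    and \<kappa> :: "real \<Rightarrow> 'v \<Rightarrow> 'v measure"
    and \<Phi> :: "real \<Rightarrow> 'v \<Rightarrow> complex"
    and \<psi>R \<psi>I :: "real \<Rightarrow> 'v \<Rightarrow> 'v"
    and y0 :: 'v
  assumes closed_D: "closed D" and y0: "y0 \<in> D"
    and spanning: "span ((\<lambda>x. x - y0) ` D) = UNIV"
    and sets_kappa: "\<And>s x. s \<ge> 0 \<Longrightarrow> x \<in> D \<Longrightarrow> sets (\<kappa> s x) = sets borel"
    and mass_le: "\<And>s x. s \<ge> 0 \<Longrightarrow> x \<in> D \<Longrightarrow> emeasure (\<kappa> s x) UNIV \<le> 1"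
    and concentrated: "\<And>s x. s \<ge> 0 \<Longrightarrow> x \<in> D \<Longrightarrow> emeasure (\<kappa> s x) (- D) = 0"
    and kappa_zero: "\<And>x. x \<in> D \<Longrightarrow> \<kappa> 0 x = return borel x"
    and chapman_kolmogorov: "\<And>s t x A. s \<ge> 0 \<Longrightarrow> t \<ge> 0 \<Longrightarrow> x \<in> D \<Longrightarrow> A \<in> sets borel \<Longrightarrow>
          emeasure (\<kappa> (t + s) x) A = (\<integral>\<^sup>+\<xi>. emeasure (\<kappa> t \<xi>) A \<partial>\<kappa> s x)"
    and weakly_continuous: "\<And>x t (g :: 'v \<Rightarrow> real). x \<in> D \<Longrightarrow> t \<ge> 0 \<Longrightarrow> continuous_on UNIV g \<Longrightarrow> bounded (range g) \<Longrightarrow>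
          ((\<lambda>s. LINT \<xi>|\<kappa> s x. g \<xi>) \<longlongrightarrow> (LINT \<xi>|\<kappa> t x. g \<xi>)) (at t within {0..})"
    and fourier: "\<And>s x v. s \<ge> 0 \<Longrightarrow> x \<in> D \<Longrightarrow>
          (CLINT \<xi>|\<kappa> s x. iexp (v \<bullet> \<xi>)) = \<Phi> s v * exp (Complex (\<psi>R s v \<bullet> x) (\<psi>I s v \<bullet> x))"
    and psi_cont: "\<And>x. x \<in> D \<Longrightarrow> continuous_on {(s, v). 0 \<le> s \<and> (\<forall>r\<in>{0..s}. \<Phi> r v \<noteq> 0)}
          (\<lambda>(s, v). Complex (\<psi>R s v \<bullet> x) (\<psi>I s v \<bullet> x))"
begin

definition F :: "real \<Rightarrow> 'v \<Rightarrow> 'v \<Rightarrow> complex" where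
  "F s x v = (CLINT \<xi>|\<kappa> s x. iexp (v \<bullet> \<xi>))"

definition mass :: "real \<Rightarrow> 'v \<Rightarrow> real" where
  "mass s x = measure (\<kappa> s x) UNIV"

lemma space_kappa: "s \<ge> 0 \<Longrightarrow> x \<in> D \<Longrightarrow> space (\<kappa> s x) = UNIV"
  using sets_eq_imp_space_eq[OF sets_kappa] by simp

lemma finite_kappa: "s \<ge> 0 \<Longrightarrow> x \<in> D \<Longrightarrow> finite_measure (\<kappa> s x)"
  using mass_le[of s x] by (intro finite_measureI) (auto simp: space_kappa top_unique)

lemma meas_kappa: "s \<ge> 0 \<Longrightarrow> x \<in> D \<Longrightarrow> f \<in> borel_measurable borel \<Longrightarrow> f \<in> borel_measurable (\<kappa> s x)"
  using measurable_cong_sets[OF sets_kappa refl] by blast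

lemma integrable_kappa:
  fixes f :: "'v \<Rightarrow> 'b::{banach, second_countable_topology}"
  assumes "s \<ge> 0" "x \<in> D" "f \<in> borel_measurable borel" "\<And>\<xi>. norm (f \<xi>) \<le> C"
  shows "integrable (\<kappa> s x) f"
  using assms by (intro finite_measure.integrable_const_bound[OF finite_kappa, where B=C] meas_kappa) auto

lemma mass_le_1: "s \<ge> 0 \<Longrightarrow> x \<in> D \<Longrightarrow> mass s x \<le> 1"
  using mass_le[of s x] unfolding mass_def measure_def by (simp add: enn2real_leI)

lemma integral_const_kappa: "s \<ge> 0 \<Longrightarrow> x \<in> D \<Longrightarrow> (LINT \<xi>|\<kappa> s x. c) = c * mass s x"
  for c :: real
  by (simp add: mass_def space_kappa)

lemma measure_le_mass: "s \<ge> 0 \<Longrightarrow> x \<in> D \<Longrightarrow> measure (\<kappa> s x) A \<le> mass s x"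
  unfolding mass_def using finite_measure.bounded_measure[OF finite_kappa] by (simp add: space_kappa)

lemma iexp_inner_measurable: "(\<lambda>\<xi>::'v. iexp (v \<bullet> \<xi> + c)) \<in> borel_measurable borel"
  by (intro borel_measurable_continuous_onI continuous_intros)

lemma integrable_iexp: "s \<ge> 0 \<Longrightarrow> x \<in> D \<Longrightarrow> integrable (\<kappa> s x) (\<lambda>\<xi>. iexp (v \<bullet> \<xi>))"
  using iexp_inner_measurable[of v 0] by (intro integrable_kappa[where C=1]) auto

lemma mass_tendsto: "x \<in> D \<Longrightarrow> t \<ge> 0 \<Longrightarrow> ((\<lambda>s. mass s x) \<longlongrightarrow> mass t x) (at t within {0..})"
proof -
  assume x: "x \<in> D" "t \<ge> 0"
  have "((\<lambda>s. LINT \<xi>|\<kappa> s x. (1::real)) \<longlongrightarrow> (LINT \<xi>|\<kappa> t x. 1)) (at t within {0..})"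
    using x by (intro weakly_continuous) auto
  moreover have "\<forall>\<^sub>F s in at t within {0..}. (LINT \<xi>|\<kappa> s x. (1::real)) = mass s x"
    unfolding eventually_at_filter by (rule always_eventually) (use x in \<open>auto simp: mass_def space_kappa\<close>)
  ultimately show ?thesis
    using x by (subst (asm) integral_const_kappa) (auto intro: Lim_transform_eventually)
qed

lemma mass_zero: "x \<in> D \<Longrightarrow> mass 0 x = 1"
  by (simp add: mass_def kappa_zero measure_return)

lemma F_eq: "s \<ge> 0 \<Longrightarrow> x \<in> D \<Longrightarrow> F s x v = \<Phi> s v * exp (Complex (\<psi>R s v \<bullet> x) (\<psi>I s v \<bullet> x))"
  unfolding F_def by (rule fourier)

lemma norm_F_le: "s \<ge> 0 \<Longrightarrow> x \<in> D \<Longrightarrow> norm (F s x v) \<le> mass s x"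
proof -
  assume sx: "s \<ge> 0" "x \<in> D"
  have "norm (F s x v) \<le> (LINT \<xi>|\<kappa> s x. norm (iexp (v \<bullet> \<xi>)))"
    unfolding F_def by (rule integral_norm_bound)
  also have "\<dots> = mass s x" using sx by (simp only: norm_exp_i_times) (simp add: mass_def space_kappa)
  finally show ?thesis .
qed

lemma F_minus_le:
  assumes "s \<ge> 0" "x \<in> D" "y \<in> D" "norm v \<le> R" "R \<ge> 0"
  shows "norm (F s x v - iexp (v \<bullet> y)) \<le> (LINT \<xi>|\<kappa> s x. min 2 (R * norm (\<xi> - y))) + (1 - mass s x)"
proof -
  have int1: "integrable (\<kappa> s x) (\<lambda>\<xi>. iexp (v \<bullet> y))"
    using assms by (intro integrable_kappa[where C=1]) auto
  have "R * norm z \<ge> 0" for z :: 'v using assms by simp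
  then have int2: "integrable (\<kappa> s x) (\<lambda>\<xi>. min 2 (R * norm (\<xi> - y)))"
    using assms by (intro integrable_kappa[where C=2]) auto
  have "F s x v - iexp (v \<bullet> y) = (CLINT \<xi>|\<kappa> s x. iexp (v \<bullet> \<xi>) - iexp (v \<bullet> y)) - (1 - mass s x) * iexp (v \<bullet> y)"
    using assms by (simp add: F_def Bochner_Integration.integral_diff[OF integrable_iexp int1] mass_def space_kappa scaleR_conv_of_real algebra_simps)
  also have "norm \<dots> \<le> norm (CLINT \<xi>|\<kappa> s x. iexp (v \<bullet> \<xi>) - iexp (v \<bullet> y)) + norm ((1 - mass s x) * iexp (v \<bullet> y))"
    by (rule norm_triangle_ineq4)
  also have "norm ((1 - mass s x) * iexp (v \<bullet> y)) = 1 - mass s x"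
    using mass_le_1[of s x] assms by (simp only: norm_mult norm_exp_i_times norm_of_real) simp
  also have "norm (CLINT \<xi>|\<kappa> s x. iexp (v \<bullet> \<xi>) - iexp (v \<bullet> y)) \<le> (LINT \<xi>|\<kappa> s x. norm (iexp (v \<bullet> \<xi>) - iexp (v \<bullet> y)))"
    by (rule integral_norm_bound)
  also have "\<dots> \<le> (LINT \<xi>|\<kappa> s x. min 2 (R * norm (\<xi> - y)))"
  proof (rule integral_mono[OF _ int2])
    show "integrable (\<kappa> s x) (\<lambda>\<xi>. norm (iexp (v \<bullet> \<xi>) - iexp (v \<bullet> y)))"
      using assms by (intro integrable_norm Bochner_Integration.integrable_diff integrable_iexp int1)
    fix \<xi>
    have "norm (iexp (v \<bullet> \<xi>) - iexp (v \<bullet> y)) \<le> norm (iexp (v \<bullet> \<xi>)) + norm (iexp (v \<bullet> y))"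
      by (rule norm_triangle_ineq4)
    also have "\<dots> = 2" by (simp only: norm_exp_i_times)
    finally have 1: "norm (iexp (v \<bullet> \<xi>) - iexp (v \<bullet> y)) \<le> 2" .
    have "norm (iexp (v \<bullet> \<xi>) - iexp (v \<bullet> y)) \<le> \<bar>v \<bullet> \<xi> - v \<bullet> y\<bar>" by (rule norm_iexp_diff_le)
    also have "\<dots> = \<bar>v \<bullet> (\<xi> - y)\<bar>" by (simp add: inner_diff_right)
    also have "\<dots> \<le> norm v * norm (\<xi> - y)" by (rule Cauchy_Schwarz_ineq2)
    also have "\<dots> \<le> R * norm (\<xi> - y)" using assms by (intro mult_right_mono) auto
    finally show "norm (iexp (v \<bullet> \<xi>) - iexp (v \<bullet> y)) \<le> min 2 (R * norm (\<xi> - y))" using 1 by simp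
  qed
  finally show ?thesis by simp
qed

text \<open>A single test function, \<open>min 2 (R * norm (\<xi> - x))\<close>, dominates the differences of exponentials for all \<open>v\<close> in
the ball of radius \<open>R\<close>, so weak continuity at time 0 yields uniformity in \<open>v\<close>.\<close>

lemma F_near_zero:
  assumes "x \<in> D" "R \<ge> 0" "\<epsilon> > 0"
  shows "\<exists>\<delta>>0. \<forall>s\<in>{0..\<delta>}. \<forall>v\<in>cball 0 R. norm (F s x v - iexp (v \<bullet> x)) < \<epsilon>"
proof -
  let ?g = "\<lambda>\<xi>. min 2 (R * norm (\<xi> - x))"
  have "R * norm z \<ge> 0" for z :: 'v using assms by simp
  then have "((\<lambda>s. LINT \<xi>|\<kappa> s x. ?g \<xi>) \<longlongrightarrow> (LINT \<xi>|\<kappa> 0 x. ?g \<xi>)) (at 0 within {0..})"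
    using assms by (intro weakly_continuous continuous_intros boundedI[where B=2]) auto
  moreover have "(LINT \<xi>|\<kappa> 0 x. ?g \<xi>) = 0"
    using assms by (simp add: kappa_zero integral_return)
  ultimately have "((\<lambda>s. (LINT \<xi>|\<kappa> s x. ?g \<xi>) + (1 - mass s x)) \<longlongrightarrow> 0 + (1 - 1)) (at 0 within {0..})"
    using mass_tendsto[of x 0] assms by (intro tendsto_intros) (simp_all add: mass_zero)
  then have "\<forall>\<^sub>F s in at 0 within {0..}. (LINT \<xi>|\<kappa> s x. ?g \<xi>) + (1 - mass s x) < \<epsilon>"
    using assms by (intro order_tendstoD(2)) auto
  then obtain d where d: "d > 0" "\<And>s. s \<ge> 0 \<Longrightarrow> s \<noteq> 0 \<Longrightarrow> \<bar>s\<bar> < d \<Longrightarrow> (LINT \<xi>|\<kappa> s x. ?g \<xi>) + (1 - mass s x) < \<epsilon>"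
    unfolding eventually_at by (auto simp: dist_real_def)
  show ?thesis
  proof (intro exI[of _ "d / 2"] conjI ballI)
    fix s v assume s: "s \<in> {0..d / 2}" and v: "v \<in> cball (0::'v) R"
    have "norm (F s x v - iexp (v \<bullet> x)) \<le> (LINT \<xi>|\<kappa> s x. ?g \<xi>) + (1 - mass s x)"
      using s v assms by (intro F_minus_le) auto
    also have "\<dots> < \<epsilon>"
      using s d assms by (cases "s = 0") (auto simp: kappa_zero integral_return mass_zero)
    finally show "norm (F s x v - iexp (v \<bullet> x)) < \<epsilon>" .
  qed (use d in auto)
qed

lemma Phi_nonzero:
  assumes "R \<ge> 0"
  shows "\<exists>\<delta>>0. \<forall>s\<in>{0..\<delta>}. \<forall>v\<in>cball 0 R. \<Phi> s v \<noteq> 0"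
proof -
  obtain \<delta> where \<delta>: "\<delta> > 0" "\<And>s v. s \<in> {0..\<delta>} \<Longrightarrow> v \<in> cball 0 R \<Longrightarrow> norm (F s y0 v - iexp (v \<bullet> y0)) < 1"
    using F_near_zero[OF y0 assms, of 1] by auto
  have "\<Phi> s v \<noteq> 0" if sv: "s \<in> {0..\<delta>}" "v \<in> cball 0 R" for s v
  proof
    assume "\<Phi> s v = 0"
    then have "F s y0 v = 0" using sv by (simp add: F_eq y0)
    with \<delta>(2)[OF sv] have "norm (iexp (v \<bullet> y0)) < 1" by simp
    then show False by (simp only: norm_exp_i_times)
  qed
  with \<delta> show ?thesis by blast
qed

text \<open>Only the pairings of \<open>\<psi>\<close> with points of \<open>D\<close> are continuous by assumption; since \<open>D\<close> affinely spans the
space, this determines continuity of all components.\<close>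

lemma psi_component_cont:
  assumes "\<And>s v. s \<in> {0..\<delta>} \<Longrightarrow> v \<in> cball 0 R \<Longrightarrow> \<Phi> s v \<noteq> 0"
  shows "continuous_on ({0..\<delta>} \<times> cball 0 R) (\<lambda>p. \<psi>R (fst p) (snd p))"
    and "continuous_on ({0..\<delta>} \<times> cball 0 R) (\<lambda>p. \<psi>I (fst p) (snd p))"
proof -
  let ?K = "{0..\<delta>} \<times> cball (0::'v) R"
  let ?c = "\<lambda>p z. Complex (\<psi>R (fst p) (snd p) \<bullet> z) (\<psi>I (fst p) (snd p) \<bullet> z)"
  have sub: "?K \<subseteq> {(s, v). 0 \<le> s \<and> (\<forall>r\<in>{0..s}. \<Phi> r v \<noteq> 0)}"
    using assms by auto
  have D: "continuous_on ?K (\<lambda>p. ?c p x)" if "x \<in> D" for x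
    using continuous_on_subset[OF psi_cont[OF that] sub] by (simp add: case_prod_beta)
  have c_add: "?c p (a + b) = ?c p a + ?c p b" "?c p (a - b) = ?c p a - ?c p b"
     "?c p (t *\<^sub>R a) = t *\<^sub>R ?c p a" for p a b t
    by (auto simp: complex_eq_iff inner_add_right inner_diff_right)
  have all: "continuous_on ?K (\<lambda>p. ?c p z)" for z
  proof -
    have "z \<in> span ((\<lambda>x. x - y0) ` D)" using spanning by simp
    then show ?thesis
    proof (induction z rule: span_induct)
      case base
      have "?c p 0 = 0" for p by (simp add: complex_eq_iff)
      then have "continuous_on ?K (\<lambda>p. ?c p 0)" by (simp only: continuous_on_const)
      moreover have "continuous_on ?K (\<lambda>p. ?c p (a + b))" if "continuous_on ?K (\<lambda>p. ?c p a)" "continuous_on ?K (\<lambda>p. ?c p b)" for a b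
        unfolding c_add using that by (rule continuous_on_add)
      moreover have "continuous_on ?K (\<lambda>p. ?c p (t *\<^sub>R a))" if "continuous_on ?K (\<lambda>p. ?c p a)" for a t
        unfolding c_add using that by (rule continuous_on_scaleR[OF continuous_on_const])
      ultimately show ?case unfolding subspace_def by blast
    next
      case (step z)
      then obtain x where "x \<in> D" "z = x - y0" by auto
      then show ?case unfolding \<open>z = x - y0\<close> c_add by (intro continuous_on_diff D y0)
    qed
  qed
  have comp: "continuous_on ?K (\<lambda>p. \<psi>R (fst p) (snd p) \<bullet> z)" "continuous_on ?K (\<lambda>p. \<psi>I (fst p) (snd p) \<bullet> z)" for z
    using continuous_on_Re[OF all[of z]] continuous_on_Im[OF all[of z]] by simp_all
  show "continuous_on ?K (\<lambda>p. \<psi>R (fst p) (snd p))"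
    by (rule continuous_on_componentwise[THEN iffD2], intro ballI, rule comp(1))
  show "continuous_on ?K (\<lambda>p. \<psi>I (fst p) (snd p))"
    by (rule continuous_on_componentwise[THEN iffD2], intro ballI, rule comp(2))
qed

text \<open>At time 0 the kernel is a point mass, hence \<open>exp\<close> of the pairing of \<open>\<psi> 0 v - \<i> v\<close> with \<open>x - y0\<close> equals 1. So the
imaginary part of the pairing takes values in the discrete set of multiples of \<open>2 * pi\<close>, and continuity
makes it independent of \<open>v\<close>. The remaining vector \<open>\<psi>I 0 0\<close> may be nonzero, for instance if \<open>D\<close> is a lattice.\<close>

lemma psi_time_zero:
  shows "\<psi>R 0 v = 0" and "\<psi>I 0 v = \<psi>I 0 0 + v"
    and "x \<in> D \<Longrightarrow> iexp (\<psi>I 0 0 \<bullet> (x - y0)) = 1"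
proof -
  have F0: "F 0 x v = iexp (v \<bullet> x)" if "x \<in> D" for x v
    using that by (simp add: F_def kappa_zero integral_return)
  have nz: "\<Phi> 0 v \<noteq> 0" for v
  proof
    assume "\<Phi> 0 v = 0"
    then have "iexp (v \<bullet> y0) = 0" using F0[OF y0, of v] by (simp add: F_eq y0)
    then show False by simp
  qed
  have one: "exp (Complex (\<psi>R 0 v \<bullet> (x - y0)) ((\<psi>I 0 v - v) \<bullet> (x - y0))) = 1" if "x \<in> D" for x v
  proof -
    let ?e = "\<lambda>x. exp (Complex (\<psi>R 0 v \<bullet> x) (\<psi>I 0 v \<bullet> x))"
    have eq: "\<Phi> 0 v * ?e x = iexp (v \<bullet> x)" "\<Phi> 0 v * ?e y0 = iexp (v \<bullet> y0)"
      using F0[OF that, of v] F0[OF y0, of v] F_eq[of 0 x v] F_eq[of 0 y0 v] that y0 by simp_all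
    have "Complex (\<psi>R 0 v \<bullet> (x - y0)) ((\<psi>I 0 v - v) \<bullet> (x - y0))
        = (Complex (\<psi>R 0 v \<bullet> x) (\<psi>I 0 v \<bullet> x) - Complex (\<psi>R 0 v \<bullet> y0) (\<psi>I 0 v \<bullet> y0)) - (\<i> * (v \<bullet> x) - \<i> * (v \<bullet> y0))"
      by (simp add: complex_eq_iff inner_diff_left inner_diff_right)
    then have "exp (Complex (\<psi>R 0 v \<bullet> (x - y0)) ((\<psi>I 0 v - v) \<bullet> (x - y0)))
        = (?e x / ?e y0) / (iexp (v \<bullet> x) / iexp (v \<bullet> y0))"
      by (simp only: exp_diff)
    also have "iexp (v \<bullet> x) / iexp (v \<bullet> y0) = ?e x / ?e y0"
      unfolding eq[symmetric] using nz[of v] by simp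
    finally show ?thesis by simp
  qed
  have R: "\<psi>R 0 v \<bullet> (x - y0) = 0" if "x \<in> D" for x v
    using arg_cong[OF one[OF that, of v], of norm] by (simp add: norm_exp)
  have range: "(\<psi>I 0 v - v) \<bullet> (x - y0) \<in> {of_int (2 * n) * pi |n. True}" if "x \<in> D" for x v
    using one[OF that, of v] by (auto simp: exp_eq_1)
  have const: "(\<psi>I 0 v - v) \<bullet> (x - y0) = (\<psi>I 0 0 - 0) \<bullet> (x - y0)" if x: "x \<in> D" for x v
  proof -
    let ?h = "\<lambda>v. (\<psi>I 0 v - v) \<bullet> (x - y0)"
    have "continuous_on ({0..0} \<times> cball 0 (norm v)) (\<lambda>p. \<psi>I (fst p) (snd p))"
      by (rule psi_component_cont) (use nz in auto)
    then have "continuous_on (cball 0 (norm v)) (\<lambda>w. (\<lambda>p. \<psi>I (fst p) (snd p)) (0, w))"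
      by (rule continuous_on_compose2) (auto intro!: continuous_intros)
    then have "continuous_on (cball 0 (norm v)) ?h"
      by (intro continuous_intros) simp
    then have "?h constant_on cball 0 (norm v)"
    proof (rule continuous_discrete_range_constant[OF connected_cball])
      fix w :: 'v
      show "\<exists>e>0. \<forall>u. u \<in> cball 0 (norm v) \<and> ?h u \<noteq> ?h w \<longrightarrow> e \<le> norm (?h u - ?h w)"
      proof (intro exI[of _ pi] conjI allI impI)
        fix u assume u: "u \<in> cball 0 (norm v) \<and> ?h u \<noteq> ?h w"
        obtain m n where mn: "?h u = of_int (2 * m) * pi" "?h w = of_int (2 * n) * pi"
          using range[OF x, of u] range[OF x, of w] by auto
        with u have "m \<noteq> n" by auto
        then have "1 \<le> \<bar>of_int (m - n) :: real\<bar>" by linarith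
        then have "1 * pi \<le> \<bar>of_int (2 * (m - n))\<bar> * pi" by (intro mult_right_mono) auto
        also have "\<dots> = norm (?h u - ?h w)"
          unfolding mn by (simp add: abs_mult flip: left_diff_distrib)
        finally show "pi \<le> norm (?h u - ?h w)" by simp
      qed simp
    qed
    then show ?thesis unfolding constant_on_def by (metis mem_cball_0 norm_zero norm_ge_zero order_refl)
  qed
  have zero: "z = 0" if "\<And>x. x \<in> D \<Longrightarrow> z \<bullet> (x - y0) = 0" for z
  proof -
    have "z \<in> span ((\<lambda>x. x - y0) ` D)" using spanning by simp
    moreover have "orthogonal z w" if "w \<in> span ((\<lambda>x. x - y0) ` D)" for w
      using that by (rule orthogonal_to_span) (use \<open>\<And>x. x \<in> D \<Longrightarrow> z \<bullet> (x - y0) = 0\<close> in \<open>auto simp: orthogonal_def\<close>)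
    ultimately have "orthogonal z z" by blast
    then show ?thesis by (simp add: orthogonal_self)
  qed
  show "\<psi>R 0 v = 0" by (rule zero) (rule R)
  have "\<psi>I 0 v - v - \<psi>I 0 0 = 0" by (rule zero) (use const in \<open>auto simp: inner_diff_left\<close>)
  then show "\<psi>I 0 v = \<psi>I 0 0 + v" by (simp add: algebra_simps)
  show "iexp (\<psi>I 0 0 \<bullet> (x - y0)) = 1" if "x \<in> D"
    using one[OF that, of 0] R[OF that, of 0] by (simp add: Complex_eq)
qed

lemma psi_near_zero:
  assumes "R \<ge> 0" "\<epsilon> > 0"
  shows "\<exists>\<delta>>0. \<forall>s\<in>{0..\<delta>}. \<forall>v\<in>cball 0 R. \<Phi> s v \<noteq> 0 \<and> norm (\<psi>R s v) < \<epsilon> \<and> norm (\<psi>I s v - \<psi>I 0 0 - v) < \<epsilon>"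
proof -
  obtain \<delta>0 where \<delta>0: "\<delta>0 > 0" and nz: "\<And>s v. s \<in> {0..\<delta>0} \<Longrightarrow> v \<in> cball 0 R \<Longrightarrow> \<Phi> s v \<noteq> 0"
    using Phi_nonzero[OF assms(1)] by blast
  let ?K = "{0..\<delta>0} \<times> cball (0::'v) R"
  have K: "compact ?K" by (intro compact_Times) auto
  have small: "\<exists>d>0. \<forall>s\<in>{0..\<delta>0}. \<forall>v\<in>cball 0 R. s < d \<longrightarrow> norm (g s v - g 0 v) < \<epsilon>"
    if g: "continuous_on ?K (\<lambda>p. g (fst p) (snd p))" for g :: "real \<Rightarrow> 'v \<Rightarrow> 'v"
  proof -
    from compact_uniformly_continuous[OF g K] assms
    obtain d where d: "d > 0" "\<And>p q. p \<in> ?K \<Longrightarrow> q \<in> ?K \<Longrightarrow> dist q p < d \<Longrightarrow> dist (g (fst q) (snd q)) (g (fst p) (snd p)) < \<epsilon>"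
      unfolding uniformly_continuous_on_def by metis
    show ?thesis
    proof (intro exI[of _ d] conjI ballI impI)
      fix s v assume "s \<in> {0..\<delta>0}" "v \<in> cball (0::'v) R" "s < d"
      then show "norm (g s v - g 0 v) < \<epsilon>"
        using d(2)[of "(0, v)" "(s, v)"] by (auto simp: dist_norm dist_Pair_Pair)
    qed (use d in auto)
  qed
  obtain d1 where d1: "d1 > 0" "\<And>s v. s \<in> {0..\<delta>0} \<Longrightarrow> v \<in> cball 0 R \<Longrightarrow> s < d1 \<Longrightarrow> norm (\<psi>R s v - \<psi>R 0 v) < \<epsilon>"
    using small[OF psi_component_cont(1)[OF nz]] by blast
  obtain d2 where d2: "d2 > 0" "\<And>s v. s \<in> {0..\<delta>0} \<Longrightarrow> v \<in> cball 0 R \<Longrightarrow> s < d2 \<Longrightarrow> norm (\<psi>I s v - \<psi>I 0 v) < \<epsilon>"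
    using small[OF psi_component_cont(2)[OF nz]] by blast
  define \<delta> where "\<delta> = min \<delta>0 (min (d1 / 2) (d2 / 2))"
  have \<delta>: "\<delta> > 0" "\<delta> \<le> \<delta>0" "\<delta> < d1" "\<delta> < d2" using \<delta>0 d1 d2 by (auto simp: \<delta>_def)
  show ?thesis
  proof (intro exI[of _ \<delta>] conjI ballI)
    fix s v assume sv: "s \<in> {0..\<delta>}" "v \<in> cball (0::'v) R"
    show "\<Phi> s v \<noteq> 0" using sv \<delta> by (intro nz) auto
    show "norm (\<psi>R s v) < \<epsilon>" using d1(2)[of s v] sv \<delta> by (simp add: psi_time_zero)
    have "norm (\<psi>I s v - \<psi>I 0 v) < \<epsilon>" using d2(2)[of s v] sv \<delta> by auto
    then show "norm (\<psi>I s v - \<psi>I 0 0 - v) < \<epsilon>" by (simp add: psi_time_zero(2)[of v] algebra_simps)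
  qed (use \<delta> in auto)
qed

text \<open>The quotient of \<open>F s x v\<close> and \<open>F s y0 v\<close> is the exponential of the pairing of \<open>\<psi>\<close> with \<open>x - y0\<close>. Therefore convergence at
the one point \<open>y0\<close>, together with that of \<open>\<psi>\<close>, gives convergence on bounded sets.\<close>

lemma F_near_zero_uniform:
  assumes "R \<ge> 0" "\<epsilon> > 0"
  shows "\<exists>\<delta>>0. \<forall>s\<in>{0..\<delta>}. \<forall>v\<in>cball 0 R. \<forall>x\<in>D \<inter> cball 0 r. norm (F s x v - iexp (v \<bullet> x)) < \<epsilon>"
proof -
  define r' where "r' = \<bar>r\<bar> + norm y0 + 1"
  have r': "r' \<ge> 1" by (simp add: r'_def)
  have "isCont exp (0::complex)" by simp
  then obtain e1 where e1: "e1 > 0" "\<And>z::complex. norm z < e1 \<Longrightarrow> norm (exp z - 1) < \<epsilon> / 2"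
    unfolding isCont_def LIM_eq using assms by (metis diff_zero exp_zero half_gt_zero norm_zero right_minus_eq)
  obtain d1 where d1: "d1 > 0" "\<And>s v. s \<in> {0..d1} \<Longrightarrow> v \<in> cball 0 R \<Longrightarrow> norm (F s y0 v - iexp (v \<bullet> y0)) < \<epsilon> / 2"
    using F_near_zero[OF y0 assms(1), of "\<epsilon> / 2"] assms by auto
  obtain d2 where d2: "d2 > 0" "\<And>s v. s \<in> {0..d2} \<Longrightarrow> v \<in> cball 0 R \<Longrightarrow> norm (\<psi>R s v) < e1 / (2 * r') \<and> norm (\<psi>I s v - \<psi>I 0 0 - v) < e1 / (2 * r')"
    using psi_near_zero[OF assms(1), of "e1 / (2 * r')"] e1 r' by auto
  show ?thesis
  proof (intro exI[of _ "min d1 d2"] conjI ballI)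
    fix s v x assume sv: "s \<in> {0..min d1 d2}" "v \<in> cball (0::'v) R" and x: "x \<in> D \<inter> cball 0 r"
    let ?z = "x - y0"
    have nz: "norm ?z \<le> r'"
    proof -
      have "norm x \<le> r" using x by simp
      then show ?thesis
        using norm_triangle_ineq4[of x y0] abs_ge_self[of r] unfolding r'_def by linarith
    qed
    define h where "h = Complex (\<psi>R s v \<bullet> ?z) ((\<psi>I s v - \<psi>I 0 0 - v) \<bullet> ?z)"
    have "norm h \<le> \<bar>\<psi>R s v \<bullet> ?z\<bar> + \<bar>(\<psi>I s v - \<psi>I 0 0 - v) \<bullet> ?z\<bar>"
      using cmod_le[of h] by (simp add: h_def)
    also have "\<dots> \<le> norm (\<psi>R s v) * r' + norm (\<psi>I s v - \<psi>I 0 0 - v) * r'"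
      using nz by (intro add_mono order_trans[OF Cauchy_Schwarz_ineq2] mult_left_mono) auto
    also have "\<dots> < e1 / (2 * r') * r' + e1 / (2 * r') * r'"
      using d2(2)[of s v] sv r' by (intro add_strict_mono mult_strict_right_mono) auto
    also have "\<dots> = e1" using r' by simp
    finally have h: "norm (exp h - 1) < \<epsilon> / 2" by (rule e1)
    let ?e = "\<lambda>x. exp (Complex (\<psi>R s v \<bullet> x) (\<psi>I s v \<bullet> x))"
    have eq: "F s x v = F s y0 v * (iexp (v \<bullet> ?z) * exp h)"
    proof -
      have "Complex (\<psi>R s v \<bullet> x) (\<psi>I s v \<bullet> x) = Complex (\<psi>R s v \<bullet> y0) (\<psi>I s v \<bullet> y0) + (\<i> * (\<psi>I 0 0 \<bullet> ?z) + (\<i> * (v \<bullet> ?z) + h))"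
        by (simp add: h_def complex_eq_iff inner_diff_left inner_diff_right)
      then have "?e x = ?e y0 * (iexp (\<psi>I 0 0 \<bullet> ?z) * (iexp (v \<bullet> ?z) * exp h))"
        by (simp only: exp_add)
      then have "?e x = ?e y0 * (iexp (v \<bullet> ?z) * exp h)"
        using psi_time_zero(3)[of x] x by simp
      then show ?thesis using sv x by (simp add: F_eq y0)
    qed
    have "iexp (v \<bullet> x) = iexp (v \<bullet> y0) * iexp (v \<bullet> ?z)"
      by (simp add: inner_diff_right flip: exp_add distrib_left of_real_add)
    then have "F s x v - iexp (v \<bullet> x) = iexp (v \<bullet> ?z) * (F s y0 v * (exp h - 1) + (F s y0 v - iexp (v \<bullet> y0)))"
      unfolding eq by (simp add: algebra_simps)
    also have "norm \<dots> = norm (F s y0 v * (exp h - 1) + (F s y0 v - iexp (v \<bullet> y0)))"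
      by (simp only: norm_mult norm_exp_i_times mult_1)
    also have "\<dots> \<le> norm (F s y0 v) * norm (exp h - 1) + norm (F s y0 v - iexp (v \<bullet> y0))"
      by (metis norm_mult norm_triangle_ineq)
    also have "\<dots> \<le> 1 * norm (exp h - 1) + norm (F s y0 v - iexp (v \<bullet> y0))"
      using norm_F_le[of s y0 v] mass_le_1[of s y0] sv y0 by (intro add_mono mult_right_mono) auto
    also have "\<dots> < \<epsilon> / 2 + \<epsilon> / 2" using h d1(2)[of s v] sv by simp
    finally show "norm (F s x v - iexp (v \<bullet> x)) < \<epsilon>" by simp
  qed (use d1 d2 in auto)
qed

text \<open>The Gaussian tail bound needs the characteristic function up to a Gaussian tail only on a bounded set of
arguments, where it is uniformly close to that of the point mass at \<open>x\<close>.\<close>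

lemma directional_tail_small:
  assumes "\<epsilon> > 0" "\<eta> > 0" "norm b = 1"
  shows "\<exists>\<delta>>0. \<forall>s\<in>{0..\<delta>}. \<forall>x\<in>D \<inter> cball 0 r. measure (\<kappa> s x) {\<xi>. \<bar>b \<bullet> (\<xi> - x)\<bar> \<ge> \<epsilon>} \<le> \<eta>"
proof -
  interpret G: prob_space gauss by (rule prob_space_gauss)
  define \<tau> where "\<tau> = 2 / \<epsilon>"
  have \<tau>: "\<tau> > 0" "2 / \<tau> = \<epsilon>" using assms by (auto simp: \<tau>_def)
  obtain W where W: "W > 0" "measure gauss {w. \<bar>w\<bar> > W} < \<eta> / 8"
    using gauss_tail[of "\<eta> / 8"] assms by auto
  obtain \<delta> where \<delta>: "\<delta> > 0" "\<And>s v x. s \<in> {0..\<delta>} \<Longrightarrow> v \<in> cball 0 (\<tau> * W) \<Longrightarrow> x \<in> D \<inter> cball 0 r \<Longrightarrow> norm (F s x v - iexp (v \<bullet> x)) < \<eta> / 4"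
    using F_near_zero_uniform[of "\<tau> * W" "\<eta> / 4" r] \<tau> W assms by auto
  show ?thesis
  proof (intro exI[of _ \<delta>] conjI ballI \<delta>)
    fix s x assume s: "s \<in> {0..\<delta>}" and x: "x \<in> D \<inter> cball 0 r"
    then have sx: "s \<ge> 0" "x \<in> D" by auto
    interpret M: finite_measure "\<kappa> s x" using sx by (rule finite_kappa)
    let ?Y = "\<lambda>\<xi>. b \<bullet> (\<xi> - x)"
    have Y: "?Y \<in> borel_measurable (\<kappa> s x)"
      using sx by (intro meas_kappa borel_measurable_continuous_onI continuous_intros)
    let ?\<phi> = "\<lambda>w. CLINT \<xi>|\<kappa> s x. iexp (w * (\<tau> * ?Y \<xi>))"
    have phi: "?\<phi> w = iexp (- (((w * \<tau>) *\<^sub>R b) \<bullet> x)) * F s x ((w * \<tau>) *\<^sub>R b)" for w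
    proof -
      have "?\<phi> w = (CLINT \<xi>|\<kappa> s x. iexp (- (((w * \<tau>) *\<^sub>R b) \<bullet> x)) * iexp (((w * \<tau>) *\<^sub>R b) \<bullet> \<xi>))"
        by (intro Bochner_Integration.integral_cong refl) (simp add: inner_diff_right algebra_simps flip: exp_add)
      then show ?thesis unfolding F_def by (simp only: integral_mult_right_zero)
    qed
    have near: "norm (?\<phi> w - 1) < \<eta> / 4" if "\<bar>w\<bar> \<le> W" for w
    proof -
      let ?v = "(w * \<tau>) *\<^sub>R b"
      have "norm ?v \<le> \<tau> * W" using that \<tau> assms by (simp add: abs_mult mult.commute)
      then have "norm (F s x ?v - iexp (?v \<bullet> x)) < \<eta> / 4" using s x by (intro \<delta>) auto
      moreover have "?\<phi> w - 1 = iexp (- (?v \<bullet> x)) * (F s x ?v - iexp (?v \<bullet> x))"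
        unfolding phi right_diff_distrib by (simp flip: exp_add)
      ultimately show ?thesis by (simp only: norm_mult norm_exp_i_times mult_1)
    qed
    have le1: "norm (?\<phi> w) \<le> 1" for w
      unfolding phi using norm_F_le[OF sx] mass_le_1[OF sx] by (simp only: norm_mult norm_exp_i_times mult_1) (rule order_trans)
    have meas: "?\<phi> \<in> borel_measurable gauss"
    proof -
      have "(\<lambda>(w, \<xi>). iexp (w * (\<tau> * ?Y \<xi>))) \<in> borel_measurable (borel \<Otimes>\<^sub>M \<kappa> s x)"
        using Y by measurable
      then have "?\<phi> \<in> borel_measurable borel"
        by (rule M.borel_measurable_lebesgue_integral)
      then show ?thesis by simp
    qed
    have "measure (\<kappa> s x) {\<xi>. \<bar>?Y \<xi>\<bar> \<ge> \<epsilon>} \<le> 2 * (mass s x - Re (CLINT w|gauss. ?\<phi> w))"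
      using measure_tail_le_gaussian[OF M.finite_measure_axioms Y \<tau>(1)] sx \<tau> by (simp add: space_kappa mass_def)
    also have "\<dots> \<le> 2 * (1 - Re (CLINT w|gauss. ?\<phi> w))"
      using mass_le_1[OF sx] by simp
    also have "1 - Re (CLINT w|gauss. ?\<phi> w) = (LINT w|gauss. 1 - Re (?\<phi> w))"
    proof -
      have int: "integrable gauss ?\<phi>"
        using meas le1 by (intro G.integrable_const_bound[where B=1]) auto
      have "(LINT w|gauss. 1 - Re (?\<phi> w)) = (LINT w|gauss. 1) - (LINT w|gauss. Re (?\<phi> w))"
        using int by (intro Bochner_Integration.integral_diff) auto
      moreover have "(LINT w|gauss. Re (?\<phi> w)) = Re (CLINT w|gauss. ?\<phi> w)"
        using int by (rule integral_Re)
      moreover have "(LINT w|gauss. (1::real)) = 1" using G.prob_space by simp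
      ultimately show ?thesis by simp
    qed
    also have "\<dots> \<le> (LINT w|gauss. \<eta> / 4 + 2 * indicator {w. \<bar>w\<bar> > W} w)"
    proof (rule integral_mono)
      have Re_le: "\<bar>Re (?\<phi> w)\<bar> \<le> 1" for w
        using abs_Re_le_cmod le1 by (rule order_trans)
      have "\<bar>1 - Re (?\<phi> w)\<bar> \<le> 2" for w
        using Re_le[of w] unfolding abs_le_iff by linarith
      then show "integrable gauss (\<lambda>w. 1 - Re (?\<phi> w))"
        using meas by (intro G.integrable_const_bound[where B=2]) auto
      show "integrable gauss (\<lambda>w. \<eta> / 4 + 2 * indicator {w. \<bar>w\<bar> > W} w)"
        using assms by (intro G.integrable_const_bound[where B="\<eta> / 4 + 2"]) (auto simp: indicator_def)
      show "1 - Re (?\<phi> w) \<le> \<eta> / 4 + 2 * indicator {w. \<bar>w\<bar> > W} w" for w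
      proof (cases "\<bar>w\<bar> > W")
        case True
        then show ?thesis using Re_le[of w] assms by simp
      next
        case False
        then have "norm (?\<phi> w - 1) < \<eta> / 4" by (intro near) simp
        then show ?thesis using abs_Re_le_cmod[of "?\<phi> w - 1"] False by simp
      qed
    qed
    also have "\<dots> = \<eta> / 4 + 2 * measure gauss {w. \<bar>w\<bar> > W}"
    proof (subst Bochner_Integration.integral_add)
      show "integrable gauss (\<lambda>w. 2 * indicator {w. \<bar>w\<bar> > W} w :: real)"
        by (intro G.integrable_const_bound[where B=2]) (auto simp: indicator_def)
    qed (use G.prob_space in auto)
    finally show "measure (\<kappa> s x) {\<xi>. \<bar>b \<bullet> (\<xi> - x)\<bar> \<ge> \<epsilon>} \<le> \<eta>" using W by simp
  qed
qed

lemma locally_uniformly_stochastically_continuous: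
  assumes "\<epsilon> > 0"
  shows "\<exists>\<delta>>0. \<forall>s\<in>{0..\<delta>}. \<forall>x\<in>D \<inter> cball 0 r. measure (\<kappa> s x) (ball x \<epsilon>) \<ge> 1 - \<epsilon>"
proof -
  define n where "n = real DIM('v)"
  have n: "n \<ge> 1" using DIM_positive[where 'a='v] by (simp add: n_def)
  have "\<forall>b\<in>Basis. \<exists>\<delta>>0. \<forall>s\<in>{0..\<delta>}. \<forall>x\<in>D \<inter> cball 0 r. measure (\<kappa> s x) {\<xi>. \<bar>b \<bullet> (\<xi> - x)\<bar> \<ge> \<epsilon> / n} \<le> \<epsilon> / (2 * n)"
    using assms n by (intro ballI directional_tail_small) auto
  then obtain db where db: "\<And>b. b \<in> Basis \<Longrightarrow> db b > 0"
     "\<And>b s x. b \<in> Basis \<Longrightarrow> s \<in> {0..db b} \<Longrightarrow> x \<in> D \<inter> cball 0 r \<Longrightarrow> measure (\<kappa> s x) {\<xi>. \<bar>b \<bullet> (\<xi> - x)\<bar> \<ge> \<epsilon> / n} \<le> \<epsilon> / (2 * n)"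
    by metis
  obtain d0 where d0: "d0 > 0" "\<And>s x. s \<in> {0..d0} \<Longrightarrow> x \<in> D \<inter> cball 0 r \<Longrightarrow> norm (F s x 0 - iexp (0 \<bullet> x)) < \<epsilon> / 2"
    using F_near_zero_uniform[of 0 "\<epsilon> / 2" r] assms by auto
  define \<delta> where "\<delta> = min d0 (Min (db ` Basis))"
  have \<delta>: "\<delta> > 0" "\<delta> \<le> d0" "\<And>b. b \<in> Basis \<Longrightarrow> \<delta> \<le> db b"
    using d0 db unfolding \<delta>_def by (auto intro!: min.coboundedI2 Min_le)
  show ?thesis
  proof (intro exI[of _ \<delta>] conjI ballI \<delta>)
    fix s x assume s: "s \<in> {0..\<delta>}" and x: "x \<in> D \<inter> cball 0 r"
    then have sx: "s \<ge> 0" "x \<in> D" by auto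
    interpret M: finite_measure "\<kappa> s x" using sx by (rule finite_kappa)
    let ?T = "\<lambda>b. {\<xi>. \<bar>b \<bullet> (\<xi> - x)\<bar> \<ge> \<epsilon> / n}"
    have T: "?T b \<in> sets (\<kappa> s x)" for b
      unfolding sets_kappa[OF sx] by (intro borel_closed closed_Collect_le continuous_intros)
    have F0: "F s x 0 = mass s x"
      using sx by (simp add: F_def mass_def space_kappa scaleR_conv_of_real)
    have "norm (F s x 0 - iexp (0 \<bullet> x)) < \<epsilon> / 2" using s \<delta> x by (intro d0) auto
    then have "norm (complex_of_real (mass s x - 1)) < \<epsilon> / 2" by (simp add: F0)
    then have "\<bar>mass s x - 1\<bar> < \<epsilon> / 2" by (simp only: norm_of_real)
    then have "mass s x > 1 - \<epsilon> / 2" by linarith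
    moreover have "UNIV \<subseteq> ball x \<epsilon> \<union> (\<Union>b\<in>Basis. ?T b)"
    proof
      fix \<xi> :: 'v
      show "\<xi> \<in> ball x \<epsilon> \<union> (\<Union>b\<in>Basis. ?T b)"
      proof (rule ccontr)
        assume not: "\<xi> \<notin> ball x \<epsilon> \<union> (\<Union>b\<in>Basis. ?T b)"
        have "norm (\<xi> - x) \<le> (\<Sum>b\<in>Basis. \<bar>(\<xi> - x) \<bullet> b\<bar>)" by (rule norm_le_l1)
        also have "\<dots> < (\<Sum>b\<in>(Basis::'v set). \<epsilon> / n)"
          using not by (intro sum_strict_mono) (auto simp: inner_commute)
        also have "\<dots> = \<epsilon>" using n by (simp add: n_def)
        finally show False using not by (simp add: dist_norm norm_minus_commute)
      qed
    qed
    then have "mass s x \<le> measure (\<kappa> s x) (ball x \<epsilon> \<union> (\<Union>b\<in>Basis. ?T b))"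
      unfolding mass_def using T sx by (intro M.finite_measure_mono sets.Un sets.finite_UN) (auto simp: sets_kappa)
    moreover have "measure (\<kappa> s x) (ball x \<epsilon> \<union> (\<Union>b\<in>Basis. ?T b)) \<le> measure (\<kappa> s x) (ball x \<epsilon>) + measure (\<kappa> s x) (\<Union>b\<in>Basis. ?T b)"
      using T sx by (intro measure_Un_le sets.finite_UN) (auto simp: sets_kappa)
    moreover have "measure (\<kappa> s x) (\<Union>b\<in>Basis. ?T b) \<le> (\<Sum>b\<in>Basis. measure (\<kappa> s x) (?T b))"
      using T by (intro M.finite_measure_subadditive_finite) auto
    moreover have "(\<Sum>b\<in>Basis. measure (\<kappa> s x) (?T b)) \<le> (\<Sum>b\<in>(Basis::'v set). \<epsilon> / (2 * n))"
      using s x \<delta>(3) by (intro sum_mono db) force+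
    moreover have "(\<Sum>b\<in>(Basis::'v set). \<epsilon> / (2 * n)) = \<epsilon> / 2" using n by (simp add: n_def)
    ultimately show "measure (\<kappa> s x) (ball x \<epsilon>) \<ge> 1 - \<epsilon>" by linarith
  qed
qed

lemma psi_growth_lower_bound:
  assumes "norm (\<psi>I s \<theta> - \<psi>I 0 0 - \<theta>) \<le> 1 / 4" "norm (\<psi>I s 0 - \<psi>I 0 0 - 0) \<le> 1 / 4" 
  shows "(\<psi>I s \<theta> - \<psi>I s 0) \<bullet> z \<ge> \<theta> \<bullet> z - norm z / 2"
proof -
  let ?d = "(\<psi>I s \<theta> - \<psi>I 0 0 - \<theta>) - (\<psi>I s 0 - \<psi>I 0 0 - 0)"
  have "norm ?d \<le> 1 / 2"
    using norm_triangle_ineq4[of "\<psi>I s \<theta> - \<psi>I 0 0 - \<theta>" "\<psi>I s 0 - \<psi>I 0 0 - 0"] assms by linarith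
  then have "norm ?d * norm z \<le> 1 / 2 * norm z" by (intro mult_right_mono) auto
  with Cauchy_Schwarz_ineq2[of ?d z] have "\<bar>?d \<bullet> z\<bar> \<le> norm z / 2" by linarith
  moreover have "(\<psi>I s \<theta> - \<psi>I s 0) \<bullet> z = \<theta> \<bullet> z + ?d \<bullet> z"
    by (simp add: inner_diff_left)
  ultimately show ?thesis by linarith
qed

lemma F_cont:
  assumes "s \<ge> 0" "x \<in> D"
  shows "continuous_on UNIV (F s x)"
  unfolding continuous_on_eq_continuous_within
proof (safe, unfold continuous_within_sequentially, safe)
  fix v X assume X: "X \<longlonglongrightarrow> (v::'v)"
  show "(F s x \<circ> X) \<longlonglongrightarrow> F s x v"
    unfolding comp_def F_def
  proof (rule integral_dominated_convergence[where w="\<lambda>_. 1"])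
    show "(\<lambda>\<xi>. iexp (v \<bullet> \<xi>)) \<in> borel_measurable (\<kappa> s x)" "(\<lambda>\<xi>. iexp (X n \<bullet> \<xi>)) \<in> borel_measurable (\<kappa> s x)" for n
      using integrable_iexp[OF assms] by auto
    show "integrable (\<kappa> s x) (\<lambda>_. 1::real)" using assms by (intro integrable_kappa[where C=1]) auto
    show "AE \<xi> in \<kappa> s x. (\<lambda>n. iexp (X n \<bullet> \<xi>)) \<longlonglongrightarrow> iexp (v \<bullet> \<xi>)"
      by (intro AE_I2 tendsto_intros X)
  qed (auto simp: norm_exp_i_times)
qed

text \<open>The main step: the process started far out does not return to a bounded set by a fixed small time.

Suppose that \<open>x\<^sub>k\<close> tends to infinity in the direction \<open>\<theta>\<close> while \<open>\<kappa> s x\<^sub>k\<close> keeps mass \<open>e\<close> in a ball, and consider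
the laws of \<open>\<theta> \<bullet> \<xi>\<close> under \<open>\<kappa> s x\<^sub>k\<close>, whose characteristic functions are \<open>\<Phi> * exp z\<^sub>k\<close> with \<open>z\<^sub>k\<close> the pairing of
\<open>\<psi> s (w \<theta>)\<close> with \<open>x\<^sub>k\<close>. The real part of \<open>z\<^sub>k\<close> is bounded above, so along a subsequence it converges or tends
to minus infinity, for each \<open>w\<close>. By the results on limits of moduli, the second case does not occur,
the characteristic functions are equicontinuous and their moduli are bounded below. So from \<open>w = 0\<close> to \<open>w = 1\<close>
the argument of \<open>exp z\<^sub>k\<close> changes by an amount bounded independently of \<open>k\<close>. But \<open>\<psi> s\<close> is close to the one at time 0, which is
\<open>\<i> v\<close> up to a constant, and this makes the argument grow by a fixed fraction of \<open>norm x\<^sub>k\<close>.\<close>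

lemma vanishing_at_infinity:
  assumes s: "s \<ge> 0" and \<delta>: "s \<le> \<delta>"
    and near: "\<And>s v. s \<in> {0..\<delta>} \<Longrightarrow> v \<in> cball 0 1 \<Longrightarrow> \<Phi> s v \<noteq> 0 \<and> norm (\<psi>I s v - \<psi>I 0 0 - v) \<le> 1 / 4"
    and "e > 0"
  shows "\<exists>M. \<forall>x\<in>D. norm x \<ge> M \<longrightarrow> measure (\<kappa> s x) (cball 0 a) < e"
proof (rule ccontr)
  assume "\<not> ?thesis"
  then have "\<forall>n::nat. \<exists>x\<in>D. norm x \<ge> real (Suc n) \<and> measure (\<kappa> s x) (cball 0 a) \<ge> e"
    by (auto simp: not_less)
  then obtain X where X: "\<And>n. X n \<in> D" "\<And>n. norm (X n) \<ge> real (Suc n)" "\<And>n. measure (\<kappa> s (X n)) (cball 0 a) \<ge> e"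
    by metis
  have "\<forall>n. X n /\<^sub>R norm (X n) \<in> sphere 0 1"
  proof
    fix n have "norm (X n) > 0" using X(2)[of n] by (meson of_nat_0_less_iff less_le_trans zero_less_Suc)
    then show "X n /\<^sub>R norm (X n) \<in> sphere 0 1" by simp
  qed
  then obtain \<theta> \<rho> where \<theta>: "\<theta> \<in> sphere (0::'v) 1" and \<rho>: "strict_mono (\<rho> :: nat \<Rightarrow> nat)"
    and lim\<theta>: "((\<lambda>n. X n /\<^sub>R norm (X n)) \<circ> \<rho>) \<longlonglongrightarrow> \<theta>"
    by (rule seq_compactE[OF compact_imp_seq_compact[OF compact_sphere]])
  obtain \<sigma> S g where \<sigma>: "strict_mono (\<sigma> :: nat \<Rightarrow> nat)" and S: "subspace (S :: 'v set)" "linear g"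
    and conv: "\<And>r. r \<in> S \<Longrightarrow> (\<lambda>k. r \<bullet> X (\<rho> (\<sigma> k))) \<longlonglongrightarrow> g r"
    and div: "\<And>r C. r \<notin> S \<Longrightarrow> (\<And>k. r \<bullet> X (\<rho> (\<sigma> k)) \<le> C) \<Longrightarrow> filterlim (\<lambda>k. r \<bullet> X (\<rho> (\<sigma> k))) at_bot sequentially"
    by (rule inner_dichotomy_subsequence[of "\<lambda>k. X (\<rho> k)"]) blast
  define x where "x k = X (\<rho> (\<sigma> k))" for k
  have x: "x k \<in> D" "measure (\<kappa> s (x k)) (cball 0 a) \<ge> e" for k
    using X by (auto simp: x_def)
  have mono: "strict_mono (\<rho> \<circ> \<sigma>)" using \<rho> \<sigma> by (rule strict_mono_o)
  have x_inf: "filterlim (\<lambda>k. norm (x k)) at_top sequentially"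
  proof -
    have "filterlim (\<lambda>k. real (Suc ((\<rho> \<circ> \<sigma>) k))) at_top sequentially"
      using filterlim_subseq[OF mono] by (intro filterlim_compose[OF filterlim_real_sequentially] filterlim_compose[OF filterlim_Suc])
    then show ?thesis
      by (rule filterlim_at_top_mono) (use X(2) in \<open>auto simp: x_def\<close>)
  qed
  have dir: "(\<lambda>k. x k /\<^sub>R norm (x k)) \<longlonglongrightarrow> \<theta>"
    using LIMSEQ_subseq_LIMSEQ[OF lim\<theta> \<sigma>] by (simp add: x_def comp_def)
  have n\<theta>: "norm \<theta> = 1" using \<theta> by simp
  have w\<theta>: "w *\<^sub>R \<theta> \<in> cball 0 1" if "w \<in> {0..1}" for w
    using that n\<theta> by simp
  have nz: "\<Phi> s (w *\<^sub>R \<theta>) \<noteq> 0" if "w \<in> {0..1}" for w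
    using near[of s "w *\<^sub>R \<theta>"] w\<theta>[OF that] s \<delta> by auto
  have psi_line: "continuous_on {0..1} (\<lambda>w. \<psi>R s (w *\<^sub>R \<theta>))" "continuous_on {0..1} (\<lambda>w. \<psi>I s (w *\<^sub>R \<theta>))"
  proof -
    have nz': "\<Phi> s v \<noteq> 0" if "s \<in> {0..\<delta>}" "v \<in> cball 0 1" for s v using near[OF that] by simp
    have map: "continuous_on {0..1} (\<lambda>w. (s, w *\<^sub>R \<theta>))" "(\<lambda>w. (s, w *\<^sub>R \<theta>)) ` {0..1} \<subseteq> {0..\<delta>} \<times> cball 0 1"
      using w\<theta> s \<delta> by (auto intro!: continuous_intros)
    show "continuous_on {0..1} (\<lambda>w. \<psi>R s (w *\<^sub>R \<theta>))"
      using continuous_on_compose2[OF psi_component_cont(1)[OF nz'] map] by simp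
    show "continuous_on {0..1} (\<lambda>w. \<psi>I s (w *\<^sub>R \<theta>))"
      using continuous_on_compose2[OF psi_component_cont(2)[OF nz'] map] by simp
  qed
  define z where "z y w = Complex (\<psi>R s (w *\<^sub>R \<theta>) \<bullet> y) (\<psi>I s (w *\<^sub>R \<theta>) \<bullet> y)" for y w
  have z_cont: "continuous_on {0..1} (z y)" for y
    unfolding z_def Complex_eq by (intro continuous_intros psi_line)
  have Fz: "F s y (w *\<^sub>R \<theta>) = \<Phi> s (w *\<^sub>R \<theta>) * exp (z y w)" if "y \<in> D" for y w
    unfolding z_def using s that by (rule F_eq)
  have Phi_line: "continuous_on {0..1} (\<lambda>w. \<Phi> s (w *\<^sub>R \<theta>))"
  proof -
    have "continuous_on {0..1} (\<lambda>w. F s y0 (w *\<^sub>R \<theta>) * exp (- z y0 w))"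
      by (intro continuous_intros z_cont continuous_on_compose2[OF F_cont[OF s y0]]) auto
    moreover have "F s y0 (w *\<^sub>R \<theta>) * exp (- z y0 w) = \<Phi> s (w *\<^sub>R \<theta>)" for w
      by (simp add: Fz y0 mult.assoc flip: exp_add)
    ultimately show ?thesis by simp
  qed
  define \<mu> where "\<mu> k = distr (\<kappa> s (x k)) borel (\<lambda>\<xi>. \<theta> \<bullet> \<xi>)" for k
  have meas: "(\<lambda>\<xi>. \<theta> \<bullet> \<xi>) \<in> borel_measurable (\<kappa> s (x k))" for k
    using s x(1) by (intro meas_kappa borel_measurable_continuous_onI continuous_intros)
  have char_mu: "char (\<mu> k) w = F s (x k) (w *\<^sub>R \<theta>)" for k w
    unfolding char_def \<mu>_def F_def by (subst integral_distr[OF meas]) simp_all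
  \<comment> \<open>On \<open>E\<close> the real part of the exponent converges, off \<open>E\<close> it tends to minus infinity.\<close>
  define E where "E = {w \<in> {0..1}. \<psi>R s (w *\<^sub>R \<theta>) \<in> S}"
  define \<gamma> where "\<gamma> w = norm (\<Phi> s (w *\<^sub>R \<theta>)) * exp (g (\<psi>R s (w *\<^sub>R \<theta>)))" for w
  have norm_F: "norm (F s (x k) (w *\<^sub>R \<theta>)) = norm (\<Phi> s (w *\<^sub>R \<theta>)) * exp (\<psi>R s (w *\<^sub>R \<theta>) \<bullet> x k)" for k w
    using x(1)[of k] by (simp add: Fz norm_mult z_def norm_exp)
  interpret L: modulus_limit \<mu> E \<gamma> "\<bar>a\<bar>" e
  proof (rule modulus_limit.intro)
    fix k
    interpret M: finite_measure "\<kappa> s (x k)" using s x(1) by (rule finite_kappa)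
    have sp: "space (\<kappa> s (x k)) = UNIV" using s x(1) by (rule space_kappa)
    show "finite_measure (\<mu> k)" unfolding \<mu>_def by (rule M.finite_measure_distr[OF meas])
    show "measure (\<mu> k) UNIV \<le> 1"
      using measure_distr[OF meas[of k], of UNIV] mass_le_1[OF s x(1), of k] by (simp add: \<mu>_def sp mass_def)
    have "e \<le> measure (\<kappa> s (x k)) (cball 0 a)" by (rule x)
    also have "\<dots> \<le> measure (\<kappa> s (x k)) ((\<lambda>\<xi>. \<theta> \<bullet> \<xi>) -` {-\<bar>a\<bar>..\<bar>a\<bar>} \<inter> space (\<kappa> s (x k)))"
    proof (rule M.finite_measure_mono)
      show "cball 0 a \<subseteq> (\<lambda>\<xi>. \<theta> \<bullet> \<xi>) -` {-\<bar>a\<bar>..\<bar>a\<bar>} \<inter> space (\<kappa> s (x k))"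
      proof
        fix \<xi> :: 'v assume "\<xi> \<in> cball 0 a"
        then have "\<bar>\<theta> \<bullet> \<xi>\<bar> \<le> \<bar>a\<bar>" using Cauchy_Schwarz_ineq2[of \<theta> \<xi>] n\<theta> by simp
        then show "\<xi> \<in> (\<lambda>\<xi>. \<theta> \<bullet> \<xi>) -` {-\<bar>a\<bar>..\<bar>a\<bar>} \<inter> space (\<kappa> s (x k))" by (auto simp: sp)
      qed
    qed (rule measurable_sets[OF meas], simp)
    also have "\<dots> = measure (\<mu> k) {-\<bar>a\<bar>..\<bar>a\<bar>}"
      unfolding \<mu>_def by (rule measure_distr[OF meas, symmetric]) simp
    finally show "e \<le> measure (\<mu> k) {-\<bar>a\<bar>..\<bar>a\<bar>}" .
  next
    fix w :: real assume w: "w \<in> {0..1}"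
    show "\<gamma> w > 0" using nz[OF w] by (simp add: \<gamma>_def)
    show "(\<lambda>k. norm (char (\<mu> k) w)) \<longlonglongrightarrow> (if w \<in> E then \<gamma> w else 0)"
    proof (cases "w \<in> E")
      case True
      then have "(\<lambda>k. \<psi>R s (w *\<^sub>R \<theta>) \<bullet> x k) \<longlonglongrightarrow> g (\<psi>R s (w *\<^sub>R \<theta>))"
        unfolding x_def by (intro conv) (simp add: E_def)
      then show ?thesis
        unfolding char_mu norm_F using True by (simp add: \<gamma>_def tendsto_intros)
    next
      case False
      have "\<psi>R s (w *\<^sub>R \<theta>) \<bullet> x k \<le> ln (1 / norm (\<Phi> s (w *\<^sub>R \<theta>)))" for k
      proof -
        have "norm (\<Phi> s (w *\<^sub>R \<theta>)) * exp (\<psi>R s (w *\<^sub>R \<theta>) \<bullet> x k) \<le> 1"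
          using norm_F_le[OF s x(1), of k "w *\<^sub>R \<theta>"] mass_le_1[OF s x(1), of k] by (simp add: norm_F)
        then have "exp (\<psi>R s (w *\<^sub>R \<theta>) \<bullet> x k) \<le> 1 / norm (\<Phi> s (w *\<^sub>R \<theta>))"
          using nz[OF w] by (simp add: field_simps)
        then show ?thesis using nz[OF w] by (subst ln_ge_iff) auto
      qed
      then have "filterlim (\<lambda>k. \<psi>R s (w *\<^sub>R \<theta>) \<bullet> x k) at_bot sequentially"
        unfolding x_def using False w by (intro div) (auto simp: E_def)
      then have "(\<lambda>k. exp (\<psi>R s (w *\<^sub>R \<theta>) \<bullet> x k)) \<longlonglongrightarrow> 0"
        by (rule filterlim_compose[OF exp_at_bot])
      then show ?thesis
        unfolding char_mu norm_F using False by (simp add: tendsto_mult_right_zero)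
    qed
  next
    have "continuous_on UNIV g" using S(2) by (rule linear_continuous_on_compose[OF continuous_on_id, unfolded comp_def id_def, simplified])
    then show "continuous_on {0..1} \<gamma>"
      unfolding \<gamma>_def by (intro continuous_intros Phi_line continuous_on_compose2[OF \<open>continuous_on UNIV g\<close> psi_line(1)]) auto
    have "closed S" using S(1) by (rule closed_subspace)
    then have "closed ({0..1} \<inter> (\<lambda>w. \<psi>R s (w *\<^sub>R \<theta>)) -` S)"
      by (intro continuous_closed_preimage psi_line) auto
    then show "closed E" by (simp add: E_def vimage_def Int_def)
  qed (auto simp: \<mu>_def E_def \<open>e > 0\<close>)
  obtain c where c: "c > 0" and below: "\<forall>\<^sub>F k in sequentially. \<forall>w\<in>{0..1}. norm (F s (x k) (w *\<^sub>R \<theta>)) \<ge> c"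
    using L.bounded_below unfolding char_mu by blast
  have f_line: "continuous_on {0..1} (\<lambda>w. F s y0 (w *\<^sub>R \<theta>))"
    by (intro continuous_intros continuous_on_compose2[OF F_cont[OF s y0]]) auto
  obtain c1 where c1: "c1 > 0" "\<And>w. w \<in> {0..1} \<Longrightarrow> norm (F s y0 (w *\<^sub>R \<theta>)) \<ge> c1"
  proof -
    obtain w0 where w0: "w0 \<in> {0..1}" "\<And>w. w \<in> {0..1} \<Longrightarrow> norm (F s y0 (w0 *\<^sub>R \<theta>)) \<le> norm (F s y0 (w *\<^sub>R \<theta>))"
      using continuous_attains_inf[OF _ _ continuous_on_norm[OF f_line]] by auto
    show ?thesis
      by (rule that[of "norm (F s y0 (w0 *\<^sub>R \<theta>))"]) (use w0 nz[OF w0(1)] in \<open>auto simp: Fz y0\<close>)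
  qed
  define \<eta> where "\<eta> = c * c1 / 4"
  have \<eta>: "\<eta> > 0" using c c1 by (simp add: \<eta>_def)
  obtain d1 where d1: "d1 > 0" and equi: "\<forall>\<^sub>F k in sequentially. \<forall>v w. \<bar>v - w\<bar> \<le> d1 \<longrightarrow> norm (F s (x k) (v *\<^sub>R \<theta>) - F s (x k) (w *\<^sub>R \<theta>)) \<le> \<eta>"
    using L.asymptotically_equicontinuous[OF \<eta>] unfolding char_mu by blast
  obtain d2 where d2: "d2 > 0" "\<And>v w. v \<in> {0..1} \<Longrightarrow> w \<in> {0..1} \<Longrightarrow> \<bar>v - w\<bar> < d2 \<Longrightarrow> norm (F s y0 (v *\<^sub>R \<theta>) - F s y0 (w *\<^sub>R \<theta>)) < \<eta>"
    using compact_uniformly_continuous[OF f_line compact_Icc] \<eta>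
    unfolding uniformly_continuous_on_def dist_norm real_norm_def by metis
  obtain N :: nat where N: "N > 0" "1 / real N < min d1 d2"
    using reals_Archimedean[of "min d1 d2"] d1 d2 by (auto simp: inverse_eq_divide) (metis lessI of_nat_Suc zero_less_Suc)
  \<comment> \<open>The bound for the variation of the argument; it does not depend on \<open>k\<close>.\<close>
  define C where "C = real N * (pi / 2)"
  have "C \<ge> 0" by (simp add: C_def)
  have upper: "\<forall>\<^sub>F k in sequentially. \<bar>Im (z (x k - y0) 1) - Im (z (x k - y0) 0)\<bar> \<le> C"
    unfolding C_def
    using below equi
  proof eventually_elim
    case (elim k)
    have z_diff: "z (x k - y0) w = z (x k) w - z y0 w" for w
      by (simp add: z_def complex_eq_iff inner_diff_right)
    show ?case
    proof (rule imaginary_part_variation_bounded[OF z_cont N(1)])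
      fix v w :: real assume v: "v \<in> {0..1}" and w: "w \<in> {0..1}" and vw: "\<bar>v - w\<bar> \<le> 1 / N"
      let ?p = "\<lambda>w. F s (x k) (w *\<^sub>R \<theta>)" and ?f = "\<lambda>w. F s y0 (w *\<^sub>R \<theta>)"
      have nz_p: "?p w \<noteq> 0" using elim(1) w c by force
      have nz_f: "?f w \<noteq> 0" "?f v \<noteq> 0" using c1 v w by force+
      have e: "exp (z (x k - y0) u) = ?p u / ?f u" if "u \<in> {0..1}" for u
        using nz[OF that] x(1)[of k] y0 by (simp add: z_diff Fz exp_diff)
      have "exp (z (x k - y0) v - z (x k - y0) w) - 1 = (?p v / ?f v) / (?p w / ?f w) - 1"
        by (simp only: exp_diff e[OF v] e[OF w])
      also have "\<dots> = ((?p v - ?p w) * ?f w + ?p w * (?f w - ?f v)) / (?p w * ?f v)"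
        using nz_p nz_f by (simp add: field_simps)
      finally have "norm (exp (z (x k - y0) v - z (x k - y0) w) - 1)
          = norm ((?p v - ?p w) * ?f w + ?p w * (?f w - ?f v)) / (norm (?p w) * norm (?f v))"
        by (simp add: norm_divide norm_mult)
      also have "\<dots> \<le> (\<eta> * 1 + 1 * \<eta>) / (c * c1)"
      proof (rule frac_le)
        have "norm ((?p v - ?p w) * ?f w + ?p w * (?f w - ?f v)) \<le> norm (?p v - ?p w) * norm (?f w) + norm (?p w) * norm (?f w - ?f v)"
          by (metis norm_mult norm_triangle_ineq)
        also have "\<dots> \<le> \<eta> * 1 + 1 * \<eta>"
        proof (intro add_mono mult_mono)
          show "norm (?p v - ?p w) \<le> \<eta>" using elim(2) vw N by auto
          show "norm (?f w - ?f v) \<le> \<eta>" using d2(2)[OF w v] vw N by (simp add: abs_minus_commute)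
          show "norm (?f w) \<le> 1" "norm (?p w) \<le> 1"
            using norm_F_le[OF s y0] mass_le_1[OF s y0] norm_F_le[OF s x(1)] mass_le_1[OF s x(1)] by (meson order_trans)+
        qed (use \<eta> in auto)
        finally show "norm ((?p v - ?p w) * ?f w + ?p w * (?f w - ?f v)) \<le> \<eta> * 1 + 1 * \<eta>" .
        show "c * c1 \<le> norm (?p w) * norm (?f v)"
          using elim(1) w c c1 v by (intro mult_mono) auto
      qed (use c c1 \<eta> in auto)
      also have "\<dots> < 1" using c c1 by (simp add: \<eta>_def)
      finally show "norm (exp (z (x k - y0) v - z (x k - y0) w) - 1) < 1" .
    qed
  qed
  have near0: "norm (\<psi>I s \<theta> - \<psi>I 0 0 - \<theta>) \<le> 1 / 4" "norm (\<psi>I s 0 - \<psi>I 0 0 - 0) \<le> 1 / 4"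
    using near[of s \<theta>] near[of s 0] s \<delta> n\<theta> by auto
  have "(\<lambda>k. \<theta> \<bullet> (x k /\<^sub>R norm (x k))) \<longlonglongrightarrow> \<theta> \<bullet> \<theta>"
    by (intro tendsto_intros dir)
  then have "\<forall>\<^sub>F k in sequentially. \<theta> \<bullet> (x k /\<^sub>R norm (x k)) > 3 / 4"
    by (rule order_tendstoD) (use n\<theta> in \<open>simp add: dot_square_norm\<close>)
  \<comment> \<open>The argument grows by at least \<open>norm (x k) / 4 - 3 / 2 * norm y0\<close>, which then exceeds \<open>C\<close>.\<close>
  moreover have "\<forall>\<^sub>F k in sequentially. 4 * C + 6 * norm y0 + 4 \<le> norm (x k)"
    using x_inf by (simp add: filterlim_at_top)
  ultimately have "\<forall>\<^sub>F k in sequentially. False"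
    using upper
  proof eventually_elim
    case (elim k)
    have pos: "norm (x k) > 0"
      using elim(2) \<open>C \<ge> 0\<close> norm_ge_zero[of y0] by linarith
    have "\<theta> \<bullet> x k \<ge> 3 / 4 * norm (x k)"
      using elim(1) pos by (simp add: field_simps)
    moreover have "\<theta> \<bullet> y0 \<le> norm y0"
      using norm_cauchy_schwarz[of \<theta> y0] n\<theta> by simp
    moreover have "norm (x k - y0) \<le> norm (x k) + norm y0" by (rule norm_triangle_ineq4)
    moreover have "(\<psi>I s \<theta> - \<psi>I s 0) \<bullet> (x k - y0) \<ge> \<theta> \<bullet> (x k - y0) - norm (x k - y0) / 2"
      by (rule psi_growth_lower_bound[OF near0])
    moreover have "\<theta> \<bullet> (x k - y0) = \<theta> \<bullet> x k - \<theta> \<bullet> y0" by (rule inner_diff_right)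
    moreover have "Im (z (x k - y0) 1) - Im (z (x k - y0) 0) = (\<psi>I s \<theta> - \<psi>I s 0) \<bullet> (x k - y0)"
      by (simp add: z_def inner_diff_left)
    ultimately show False using elim(2) abs_le_D1[OF elim(3)] by linarith
  qed
  then show False by simp
qed

text \<open>By the Chapman-Kolmogorov equation, what lies in the first ball at time \<open>s\<close> lies in the second one at
time \<open>t + s\<close> with conditional probability at least \<open>1 / 2\<close>.\<close>

lemma measure_cball_propagates:
  assumes "s \<ge> 0" "t \<ge> 0" "x \<in> D"
    and stay: "\<And>\<xi>. \<xi> \<in> D \<inter> cball 0 a \<Longrightarrow> measure (\<kappa> t \<xi>) (cball 0 b) \<ge> 1 / 2"
  shows "measure (\<kappa> s x) (cball 0 a) \<le> 2 * measure (\<kappa> (t + s) x) (cball 0 b)"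
proof -
  interpret M: finite_measure "\<kappa> s x" using assms by (intro finite_kappa)
  interpret N: finite_measure "\<kappa> (t + s) x" using assms by (intro finite_kappa) auto
  let ?A = "D \<inter> cball 0 a"
  have A: "?A \<in> sets (\<kappa> s x)"
    using assms closed_D by (simp add: sets_kappa)
  have nullD: "- D \<in> sets (\<kappa> s x)" "emeasure (\<kappa> s x) (- D) = 0"
    using assms closed_D concentrated[of s x] by (auto simp: sets_kappa)
  have "emeasure (\<kappa> s x) (cball 0 a) \<le> emeasure (\<kappa> s x) (?A \<union> - D)"
    using A nullD by (intro emeasure_mono) auto
  also have "\<dots> \<le> emeasure (\<kappa> s x) ?A + emeasure (\<kappa> s x) (- D)"
    using A nullD by (intro emeasure_subadditive)
  also have "\<dots> = emeasure (\<kappa> s x) ?A" using nullD by simp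
  finally have le: "emeasure (\<kappa> s x) (cball 0 a) \<le> emeasure (\<kappa> s x) ?A" .
  have "ennreal (1 / 2) * emeasure (\<kappa> s x) ?A = (\<integral>\<^sup>+\<xi>. ennreal (1 / 2) * indicator ?A \<xi> \<partial>\<kappa> s x)"
    using A by (simp add: nn_integral_cmult_indicator)
  also have "\<dots> \<le> (\<integral>\<^sup>+\<xi>. emeasure (\<kappa> t \<xi>) (cball 0 b) \<partial>\<kappa> s x)"
  proof (rule nn_integral_mono)
    fix \<xi>
    show "ennreal (1 / 2) * indicator ?A \<xi> \<le> emeasure (\<kappa> t \<xi>) (cball 0 b)"
    proof (cases "\<xi> \<in> ?A")
      case True
      interpret K: finite_measure "\<kappa> t \<xi>" using assms True by (intro finite_kappa) auto
      have "ennreal (1 / 2) \<le> ennreal (measure (\<kappa> t \<xi>) (cball 0 b))"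
        by (intro ennreal_leI stay True)
      then show ?thesis using True by (simp only: K.emeasure_eq_measure indicator_simps mult_1_right)
    qed simp
  qed
  also have "\<dots> = emeasure (\<kappa> (t + s) x) (cball 0 b)"
    using assms by (intro chapman_kolmogorov[symmetric]) auto
  finally have "ennreal (1 / 2) * emeasure (\<kappa> s x) ?A \<le> emeasure (\<kappa> (t + s) x) (cball 0 b)" .
  moreover have "ennreal (1 / 2) * emeasure (\<kappa> s x) (cball 0 a) \<le> ennreal (1 / 2) * emeasure (\<kappa> s x) ?A"
    using le by (intro mult_left_mono) auto
  ultimately have "ennreal (1 / 2) * emeasure (\<kappa> s x) (cball 0 a) \<le> emeasure (\<kappa> (t + s) x) (cball 0 b)"
    by (rule order_trans[rotated])
  moreover have "ennreal (1 / 2 * measure (\<kappa> s x) (cball 0 a)) = ennreal (1 / 2) * emeasure (\<kappa> s x) (cball 0 a)"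
    unfolding M.emeasure_eq_measure by (rule ennreal_mult'') simp
  ultimately have "ennreal (1 / 2 * measure (\<kappa> s x) (cball 0 a)) \<le> ennreal (measure (\<kappa> (t + s) x) (cball 0 b))"
    by (simp only: N.emeasure_eq_measure)
  then have "1 / 2 * measure (\<kappa> s x) (cball 0 a) \<le> measure (\<kappa> (t + s) x) (cball 0 b)"
    by (rule ennreal_le_iff[THEN iffD1, rotated]) simp
  then show ?thesis by simp
qed

text \<open>The bound at a fixed time becomes uniform in time because mass in a ball persists, up to a factor, until
the next point of a finite grid of times.\<close>

lemma vanishing_at_infinity_uniform:
  "\<exists>\<delta>>0. \<forall>a e. e > 0 \<longrightarrow> (\<exists>M. \<forall>s\<in>{0..\<delta>}. \<forall>x\<in>D. norm x \<ge> M \<longrightarrow> measure (\<kappa> s x) (cball 0 a) < e)"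
proof -
  obtain \<delta>' where \<delta>': "\<delta>' > 0" and near: "\<And>s v. s \<in> {0..\<delta>'} \<Longrightarrow> v \<in> cball 0 1 \<Longrightarrow> \<Phi> s v \<noteq> 0 \<and> norm (\<psi>I s v - \<psi>I 0 0 - v) < 1 / 4"
    using psi_near_zero[of 1 "1 / 4"] by auto
  have "\<exists>M. \<forall>s\<in>{0..\<delta>' / 2}. \<forall>x\<in>D. norm x \<ge> M \<longrightarrow> measure (\<kappa> s x) (cball 0 a) < e" if "e > 0" for a e
  proof -
    obtain \<delta>0 where \<delta>0: "\<delta>0 > 0" "\<And>t \<xi>. t \<in> {0..\<delta>0} \<Longrightarrow> \<xi> \<in> D \<inter> cball 0 a \<Longrightarrow> measure (\<kappa> t \<xi>) (ball \<xi> (1 / 2)) \<ge> 1 - 1 / 2"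
      using locally_uniformly_stochastically_continuous[of "1 / 2" a] by auto
    have stay: "measure (\<kappa> t \<xi>) (cball 0 (a + 1)) \<ge> 1 / 2" if t: "t \<in> {0..\<delta>0}" and \<xi>: "\<xi> \<in> D \<inter> cball 0 a" for t \<xi>
    proof -
      interpret finite_measure "\<kappa> t \<xi>" using t \<xi> by (intro finite_kappa) auto
      have "ball \<xi> (1 / 2) \<subseteq> cball 0 (a + 1)"
      proof
        fix y assume "y \<in> ball \<xi> (1 / 2)"
        then have "norm (y - \<xi>) < 1 / 2" by (simp add: dist_norm norm_minus_commute)
        then show "y \<in> cball 0 (a + 1)" using \<xi> norm_triangle_sub[of y \<xi>] by simp
      qed
      then have "measure (\<kappa> t \<xi>) (ball \<xi> (1 / 2)) \<le> measure (\<kappa> t \<xi>) (cball 0 (a + 1))"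
        using t \<xi> by (intro finite_measure_mono) (auto simp: sets_kappa)
      then show ?thesis using \<delta>0(2)[OF t \<xi>] by simp
    qed
    define h where "h = min \<delta>0 (\<delta>' / 2)"
    have h: "h > 0" "h \<le> \<delta>0" "h \<le> \<delta>' / 2" using \<delta>0 \<delta>' by (auto simp: h_def)
    have "\<exists>M. \<forall>x\<in>D. norm x \<ge> M \<longrightarrow> measure (\<kappa> (real j * h) x) (cball 0 (a + 1)) < e / 2" if "real j * h \<le> \<delta>'" for j :: nat
      using near h that \<open>e > 0\<close> by (intro vanishing_at_infinity[of _ \<delta>']) (auto intro: less_imp_le)
    then obtain m where m: "\<And>j x. real j * h \<le> \<delta>' \<Longrightarrow> x \<in> D \<Longrightarrow> norm x \<ge> m j \<Longrightarrow> measure (\<kappa> (real j * h) x) (cball 0 (a + 1)) < e / 2"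
      by metis
    define J where "J = nat \<lceil>\<delta>' / h\<rceil>"
    show ?thesis
    proof (intro exI[of _ "Max (m ` {..J})"] ballI impI)
      fix s x assume s: "s \<in> {0..\<delta>' / 2}" and x: "x \<in> D" and big: "norm x \<ge> Max (m ` {..J})"
      \<comment> \<open>The first point \<open>j * h\<close> of the grid after \<open>s\<close>.\<close>
      define j where "j = nat \<lceil>s / h\<rceil>"
      have "s / h \<ge> 0" using s h by simp
      then have "real j = of_int \<lceil>s / h\<rceil>" unfolding j_def by simp
      then have "s / h \<le> real j" "real j < s / h + 1" by linarith+
      then have j: "s \<le> real j * h" "real j * h < s + h" using h by (simp_all add: field_simps)
      then have j': "real j * h \<le> \<delta>'" using h s by auto
      then have "real j \<le> \<delta>' / h" using h by (simp add: field_simps)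
      then have "j \<in> {..J}" unfolding J_def by simp linarith
      then have "norm x \<ge> m j" using big by (meson Max_ge finite_atMost finite_imageI imageI order_trans)
      then have "measure (\<kappa> (real j * h) x) (cball 0 (a + 1)) < e / 2" using j' x by (intro m)
      moreover have "measure (\<kappa> s x) (cball 0 a) \<le> 2 * measure (\<kappa> ((real j * h - s) + s) x) (cball 0 (a + 1))"
        using s j h x by (intro measure_cball_propagates stay) auto
      ultimately show "measure (\<kappa> s x) (cball 0 a) < e" by simp
    qed
  qed
  then show ?thesis using \<delta>' by (intro exI[of _ "\<delta>' / 2"]) auto
qed

lemma feller_vanishing:
  "\<exists>\<delta>>0. \<forall>h B. continuous_on UNIV h \<longrightarrow> (\<forall>x. \<bar>h x\<bar> \<le> B) \<longrightarrow> (h \<longlongrightarrow> (0::real)) at_infinity \<longrightarrow>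
     (\<forall>e>0. \<exists>M. \<forall>s\<in>{0..\<delta>}. \<forall>x\<in>D. norm x \<ge> M \<longrightarrow> \<bar>LINT \<xi>|\<kappa> s x. h \<xi>\<bar> \<le> e)"
proof -
  obtain \<delta> where \<delta>: "\<delta> > 0" and van: "\<And>a e. e > 0 \<Longrightarrow> \<exists>M. \<forall>s\<in>{0..\<delta>}. \<forall>x\<in>D. norm x \<ge> M \<longrightarrow> measure (\<kappa> s x) (cball 0 a) < e"
    using vanishing_at_infinity_uniform by blast
  show ?thesis
  proof (rule exI[of _ \<delta>], intro conjI allI impI \<delta>)
    fix h :: "'v \<Rightarrow> real" and B e :: real
    assume h: "continuous_on UNIV h" "\<forall>x. \<bar>h x\<bar> \<le> B" "(h \<longlongrightarrow> 0) at_infinity" and e: "e > 0"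
    have B: "B \<ge> 0" using h(2) by (meson abs_ge_zero order_trans)
    obtain R where R: "\<And>x. norm x \<ge> R \<Longrightarrow> \<bar>h x\<bar> < e / 2"
      using tendstoD[OF h(3), of "e / 2"] e by (auto simp: eventually_at_infinity)
    define e' where "e' = e / (2 * (B + 1))"
    have e': "e' > 0" "B * e' \<le> e / 2" using e B by (auto simp: e'_def field_simps)
    obtain M where M: "\<And>s x. s \<in> {0..\<delta>} \<Longrightarrow> x \<in> D \<Longrightarrow> norm x \<ge> M \<Longrightarrow> measure (\<kappa> s x) (cball 0 R) < e'"
      using van[OF e'(1)] by blast
    show "\<exists>M. \<forall>s\<in>{0..\<delta>}. \<forall>x\<in>D. norm x \<ge> M \<longrightarrow> \<bar>LINT \<xi>|\<kappa> s x. h \<xi>\<bar> \<le> e"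
    proof (intro exI[of _ M] ballI impI)
      fix s x assume s: "s \<in> {0..\<delta>}" and x: "x \<in> D" and big: "norm x \<ge> M"
      then have sx: "s \<ge> 0" "x \<in> D" by auto
      have hm: "h \<in> borel_measurable borel" using h(1) by (rule borel_measurable_continuous_onI)
      have "\<bar>LINT \<xi>|\<kappa> s x. h \<xi>\<bar> \<le> (LINT \<xi>|\<kappa> s x. \<bar>h \<xi>\<bar>)" by (rule integral_abs_bound)
      also have "\<dots> \<le> (LINT \<xi>|\<kappa> s x. e / 2 + B * indicator (cball 0 R) \<xi>)"
      proof (rule integral_mono)
        show "integrable (\<kappa> s x) (\<lambda>\<xi>. \<bar>h \<xi>\<bar>)" using sx h hm by (intro integrable_kappa[where C=B]) auto
        show "integrable (\<kappa> s x) (\<lambda>\<xi>. e / 2 + B * indicator (cball 0 R) \<xi>)"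
          using sx e B by (intro integrable_kappa[where C="e / 2 + B"]) (auto simp: indicator_def)
        show "\<bar>h \<xi>\<bar> \<le> e / 2 + B * indicator (cball 0 R) \<xi>" for \<xi>
          using h(2) R[of \<xi>] e by (cases "norm \<xi> \<le> R") (auto simp: indicator_def intro: add_increasing less_imp_le)
      qed
      also have "\<dots> = e / 2 * mass s x + B * measure (\<kappa> s x) (cball 0 R)"
      proof -
        have "integrable (\<kappa> s x) (\<lambda>_. e / 2)" using sx by (intro integrable_kappa[where C="\<bar>e / 2\<bar>"]) auto
        moreover have "integrable (\<kappa> s x) (\<lambda>\<xi>. B * indicator (cball 0 R) \<xi>)"
          using sx B by (intro integrable_kappa[where C=B]) (auto simp: indicator_def)
        ultimately have "(LINT \<xi>|\<kappa> s x. e / 2 + B * indicator (cball 0 R) \<xi>) = (LINT \<xi>|\<kappa> s x. e / 2) + (LINT \<xi>|\<kappa> s x. B * indicator (cball 0 R) \<xi>)"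
          by (rule Bochner_Integration.integral_add)
        then show ?thesis
          unfolding integral_const_kappa[OF sx] integral_mult_right_zero using sx by (simp add: space_kappa)
      qed
      also have "\<dots> \<le> e / 2 * 1 + B * e'"
        using mass_le_1[OF sx] M[OF s x big] e B by (intro add_mono mult_left_mono) auto
      also have "\<dots> \<le> e" using e' by simp
      finally show "\<bar>LINT \<xi>|\<kappa> s x. h \<xi>\<bar> \<le> e" .
    qed
  qed
qed

text \<open>Far out both \<open>h\<close> and its image under the kernel are small; on a bounded set the kernel is concentrated
near its starting point, where \<open>h\<close> varies little.\<close>

lemma feller_strongly_continuous:
  assumes h: "continuous_on UNIV h" "\<And>x. \<bar>h x\<bar> \<le> B" "(h \<longlongrightarrow> (0::real)) at_infinity" and e: "e > 0"
  shows "\<exists>\<delta>>0. \<forall>s\<in>{0..\<delta>}. \<forall>x\<in>D. \<bar>(LINT \<xi>|\<kappa> s x. h \<xi>) - h x\<bar> \<le> e"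
proof -
  have B: "B \<ge> 0" using h(2) by (meson abs_ge_zero order_trans)
  obtain \<delta>1 M1 where \<delta>1: "\<delta>1 > 0" and M1: "\<And>s x. s \<in> {0..\<delta>1} \<Longrightarrow> x \<in> D \<Longrightarrow> norm x \<ge> M1 \<Longrightarrow> \<bar>LINT \<xi>|\<kappa> s x. h \<xi>\<bar> \<le> e / 2"
    using feller_vanishing h e half_gt_zero by metis
  obtain R where R: "\<And>x. norm x \<ge> R \<Longrightarrow> \<bar>h x\<bar> < e / 2"
    using tendstoD[OF h(3), of "e / 2"] e by (auto simp: eventually_at_infinity)
  define M where "M = max M1 R"
  have "uniformly_continuous_on (cball 0 (M + 1)) h"
    using h(1) by (intro compact_uniformly_continuous continuous_on_subset[OF h(1)]) auto
  then obtain d where d: "d > 0" "\<And>x y. x \<in> cball 0 (M + 1) \<Longrightarrow> y \<in> cball 0 (M + 1) \<Longrightarrow> dist y x < d \<Longrightarrow> dist (h y) (h x) < e / 2"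
    using e unfolding uniformly_continuous_on_def by (metis half_gt_zero)
  define \<epsilon> where "\<epsilon> = min (min d 1) (e / (6 * (B + 1)))"
  have \<epsilon>: "\<epsilon> > 0" "\<epsilon> \<le> d" "\<epsilon> \<le> 1" "3 * B * \<epsilon> \<le> e / 2"
  proof -
    show "\<epsilon> > 0" "\<epsilon> \<le> d" "\<epsilon> \<le> 1" using d e B by (auto simp: \<epsilon>_def)
    have "3 * B * \<epsilon> \<le> 3 * B * (e / (6 * (B + 1)))" using B by (intro mult_left_mono) (auto simp: \<epsilon>_def)
    also have "\<dots> \<le> e / 2" using B e by (simp add: field_simps)
    finally show "3 * B * \<epsilon> \<le> e / 2" .
  qed
  obtain \<delta>2 where \<delta>2: "\<delta>2 > 0" "\<And>s x. s \<in> {0..\<delta>2} \<Longrightarrow> x \<in> D \<inter> cball 0 M \<Longrightarrow> measure (\<kappa> s x) (ball x \<epsilon>) \<ge> 1 - \<epsilon>"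
    using locally_uniformly_stochastically_continuous[OF \<epsilon>(1), of M] by blast
  show ?thesis
  proof (intro exI[of _ "min \<delta>1 \<delta>2"] conjI ballI)
    fix s x assume s: "s \<in> {0..min \<delta>1 \<delta>2}" and x: "x \<in> D"
    then have sx: "s \<ge> 0" "x \<in> D" by auto
    show "\<bar>(LINT \<xi>|\<kappa> s x. h \<xi>) - h x\<bar> \<le> e"
    proof (cases "norm x \<ge> M")
      case True
      then have "\<bar>LINT \<xi>|\<kappa> s x. h \<xi>\<bar> \<le> e / 2" "\<bar>h x\<bar> < e / 2" using s x M1 R by (auto simp: M_def)
      then show ?thesis by linarith
    next
      case False
      then have xM: "x \<in> D \<inter> cball 0 M" using x by auto
      define m where "m = measure (\<kappa> s x) (ball x \<epsilon>)"
      have m: "m \<ge> 1 - \<epsilon>" "m \<le> mass s x" using \<delta>2(2)[of s x] s xM measure_le_mass[OF sx] by (auto simp: m_def)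
      have hm: "h \<in> borel_measurable borel" using h(1) by (rule borel_measurable_continuous_onI)
      have int_h: "integrable (\<kappa> s x) h" using sx h hm by (intro integrable_kappa[where C=B]) auto
      have int_c: "integrable (\<kappa> s x) (\<lambda>_. c)" for c :: real using sx by (intro integrable_kappa[where C="\<bar>c\<bar>"]) auto
      have int_i: "integrable (\<kappa> s x) (\<lambda>\<xi>. 2 * B * indicator (ball x \<epsilon>) \<xi>)"
        using sx B by (intro integrable_kappa[where C="2 * B"]) (auto simp: indicator_def)
      have "(LINT \<xi>|\<kappa> s x. h \<xi>) - h x = (LINT \<xi>|\<kappa> s x. h \<xi> - h x) - h x * (1 - mass s x)"
        using Bochner_Integration.integral_diff[OF int_h int_c[of "h x"]] space_kappa[OF sx]
        by (simp add: mass_def algebra_simps)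
      also have "\<bar>\<dots>\<bar> \<le> \<bar>LINT \<xi>|\<kappa> s x. h \<xi> - h x\<bar> + \<bar>h x * (1 - mass s x)\<bar>" by (rule abs_triangle_ineq4)
      also have "\<bar>h x * (1 - mass s x)\<bar> \<le> B * \<epsilon>"
        unfolding abs_mult using h(2) B m mass_le_1[OF sx] by (intro mult_mono) auto
      also have "\<bar>LINT \<xi>|\<kappa> s x. h \<xi> - h x\<bar> \<le> (LINT \<xi>|\<kappa> s x. \<bar>h \<xi> - h x\<bar>)" by (rule integral_abs_bound)
      also have "\<dots> \<le> (LINT \<xi>|\<kappa> s x. (e / 2 + 2 * B) - 2 * B * indicator (ball x \<epsilon>) \<xi>)"
      proof (rule integral_mono)
        show "integrable (\<kappa> s x) (\<lambda>\<xi>. \<bar>h \<xi> - h x\<bar>)" by (intro integrable_abs Bochner_Integration.integrable_diff int_h int_c)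
        show "integrable (\<kappa> s x) (\<lambda>\<xi>. (e / 2 + 2 * B) - 2 * B * indicator (ball x \<epsilon>) \<xi>)"
          by (intro Bochner_Integration.integrable_diff int_i int_c)
        fix \<xi>
        show "\<bar>h \<xi> - h x\<bar> \<le> (e / 2 + 2 * B) - 2 * B * indicator (ball x \<epsilon>) \<xi>"
        proof (cases "\<xi> \<in> ball x \<epsilon>")
          case True
          then have "norm (\<xi> - x) < \<epsilon>" by (simp add: dist_norm norm_minus_commute)
          then have "dist (h \<xi>) (h x) < e / 2"
            using xM \<epsilon> norm_triangle_sub[of \<xi> x] by (intro d) (auto simp: dist_norm)
          then show ?thesis using True by (simp add: dist_real_def)
        next
          case False
          have "\<bar>h \<xi> - h x\<bar> \<le> 2 * B" using h(2)[of \<xi>] h(2)[of x] by linarith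
          then show ?thesis using False e by simp
        qed
      qed
      also have "\<dots> = (e / 2 + 2 * B) * mass s x - 2 * B * m"
        using sx by (subst Bochner_Integration.integral_diff[OF int_c int_i]) (simp add: m_def sets_kappa mass_def space_kappa)
      also have "\<dots> \<le> (e / 2 + 2 * B) * 1 - 2 * B * (1 - \<epsilon>)"
        using m mass_le_1[OF sx] e B by (intro diff_mono mult_left_mono) auto
      finally show ?thesis using \<epsilon> by (simp add: algebra_simps)
    qed
  qed (use \<delta>1 \<delta>2 in auto)
qed

end

section \<open>Oscillations of bounded martingales\<close>

text \<open>The reference value follows the sequence lazily: it is reset to the current value whenever the distance
reaches \<open>\<epsilon>\<close>. Counting the resets measures oscillations without stopping times.\<close>

primrec greedy_ref :: "real \<Rightarrow> (nat \<Rightarrow> real) \<Rightarrow> nat \<Rightarrow> real" where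
  "greedy_ref \<epsilon> a 0 = a 0"
| "greedy_ref \<epsilon> a (Suc n) = (if \<bar>a (Suc n) - greedy_ref \<epsilon> a n\<bar> \<ge> \<epsilon> then a (Suc n) else greedy_ref \<epsilon> a n)"

primrec greedy_count :: "real \<Rightarrow> (nat \<Rightarrow> real) \<Rightarrow> nat \<Rightarrow> nat" where
  "greedy_count \<epsilon> a 0 = 0"
| "greedy_count \<epsilon> a (Suc n) = greedy_count \<epsilon> a n + (if \<bar>a (Suc n) - greedy_ref \<epsilon> a n\<bar> \<ge> \<epsilon> then 1 else 0)"

text \<open>At least \<open>m\<close> successive disjoint oscillations of size \<open>\<epsilon>\<close> at times in \<open>S\<close>, none of them beginning before \<open>a\<close>.\<close>

primrec oscillates :: "(real \<Rightarrow> real) \<Rightarrow> real \<Rightarrow> real set \<Rightarrow> nat \<Rightarrow> real \<Rightarrow> bool" where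
  "oscillates f \<epsilon> S 0 a = True"
| "oscillates f \<epsilon> S (Suc m) a = (\<exists>u\<in>S. \<exists>v\<in>S. a \<le> u \<and> u < v \<and> \<epsilon> \<le> \<bar>f u - f v\<bar> \<and> oscillates f \<epsilon> S m v)"

lemma oscillates_mono_eps: "oscillates f \<epsilon> S m a \<Longrightarrow> \<epsilon>' \<le> \<epsilon> \<Longrightarrow> oscillates f \<epsilon>' S m a"
proof (induction m arbitrary: a)
  case (Suc m)
  then obtain u v where "u \<in> S" "v \<in> S" "a \<le> u" "u < v" "\<epsilon> \<le> \<bar>f u - f v\<bar>" "oscillates f \<epsilon> S m v"
    by auto
  moreover from this have "\<epsilon>' \<le> \<bar>f u - f v\<bar>" "oscillates f \<epsilon>' S m v" using Suc by auto
  ultimately show ?case by auto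
qed simp

lemma oscillates_eventually:
  assumes "oscillates f \<epsilon> S m a" and ev: "\<And>q. q \<in> S \<Longrightarrow> \<forall>\<^sub>F n in sequentially. q \<in> G n"
  shows "\<forall>\<^sub>F n in sequentially. oscillates f \<epsilon> (G n) m a"
  using assms(1)
proof (induction m arbitrary: a)
  case (Suc m)
  then obtain u v where uv: "u \<in> S" "v \<in> S" "a \<le> u" "u < v" "\<epsilon> \<le> \<bar>f u - f v\<bar>" "oscillates f \<epsilon> S m v"
    by auto
  from ev[OF uv(1)] ev[OF uv(2)] Suc.IH[OF uv(6)] show ?case
    by eventually_elim (use uv in auto)
qed simp

lemma greedy_ref_close: "\<epsilon> > 0 \<Longrightarrow> \<bar>a n - greedy_ref \<epsilon> a n\<bar> < \<epsilon>"
  by (cases n) auto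

lemma greedy_count_mono: "i \<le> j \<Longrightarrow> greedy_count \<epsilon> a i \<le> greedy_count \<epsilon> a j"
  by (rule lift_Suc_mono_le[of "greedy_count \<epsilon> a"]) simp

lemma greedy_ref_constant: "i \<le> j \<Longrightarrow> greedy_count \<epsilon> a j = greedy_count \<epsilon> a i \<Longrightarrow> greedy_ref \<epsilon> a j = greedy_ref \<epsilon> a i"
proof (induction j rule: dec_induct)
  case (step j)
  then have "greedy_count \<epsilon> a i \<le> greedy_count \<epsilon> a j" by (intro greedy_count_mono) auto
  with step.prems have "greedy_count \<epsilon> a j = greedy_count \<epsilon> a i" "\<not> \<bar>a (Suc j) - greedy_ref \<epsilon> a j\<bar> \<ge> \<epsilon>"
    by (auto split: if_splits)
  then show ?case using step.IH by simp
qed simp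

text \<open>As long as the reference value is not reset, all values are within \<open>\<epsilon>\<close> of it; so an oscillation of size
\<open>2 * \<epsilon>\<close> forces a reset.\<close>

lemma oscillates_greedy_count:
  assumes "\<epsilon> > 0" and mono: "\<And>i j. i < j \<Longrightarrow> j \<le> n \<Longrightarrow> time i < time j"
  shows "oscillates f (2 * \<epsilon>) (time ` {..n}) m (time j) \<Longrightarrow> j \<le> n \<Longrightarrow>
     m + greedy_count \<epsilon> (\<lambda>i. f (time i)) j \<le> greedy_count \<epsilon> (\<lambda>i. f (time i)) n"
proof (induction m arbitrary: j)
  case 0
  then show ?case by (simp add: greedy_count_mono)
next
  case (Suc m)
  let ?a = "\<lambda>i. f (time i)"
  have "\<exists>u\<in>time ` {..n}. \<exists>v\<in>time ` {..n}. time j \<le> u \<and> u < v \<and> 2 * \<epsilon> \<le> \<bar>f u - f v\<bar> \<and> oscillates f (2 * \<epsilon>) (time ` {..n}) m v"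
    using Suc.prems(1) by (simp only: oscillates.simps)
  then obtain u v where uv: "u \<in> time ` {..n}" "v \<in> time ` {..n}" "time j \<le> u" "u < v" "2 * \<epsilon> \<le> \<bar>f u - f v\<bar>"
    "oscillates f (2 * \<epsilon>) (time ` {..n}) m v"
    by blast
  from uv(1) obtain k where k: "u = time k" "k \<le> n" by blast
  from uv(2) obtain l where l: "v = time l" "l \<le> n" by blast
  note kl = k(2) l(2) uv(3-6)[unfolded k(1) l(1)]
  have jk: "j \<le> k"
  proof (rule ccontr)
    assume "\<not> j \<le> k"
    then have "time k < time j" using Suc.prems(2) by (intro mono[of k j]) simp_all
    with kl(3) show False by simp
  qed
  have "k < l"
  proof (rule ccontr)
    assume "\<not> k < l"
    then have "k = l \<or> time l < time k" using kl(1) mono[of l k] by linarith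
    with kl(4) show False by auto
  qed
  have "greedy_count \<epsilon> ?a k \<noteq> greedy_count \<epsilon> ?a l"
  proof
    assume "greedy_count \<epsilon> ?a k = greedy_count \<epsilon> ?a l"
    then have "greedy_ref \<epsilon> ?a l = greedy_ref \<epsilon> ?a k"
      by (rule greedy_ref_constant[OF less_imp_le[OF \<open>k < l\<close>] sym])
    moreover have "\<bar>f (time k) - greedy_ref \<epsilon> ?a k\<bar> < \<epsilon>" "\<bar>f (time l) - greedy_ref \<epsilon> ?a l\<bar> < \<epsilon>"
      by (rule greedy_ref_close[OF assms(1), of ?a k]) (rule greedy_ref_close[OF assms(1), of ?a l])
    ultimately show False using kl(5) by linarith
  qed
  moreover have "greedy_count \<epsilon> ?a k \<le> greedy_count \<epsilon> ?a l" by (rule greedy_count_mono[OF less_imp_le[OF \<open>k < l\<close>]])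
  moreover have "greedy_count \<epsilon> ?a j \<le> greedy_count \<epsilon> ?a k" using jk by (rule greedy_count_mono)
  moreover have "m + greedy_count \<epsilon> ?a l \<le> greedy_count \<epsilon> ?a n" by (rule Suc.IH[OF kl(6) kl(2)])
  ultimately show ?case by linarith
qed

lemma greedy_reset_inequality:
  fixes x r c \<epsilon> :: real
  assumes "\<epsilon> > 0" "\<epsilon> \<le> \<bar>x - r\<bar>"
  shows "\<epsilon>\<^sup>2 * (c + 1) + x\<^sup>2 - 2 * (x * x) \<le> \<epsilon>\<^sup>2 * c + r\<^sup>2 - 2 * (x * r)"
proof -
  have "\<epsilon>\<^sup>2 \<le> (x - r)\<^sup>2"
    using assms by (metis abs_le_square_iff abs_of_pos)
  also have "(x - r)\<^sup>2 = x * x + r\<^sup>2 - 2 * (x * r)"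
    by (simp add: power2_eq_square algebra_simps)
  finally show ?thesis by (simp add: power2_eq_square algebra_simps)
qed

text \<open>A bounded discrete martingale closed by \<open>Y\<close>. Conditional expectations enter only through their pairing
with bounded measurable \<open>Z\<close>.\<close>

locale closed_bounded_martingale = prob_space M for M :: "'a measure" +
  fixes Fil :: "nat \<Rightarrow> 'a measure" and N :: "nat \<Rightarrow> 'a \<Rightarrow> real" and Y :: "'a \<Rightarrow> real" and C :: real
  assumes subalg: "\<And>i. subalgebra M (Fil i)"
    and mono_Fil: "\<And>i j. i \<le> j \<Longrightarrow> sets (Fil i) \<subseteq> sets (Fil j)"
    and N_meas: "\<And>i. N i \<in> borel_measurable (Fil i)"
    and N_bound: "\<And>i \<omega>. \<bar>N i \<omega>\<bar> \<le> C"
    and Y_meas: "Y \<in> borel_measurable M"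
    and Y_bound: "\<And>\<omega>. \<bar>Y \<omega>\<bar> \<le> C"
    and projection: "\<And>i Z K. Z \<in> borel_measurable (Fil i) \<Longrightarrow> (\<And>\<omega>. \<bar>Z \<omega>\<bar> \<le> K) \<Longrightarrow>
          (LINT \<omega>|M. Y \<omega> * Z \<omega>) = (LINT \<omega>|M. N i \<omega> * Z \<omega>)"
begin

lemma Fil_mono_meas: "i \<le> j \<Longrightarrow> f \<in> borel_measurable (Fil i) \<Longrightarrow> f \<in> borel_measurable (Fil j)"
proof -
  assume "i \<le> j" "f \<in> borel_measurable (Fil i)"
  moreover have "subalgebra (Fil j) (Fil i)"
    using mono_Fil[OF \<open>i \<le> j\<close>] subalg[of i] subalg[of j] by (simp add: subalgebra_def)
  ultimately show ?thesis by (simp add: measurable_from_subalg)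
qed

lemma Fil_meas: "f \<in> borel_measurable (Fil i) \<Longrightarrow> f \<in> borel_measurable M"
  using subalg by (rule measurable_from_subalg)

lemma martingale_step:
  assumes "Z \<in> borel_measurable (Fil i)" "\<And>\<omega>. \<bar>Z \<omega>\<bar> \<le> K"
  shows "(LINT \<omega>|M. N (Suc i) \<omega> * Z \<omega>) = (LINT \<omega>|M. N i \<omega> * Z \<omega>)"
proof -
  have "Z \<in> borel_measurable (Fil (Suc i))"
    by (rule Fil_mono_meas[OF _ assms(1)]) simp
  from projection[OF this assms(2)] projection[OF assms] show ?thesis
    by (rule trans[OF sym])
qed

lemma C_nonneg: "C \<ge> 0"
  using N_bound[of 0 undefined] by linarith

lemma greedy_measurable:
  shows "(\<lambda>\<omega>. greedy_ref \<epsilon> (\<lambda>i. N i \<omega>) n) \<in> borel_measurable (Fil n)"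
    and "(\<lambda>\<omega>. real (greedy_count \<epsilon> (\<lambda>i. N i \<omega>) n)) \<in> borel_measurable (Fil n)"
proof (induction n)
  case 0
  { case 1 show ?case using N_meas[of 0] by simp }
  { case 2 show ?case by simp }
next
  case (Suc n)
  note [measurable] = N_meas[of "Suc n"] Fil_mono_meas[OF _ Suc(1), of "Suc n", simplified] Fil_mono_meas[OF _ Suc(2), of "Suc n", simplified]
  { case 1 show ?case by simp }
  { case 2
    have "(\<lambda>\<omega>. real (greedy_count \<epsilon> (\<lambda>i. N i \<omega>) n) + (if \<bar>N (Suc n) \<omega> - greedy_ref \<epsilon> (\<lambda>i. N i \<omega>) n\<bar> \<ge> \<epsilon> then 1 else 0)) \<in> borel_measurable (Fil (Suc n))"
      by measurable
    then show ?case by (simp add: of_nat_add if_distrib cong: if_cong) }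
qed

lemma greedy_ref_bound: "\<bar>greedy_ref \<epsilon> (\<lambda>i. N i \<omega>) n\<bar> \<le> C"
proof (induction n)
  case (Suc n)
  then show ?case using N_bound[of "Suc n" \<omega>] by simp
qed (use N_bound[of 0 \<omega>] in simp)

lemma greedy_count_le: "greedy_count \<epsilon> a n \<le> n"
  by (induction n) auto

text \<open>With \<open>c\<close> the number of resets and \<open>r\<close> the reference value, \<open>\<epsilon>\<^sup>2 * c + r\<^sup>2 - 2 * N * r\<close> is a supermartingale: a reset
increases the first term by \<open>\<epsilon>\<^sup>2\<close>, and lowers the others by the square of a distance that is at least \<open>\<epsilon>\<close>.
Since the last two terms are at least \<open>- N\<^sup>2\<close>, the expected number of resets is bounded independently of
the number of times.\<close>

lemma greedy_count_expectation:
  assumes "\<epsilon> > 0"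
  shows "\<epsilon>\<^sup>2 * (LINT \<omega>|M. real (greedy_count \<epsilon> (\<lambda>i. N i \<omega>) n)) \<le> C\<^sup>2"
proof -
  let ?c = "\<lambda>n \<omega>. real (greedy_count \<epsilon> (\<lambda>i. N i \<omega>) n)"
  let ?r = "\<lambda>n \<omega>. greedy_ref \<epsilon> (\<lambda>i. N i \<omega>) n"
  let ?W = "\<lambda>n \<omega>. \<epsilon>\<^sup>2 * ?c n \<omega> + (?r n \<omega>)\<^sup>2 - 2 * (N n \<omega> * ?r n \<omega>)"
  have [measurable]: "?c n \<in> borel_measurable M" "?r n \<in> borel_measurable M" "N n \<in> borel_measurable M" for n
    by (rule Fil_meas[OF greedy_measurable(2)] Fil_meas[OF greedy_measurable(1)] Fil_meas[OF N_meas])+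
  have sq: "x\<^sup>2 \<le> C\<^sup>2" if "\<bar>x\<bar> \<le> C" for x
    using that by (metis abs_le_square_iff abs_of_nonneg C_nonneg)
  have int_c: "integrable M (?c n)" for n
    by (rule integrable_const_bound[where B="real n"]) (auto simp: greedy_count_le)
  have int_r: "integrable M (\<lambda>\<omega>. (?r n \<omega>)\<^sup>2)" for n
    by (rule integrable_const_bound[where B="C\<^sup>2"]) (auto simp: sq greedy_ref_bound)
  have int_Nr: "integrable M (\<lambda>\<omega>. N m \<omega> * ?r n \<omega>)" for m n
    by (rule integrable_const_bound[where B="C * C"]) (auto simp: abs_mult N_bound greedy_ref_bound intro!: mult_mono C_nonneg)
  have int_N: "integrable M (\<lambda>\<omega>. (N n \<omega>)\<^sup>2)" for n
    by (rule integrable_const_bound[where B="C\<^sup>2"]) (auto simp: sq N_bound)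
  have int_W: "integrable M (\<lambda>\<omega>. \<epsilon>\<^sup>2 * ?c n \<omega> + (?r n \<omega>)\<^sup>2 - 2 * (N m \<omega> * ?r n \<omega>))" for m n
    by (intro Bochner_Integration.integrable_add Bochner_Integration.integrable_diff integrable_mult_right int_c int_r int_Nr)
  have W: "(LINT \<omega>|M. ?W n \<omega>) \<le> 0" for n
  proof (induction n)
    case 0
    have "?W 0 \<omega> = - (N 0 \<omega>)\<^sup>2" for \<omega>
      by (simp add: power2_eq_square)
    then have "(LINT \<omega>|M. ?W 0 \<omega>) = - (LINT \<omega>|M. (N 0 \<omega>)\<^sup>2)" by simp
    then show ?case by simp
  next
    case (Suc n)
    have "(LINT \<omega>|M. ?W (Suc n) \<omega>) \<le> (LINT \<omega>|M. \<epsilon>\<^sup>2 * ?c n \<omega> + (?r n \<omega>)\<^sup>2 - 2 * (N (Suc n) \<omega> * ?r n \<omega>))"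
    proof (rule integral_mono[OF int_W int_W])
      fix \<omega>
      show "?W (Suc n) \<omega> \<le> \<epsilon>\<^sup>2 * ?c n \<omega> + (?r n \<omega>)\<^sup>2 - 2 * (N (Suc n) \<omega> * ?r n \<omega>)"
      proof (cases "\<bar>N (Suc n) \<omega> - ?r n \<omega>\<bar> \<ge> \<epsilon>")
        case True
        show ?thesis
          using greedy_reset_inequality[OF assms True, of "?c n \<omega>"] True
          by (simp only: greedy_ref.simps greedy_count.simps if_True of_nat_add of_nat_1)
      qed simp
    qed
    also have "\<dots> = (LINT \<omega>|M. ?W n \<omega>)"
      using martingale_step[OF greedy_measurable(1)[of \<epsilon> n] greedy_ref_bound]
      by (simp only: Bochner_Integration.integral_diff Bochner_Integration.integral_add
          Bochner_Integration.integrable_add integrable_mult_right int_c int_r int_Nr integral_mult_right_zero)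
    finally show ?case using Suc by simp
  qed
  have "\<epsilon>\<^sup>2 * (LINT \<omega>|M. ?c n \<omega>) = (LINT \<omega>|M. \<epsilon>\<^sup>2 * ?c n \<omega>)" by simp
  also have "\<dots> \<le> (LINT \<omega>|M. ?W n \<omega> + (N n \<omega>)\<^sup>2)"
  proof (rule integral_mono)
    show "integrable M (\<lambda>\<omega>. \<epsilon>\<^sup>2 * ?c n \<omega>)" using int_c by simp
    show "integrable M (\<lambda>\<omega>. ?W n \<omega> + (N n \<omega>)\<^sup>2)" using int_W int_N by (intro Bochner_Integration.integrable_add)
    fix \<omega>
    have "0 \<le> (?r n \<omega> - N n \<omega>)\<^sup>2" by simp
    then show "\<epsilon>\<^sup>2 * ?c n \<omega> \<le> ?W n \<omega> + (N n \<omega>)\<^sup>2" by (simp add: power2_eq_square algebra_simps)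
  qed
  also have "\<dots> = (LINT \<omega>|M. ?W n \<omega>) + (LINT \<omega>|M. (N n \<omega>)\<^sup>2)"
    using int_W int_N by (rule Bochner_Integration.integral_add)
  also have "\<dots> \<le> 0 + (LINT \<omega>|M. C\<^sup>2)"
    using W int_N by (intro add_mono integral_mono) (auto simp: sq N_bound)
  also have "\<dots> = C\<^sup>2" by (simp add: prob_space)
  finally show ?thesis .
qed

text \<open>Optional stopping at the first value below \<open>a\<close>, done step by step: the indicator that such a value has
occurred increases only at times when the martingale is below \<open>a\<close>.\<close>

lemma small_values_weight:
  assumes "a \<ge> 0" and N_nonneg: "\<And>i \<omega>. N i \<omega> \<ge> 0"
  shows "(LINT \<omega>|M. Y \<omega> * indicator {\<omega>. \<exists>i\<le>n. N i \<omega> < a} \<omega>) \<le> a"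
proof -
  define b :: "nat \<Rightarrow> 'a \<Rightarrow> real" where "b n = indicator {\<omega>. \<exists>i\<le>n. N i \<omega> < a}" for n
  have b_cases: "b n \<omega> = 0 \<or> b n \<omega> = 1" for n \<omega>
    by (cases "\<exists>i\<le>n. N i \<omega> < a") (simp_all add: b_def)
  have b_Suc: "b (Suc n) \<omega> = b n \<omega> \<or> (b n \<omega> = 0 \<and> b (Suc n) \<omega> = 1 \<and> N (Suc n) \<omega> < a)" for n \<omega>
  proof (cases "\<exists>i\<le>n. N i \<omega> < a")
    case True
    then obtain i where "i \<le> n" "N i \<omega> < a" by blast
    then have "\<exists>i\<le>Suc n. N i \<omega> < a" by (intro exI[of _ i]) simp
    with True show ?thesis by (simp add: b_def)
  next
    case False
    then have "(\<exists>i\<le>Suc n. N i \<omega> < a) \<longleftrightarrow> N (Suc n) \<omega> < a" by (auto simp: le_Suc_eq)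
    with False show ?thesis by (auto simp: b_def indicator_def)
  qed
  have b_meas: "b n \<in> borel_measurable (Fil n)" for n
  proof -
    have "{\<omega> \<in> space (Fil n). N i \<omega> < a} \<in> sets (Fil n)" if "i \<le> n" for i
      using Fil_mono_meas[OF that N_meas] by (simp only: borel_measurable_iff_less)
    then have "(\<Union>i\<in>{..n}. {\<omega> \<in> space (Fil n). N i \<omega> < a}) \<in> sets (Fil n)"
      by (intro sets.finite_UN) auto
    also have "(\<Union>i\<in>{..n}. {\<omega> \<in> space (Fil n). N i \<omega> < a}) = {\<omega>. \<exists>i\<le>n. N i \<omega> < a} \<inter> space (Fil n)"
      by auto
    finally show ?thesis unfolding b_def by (simp only: borel_measurable_indicator_iff)
  qed
  have b_bound: "\<bar>b n \<omega>\<bar> \<le> 1" for n \<omega> using b_cases[of n \<omega>] by auto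
  have bM: "b n \<in> borel_measurable M" for n by (rule Fil_meas[OF b_meas])
  have NM: "N n \<in> borel_measurable M" for n by (rule Fil_meas[OF N_meas])
  have int_b: "integrable M (b n)" for n
    by (rule integrable_const_bound[where B=1]) (use bM b_bound in auto)
  have int_Nb: "integrable M (\<lambda>\<omega>. N m \<omega> * b n \<omega>)" for m n
  proof (rule integrable_const_bound[where B="C * 1"])
    show "AE \<omega> in M. norm (N m \<omega> * b n \<omega>) \<le> C * 1"
      unfolding real_norm_def abs_mult by (intro AE_I2 mult_mono N_bound b_bound C_nonneg) auto
  qed (intro borel_measurable_times NM bM)
  have le: "(LINT \<omega>|M. N n \<omega> * b n \<omega>) \<le> a * (LINT \<omega>|M. b n \<omega>)" for n
  proof (induction n)
    case 0
    have "(LINT \<omega>|M. N 0 \<omega> * b 0 \<omega>) \<le> (LINT \<omega>|M. a * b 0 \<omega>)"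
      by (intro integral_mono integrable_mult_right int_Nb int_b) (auto simp: b_def indicator_def)
    then show ?case by simp
  next
    case (Suc n)
    have "(LINT \<omega>|M. N (Suc n) \<omega> * b (Suc n) \<omega>) \<le> (LINT \<omega>|M. N (Suc n) \<omega> * b n \<omega> + (a * b (Suc n) \<omega> - a * b n \<omega>))"
    proof (rule integral_mono)
      fix \<omega>
      show "N (Suc n) \<omega> * b (Suc n) \<omega> \<le> N (Suc n) \<omega> * b n \<omega> + (a * b (Suc n) \<omega> - a * b n \<omega>)"
        using b_Suc[of n \<omega>] by auto
    qed (intro int_Nb Bochner_Integration.integrable_add Bochner_Integration.integrable_diff integrable_mult_right int_b)+
    also have "\<dots> = (LINT \<omega>|M. N n \<omega> * b n \<omega>) + (a * (LINT \<omega>|M. b (Suc n) \<omega>) - a * (LINT \<omega>|M. b n \<omega>))"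
      using martingale_step[OF b_meas b_bound, of n]
      by (simp only: Bochner_Integration.integral_diff Bochner_Integration.integral_add
          Bochner_Integration.integrable_diff integrable_mult_right int_Nb int_b integral_mult_right_zero)
    finally show ?case using Suc by simp
  qed
  have "(LINT \<omega>|M. Y \<omega> * b n \<omega>) = (LINT \<omega>|M. N n \<omega> * b n \<omega>)"
    by (rule projection[OF b_meas b_bound])
  also have "\<dots> \<le> a * (LINT \<omega>|M. b n \<omega>)" by (rule le)
  also have "\<dots> \<le> a * (LINT \<omega>|M. 1)"
    using b_cases by (intro mult_left_mono integral_mono int_b assms(1)) (auto, metis order_refl zero_le_one)
  also have "\<dots> = a" by (simp add: prob_space)
  finally show ?thesis by (simp add: b_def)
qed

end

text \<open>The continuous-time counterpart, observed at rational times up to a rational time \<open>T\<close>.\<close>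

locale closed_martingale_process = prob_space M for M :: "'a measure" +
  fixes \<F> :: "real \<Rightarrow> 'a measure" and N :: "real \<Rightarrow> 'a \<Rightarrow> real" and Y :: "'a \<Rightarrow> real" and C T :: real
  assumes T: "T > 0" "T \<in> \<rat>"
    and subalg: "\<And>t. t \<ge> 0 \<Longrightarrow> subalgebra M (\<F> t)"
    and mono_F: "\<And>s t. 0 \<le> s \<Longrightarrow> s \<le> t \<Longrightarrow> sets (\<F> s) \<subseteq> sets (\<F> t)"
    and N_meas: "\<And>q. 0 \<le> q \<Longrightarrow> q \<le> T \<Longrightarrow> N q \<in> borel_measurable (\<F> q)"
    and N_bound: "\<And>q \<omega>. 0 \<le> q \<Longrightarrow> q \<le> T \<Longrightarrow> \<bar>N q \<omega>\<bar> \<le> C"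
    and Y_meas: "Y \<in> borel_measurable M"
    and Y_bound: "\<And>\<omega>. \<bar>Y \<omega>\<bar> \<le> C"
    and projection: "\<And>q Z K. 0 \<le> q \<Longrightarrow> q \<le> T \<Longrightarrow> Z \<in> borel_measurable (\<F> q) \<Longrightarrow> (\<And>\<omega>. \<bar>Z \<omega>\<bar> \<le> K) \<Longrightarrow>
          (LINT \<omega>|M. Y \<omega> * Z \<omega>) = (LINT \<omega>|M. N q \<omega> * Z \<omega>)"
begin

text \<open>The grid of mesh \<open>T / n!\<close>: any given rational time belongs to all of these grids but finitely many. The
index is capped, so that times never exceed \<open>T\<close>.\<close>

definition "time n i = T * (real (min i (fact n)) / fact n)" for n i :: nat

definition "rationals = {q \<in> \<rat>. 0 \<le> q \<and> q \<le> T}"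

lemma time_range: "0 \<le> time n i" "time n i \<le> T"
proof -
  have "real (min i (fact n)) / fact n \<le> 1"
  proof -
    have "real (min i (fact n)) \<le> real (fact n)" by (simp only: of_nat_le_iff min.cobounded2)
    then show ?thesis by simp
  qed
  then have "T * (real (min i (fact n)) / fact n) \<le> T * 1"
    using T by (intro mult_left_mono) auto
  then show "time n i \<le> T" by (simp add: time_def)
  show "0 \<le> time n i" using T by (simp add: time_def)
qed

lemma time_mono: "i \<le> j \<Longrightarrow> time n i \<le> time n j"
  using T unfolding time_def by (intro mult_left_mono divide_right_mono) auto

lemma time_strict: "i < j \<Longrightarrow> j \<le> fact n \<Longrightarrow> time n i < time n j"
  using T unfolding time_def by (intro mult_strict_left_mono divide_strict_right_mono) auto

lemma rationals_in_grid:
  assumes "q \<in> rationals"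
  shows "\<forall>\<^sub>F n in sequentially. q \<in> time n ` {..fact n}"
proof -
  have "q / T \<in> \<rat>" using assms T by (simp add: rationals_def Rats_divide)
  moreover have "0 \<le> q / T" "q / T \<le> 1" using assms T by (auto simp: rationals_def)
  ultimately obtain a b :: nat where ab: "b \<noteq> 0" "\<bar>q / T\<bar> = real a / real b"
    using Rats_abs_nat_div_natE by metis
  then have q: "q = T * (real a / real b)" using \<open>0 \<le> q / T\<close> T by (simp add: field_simps)
  have "real a / real b \<le> 1" using ab(2) \<open>0 \<le> q / T\<close> \<open>q / T \<le> 1\<close> by (simp only: abs_of_nonneg)
  then have "a \<le> b" using ab by (simp add: field_simps)
  have "q \<in> time n ` {..fact n}" if nb: "n \<ge> b" for n
  proof -
    obtain c :: nat where c: "fact n = b * c"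
    proof -
      have "b dvd fact n" using ab(1) nb by (intro dvd_fact) auto
      then show ?thesis using that by (auto simp: dvd_def)
    qed
    have c0: "c \<noteq> 0" using c by (metis fact_nonzero mult_0_right)
    have le: "a * c \<le> fact n" unfolding c using \<open>a \<le> b\<close> by simp
    have "real (fact n) = real b * real c" unfolding c by simp
    then have "real (a * c) / fact n = real a / real b"
      using ab c0 by simp
    then have "q = time n (a * c)"
      using le by (simp add: time_def q min_absorb1)
    then show ?thesis using le by auto
  qed
  then show ?thesis by (auto simp: eventually_sequentially)
qed

lemma grid_martingale: "closed_bounded_martingale M (\<lambda>i. \<F> (time n i)) (\<lambda>i. N (time n i)) Y C"
proof
  show "sets (\<F> (time n i)) \<subseteq> sets (\<F> (time n j))" if "i \<le> j" for i j
    using that by (intro mono_F time_range time_mono)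
  show "(LINT \<omega>|M. Y \<omega> * Z \<omega>) = (LINT \<omega>|M. N (time n i) \<omega> * Z \<omega>)"
    if "Z \<in> borel_measurable (\<F> (time n i))" "\<And>\<omega>. \<bar>Z \<omega>\<bar> \<le> K" for i Z K
    by (rule projection[OF time_range that])
qed (intro subalg N_meas N_bound time_range Y_meas Y_bound)+

text \<open>The numbers of resets on the grids have bounded expectations. By Fatou their lower limit is almost surely
finite, and it dominates the number of oscillations at rational times.\<close>

lemma finite_oscillation_eps:
  assumes "\<epsilon> > 0"
  shows "AE \<omega> in M. \<exists>m. \<not> oscillates (\<lambda>q. N q \<omega>) (2 * \<epsilon>) rationals m 0"
proof -
  let ?c = "\<lambda>n \<omega>. greedy_count \<epsilon> (\<lambda>i. N (time n i) \<omega>) (fact n)"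
  have c_meas: "(\<lambda>\<omega>. real (?c n \<omega>)) \<in> borel_measurable M" for n
  proof -
    interpret G: closed_bounded_martingale M "\<lambda>i. \<F> (time n i)" "\<lambda>i. N (time n i)" Y C by (rule grid_martingale)
    show ?thesis by (rule G.Fil_meas[OF G.greedy_measurable(2)])
  qed
  have c_int: "(\<integral>\<^sup>+\<omega>. ennreal (real (?c n \<omega>)) \<partial>M) \<le> ennreal (C\<^sup>2 / \<epsilon>\<^sup>2)" for n
  proof -
    interpret G: closed_bounded_martingale M "\<lambda>i. \<F> (time n i)" "\<lambda>i. N (time n i)" Y C by (rule grid_martingale)
    have "integrable M (\<lambda>\<omega>. real (?c n \<omega>))"
      by (rule integrable_const_bound[where B="real (fact n)"]) (use c_meas G.greedy_count_le in \<open>auto simp del: of_nat_fact\<close>)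
    then have "(\<integral>\<^sup>+\<omega>. ennreal (real (?c n \<omega>)) \<partial>M) = ennreal (LINT \<omega>|M. real (?c n \<omega>))"
      by (rule nn_integral_eq_integral) simp
    also have "\<dots> \<le> ennreal (C\<^sup>2 / \<epsilon>\<^sup>2)"
      using G.greedy_count_expectation[OF assms, of "fact n"] assms by (intro ennreal_leI) (simp add: field_simps)
    finally show ?thesis .
  qed
  have "(\<integral>\<^sup>+\<omega>. liminf (\<lambda>n. ennreal (real (?c n \<omega>))) \<partial>M) \<le> liminf (\<lambda>n. \<integral>\<^sup>+\<omega>. ennreal (real (?c n \<omega>)) \<partial>M)"
    using c_meas by (intro nn_integral_liminf) simp
  also have "\<dots> \<le> limsup (\<lambda>n. \<integral>\<^sup>+\<omega>. ennreal (real (?c n \<omega>)) \<partial>M)"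
    by (rule Liminf_le_Limsup) simp
  also have "\<dots> \<le> ennreal (C\<^sup>2 / \<epsilon>\<^sup>2)"
    using c_int by (intro Limsup_bounded) simp
  finally have "(\<integral>\<^sup>+\<omega>. liminf (\<lambda>n. ennreal (real (?c n \<omega>))) \<partial>M) \<noteq> \<infinity>"
    by (auto simp: top_unique)
  moreover have "(\<lambda>\<omega>. liminf (\<lambda>n. ennreal (real (?c n \<omega>)))) \<in> borel_measurable M"
    using c_meas by (intro borel_measurable_liminf) simp
  ultimately have "AE \<omega> in M. liminf (\<lambda>n. ennreal (real (?c n \<omega>))) \<noteq> \<infinity>"
    by (intro nn_integral_PInf_AE)
  then show ?thesis
  proof eventually_elim
    case (elim \<omega>)
    show ?case
    proof (rule ccontr)
      assume "\<not> ?thesis"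
      then have osc: "oscillates (\<lambda>q. N q \<omega>) (2 * \<epsilon>) rationals m 0" for m by blast
      have "ennreal (real m) \<le> liminf (\<lambda>n. ennreal (real (?c n \<omega>)))" for m
      proof (rule Liminf_bounded)
        have "\<forall>\<^sub>F n in sequentially. oscillates (\<lambda>q. N q \<omega>) (2 * \<epsilon>) (time n ` {..fact n}) m 0"
          by (rule oscillates_eventually[OF osc rationals_in_grid])
        then show "\<forall>\<^sub>F n in sequentially. ennreal (real m) \<le> ennreal (real (?c n \<omega>))"
        proof eventually_elim
          case (elim n)
          have "m + greedy_count \<epsilon> (\<lambda>i. N (time n i) \<omega>) 0 \<le> ?c n \<omega>"
          proof (rule oscillates_greedy_count[OF assms time_strict])
            show "oscillates (\<lambda>q. N q \<omega>) (2 * \<epsilon>) (time n ` {..fact n}) m (time n 0)"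
              using elim by (simp add: time_def)
          qed simp_all
          then show ?case by (intro ennreal_leI) simp
        qed
      qed
      then have large: "of_nat m \<le> liminf (\<lambda>n. ennreal (real (?c n \<omega>)))" for m
        by (simp only: ennreal_of_nat_eq_real_of_nat)
      have "liminf (\<lambda>n. ennreal (real (?c n \<omega>))) < top"
        using elim by (simp only: infinity_ennreal_def less_top)
      then obtain m where "liminf (\<lambda>n. ennreal (real (?c n \<omega>))) < of_nat m"
        using ennreal_Ex_less_of_nat by blast
      with large[of m] show False by (metis leD)
    qed
  qed
qed

lemma finite_oscillation:
  "AE \<omega> in M. \<forall>\<epsilon>>0. \<exists>m. \<not> oscillates (\<lambda>q. N q \<omega>) \<epsilon> rationals m 0"
proof -
  have "AE \<omega> in M. \<forall>k::nat. \<exists>m. \<not> oscillates (\<lambda>q. N q \<omega>) (2 * (1 / real (Suc k))) rationals m 0"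
    by (subst AE_all_countable, intro allI finite_oscillation_eps) simp
  then show ?thesis
  proof eventually_elim
    case (elim \<omega>)
    show ?case
    proof (intro allI impI)
      fix \<epsilon> :: real assume "\<epsilon> > 0"
      then obtain k :: nat where k: "1 / real (Suc k) < \<epsilon> / 2"
        using nat_approx_posE[of "\<epsilon> / 2"] by auto
      obtain m where "\<not> oscillates (\<lambda>q. N q \<omega>) (2 * (1 / real (Suc k))) rationals m 0" using elim by blast
      then have "\<not> oscillates (\<lambda>q. N q \<omega>) \<epsilon> rationals m 0"
        using oscillates_mono_eps k by fastforce
      then show "\<exists>m. \<not> oscillates (\<lambda>q. N q \<omega>) \<epsilon> rationals m 0" ..
    qed
  qed
qed

text \<open>A nonnegative martingale that comes close to 0 stays there: the terminal value has mean at most \<open>a\<close> on the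
event that a value below \<open>a\<close> occurs, and Fatou passes from the grids to all rational times.\<close>

lemma positive_terminal_value_bounded_below:
  assumes nonneg: "\<And>q \<omega>. 0 \<le> q \<Longrightarrow> q \<le> T \<Longrightarrow> N q \<omega> \<ge> 0" "\<And>\<omega>. Y \<omega> \<ge> 0"
  shows "AE \<omega> in M. Y \<omega> > 0 \<longrightarrow> (\<exists>c>0. \<forall>q\<in>rationals. N q \<omega> \<ge> c)"
proof -
  define low where "low a = (\<Union>q\<in>rationals. {\<omega> \<in> space M. N q \<omega> < a})" for a
  define Z where "Z = (\<Inter>k::nat. low (1 / real (Suc k)))"
  have NM: "N q \<in> borel_measurable M" if "0 \<le> q" "q \<le> T" for q
    by (rule measurable_from_subalg[OF subalg N_meas]) (use that in auto)
  have "countable rationals" unfolding rationals_def by (rule countable_subset[OF _ countable_rat]) auto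
  then have low_sets: "low a \<in> sets M" for a
    unfolding low_def using NM by (intro sets.countable_UN') (auto simp: rationals_def borel_measurable_iff_less)
  then have Z_sets: "Z \<in> sets M" unfolding Z_def by (intro sets.countable_INT) auto
  have le: "(\<integral>\<^sup>+\<omega>. ennreal (Y \<omega>) * indicator Z \<omega> \<partial>M) \<le> ennreal a" if a: "a > 0" for a
  proof -
    let ?B = "\<lambda>n. {\<omega>. \<exists>i\<le>fact n. N (time n i) \<omega> < a}"
    let ?g = "\<lambda>n \<omega>. ennreal (Y \<omega> * indicator (?B n) \<omega>)"
    have g_meas: "(\<lambda>\<omega>. Y \<omega> * indicator (?B n) \<omega>) \<in> borel_measurable M" for n
    proof -
      have "(\<Union>i\<in>{..fact n}. {\<omega> \<in> space M. N (time n i) \<omega> < a}) \<in> sets M"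
        using NM[OF time_range] by (intro sets.finite_UN) (auto simp: borel_measurable_iff_less)
      also have "(\<Union>i\<in>{..fact n}. {\<omega> \<in> space M. N (time n i) \<omega> < a}) = ?B n \<inter> space M" by auto
      finally have "(indicator (?B n) :: 'a \<Rightarrow> real) \<in> borel_measurable M" by (simp only: borel_measurable_indicator_iff)
      then show ?thesis by (intro borel_measurable_times Y_meas)
    qed
    have g_int: "(\<integral>\<^sup>+\<omega>. ?g n \<omega> \<partial>M) \<le> ennreal a" for n
    proof -
      interpret G: closed_bounded_martingale M "\<lambda>i. \<F> (time n i)" "\<lambda>i. N (time n i)" Y C by (rule grid_martingale)
      have "integrable M (\<lambda>\<omega>. Y \<omega> * indicator (?B n) \<omega>)"
        using g_meas Y_bound G.C_nonneg by (intro integrable_const_bound[where B=C]) (auto simp: indicator_def)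
      then have "(\<integral>\<^sup>+\<omega>. ?g n \<omega> \<partial>M) = ennreal (LINT \<omega>|M. Y \<omega> * indicator (?B n) \<omega>)"
        by (rule nn_integral_eq_integral) (simp add: nonneg)
      also have "\<dots> \<le> ennreal a"
        using a nonneg(1)[OF time_range] by (intro ennreal_leI G.small_values_weight) auto
      finally show ?thesis .
    qed
    have "(\<integral>\<^sup>+\<omega>. ennreal (Y \<omega>) * indicator Z \<omega> \<partial>M) \<le> (\<integral>\<^sup>+\<omega>. liminf (\<lambda>n. ?g n \<omega>) \<partial>M)"
    proof (rule nn_integral_mono)
      fix \<omega>
      show "ennreal (Y \<omega>) * indicator Z \<omega> \<le> liminf (\<lambda>n. ?g n \<omega>)"
      proof (cases "\<omega> \<in> Z")
        case True
        obtain k :: nat where k: "1 / real (Suc k) < a" using nat_approx_posE[OF a] by auto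
        from True have "\<omega> \<in> low (1 / real (Suc k))" by (auto simp: Z_def)
        then obtain q where q: "q \<in> rationals" "N q \<omega> < a" using k by (auto simp: low_def)
        from rationals_in_grid[OF q(1)] have "\<forall>\<^sub>F n in sequentially. ennreal (Y \<omega>) \<le> ?g n \<omega>"
        proof eventually_elim
          case (elim n)
          then have "\<omega> \<in> ?B n" using q by auto
          then show ?case by simp
        qed
        then have "ennreal (Y \<omega>) \<le> liminf (\<lambda>n. ?g n \<omega>)" by (rule Liminf_bounded)
        then show ?thesis using True by simp
      qed simp
    qed
    also have "\<dots> \<le> liminf (\<lambda>n. \<integral>\<^sup>+\<omega>. ?g n \<omega> \<partial>M)"
      using g_meas by (intro nn_integral_liminf) simp
    also have "\<dots> \<le> limsup (\<lambda>n. \<integral>\<^sup>+\<omega>. ?g n \<omega> \<partial>M)"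
      by (rule Liminf_le_Limsup) simp
    also have "\<dots> \<le> ennreal a"
      using g_int by (intro Limsup_bounded) simp
    finally show ?thesis .
  qed
  have "(\<integral>\<^sup>+\<omega>. ennreal (Y \<omega>) * indicator Z \<omega> \<partial>M) = 0"
  proof -
    have "(\<integral>\<^sup>+\<omega>. ennreal (Y \<omega>) * indicator Z \<omega> \<partial>M) \<le> 0"
      by (rule ennreal_le_epsilon) (use le in auto)
    then show ?thesis by simp
  qed
  then have "AE \<omega> in M. ennreal (Y \<omega>) * indicator Z \<omega> = 0"
    using Y_meas Z_sets by (subst (asm) nn_integral_0_iff_AE) auto
  then show ?thesis
  proof (rule AE_mp, intro AE_I2 impI)
    fix \<omega> assume \<omega>: "\<omega> \<in> space M" and zero: "ennreal (Y \<omega>) * indicator Z \<omega> = 0" and pos: "Y \<omega> > 0"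
    have "\<omega> \<notin> Z"
    proof
      assume "\<omega> \<in> Z"
      with zero pos show False by simp
    qed
    then obtain k :: nat where "\<omega> \<notin> low (1 / real (Suc k))" by (auto simp: Z_def)
    then have "N q \<omega> \<ge> 1 / real (Suc k)" if "q \<in> rationals" for q
      using \<omega> that by (auto simp: low_def not_less)
    then show "\<exists>c>0. \<forall>q\<in>rationals. N q \<omega> \<ge> c"
      by (intro exI[of _ "1 / real (Suc k)"]) auto
  qed
qed

end

section \<open>One-sided limits along rational times\<close>

lemma oscillates_mono_start:
  assumes "oscillates f \<epsilon> S m a" "a' \<le> a"
  shows "oscillates f \<epsilon> S m a'"
proof (cases m)
  case (Suc n)
  with assms obtain u v where "u \<in> S" "v \<in> S" "a \<le> u" "u < v" "\<epsilon> \<le> \<bar>f u - f v\<bar>" "oscillates f \<epsilon> S n v"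
    by auto
  moreover from this have "a' \<le> u" using assms(2) by linarith
  ultimately show ?thesis unfolding Suc oscillates.simps by blast
qed simp

text \<open>If the Cauchy property failed to the right of \<open>t\<close>, then arbitrarily many disjoint oscillations could be
collected, from right to left.\<close>

lemma oscillates_cauchy_right:
  assumes fin: "\<not> oscillates f \<epsilon> S m a" and "a \<le> t" "\<epsilon> > 0"
  shows "\<exists>\<eta>>0. \<forall>u\<in>S \<inter> {t<..<t + \<eta>}. \<forall>v\<in>S \<inter> {t<..<t + \<eta>}. \<bar>f u - f v\<bar> < \<epsilon>"
proof (rule ccontr)
  assume neg: "\<not> ?thesis"
  have pair: "\<exists>u\<in>S. \<exists>v\<in>S. t < u \<and> u < v \<and> v < b \<and> \<epsilon> \<le> \<bar>f u - f v\<bar>" if "b > t" for b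
  proof -
    from neg that obtain u v where uv: "u \<in> S" "v \<in> S" "t < u" "u < b" "t < v" "v < b" "\<epsilon> \<le> \<bar>f u - f v\<bar>"
      by (auto simp: not_less dest!: spec[of _ "b - t"])
    then have "u \<noteq> v" using \<open>\<epsilon> > 0\<close> by auto
    then consider "u < v" | "v < u" by linarith
    then show ?thesis
    proof cases
      case 1
      then show ?thesis using uv by blast
    next
      case 2
      have "\<bar>f v - f u\<bar> = \<bar>f u - f v\<bar>" by (rule abs_minus_commute)
      then show ?thesis using uv 2 by metis
    qed
  qed
  have "\<exists>b>t. oscillates f \<epsilon> S k b" for k
  proof (induction k)
    case 0
    show ?case by (intro exI[of _ "t + 1"]) simp
  next
    case (Suc k)
    then obtain b where b: "b > t" "oscillates f \<epsilon> S k b" by blast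
    from pair[OF b(1)] obtain u v where uv: "u \<in> S" "v \<in> S" "t < u" "u < v" "v < b" "\<epsilon> \<le> \<bar>f u - f v\<bar>" by blast
    have "oscillates f \<epsilon> S k v" using oscillates_mono_start[OF b(2)] uv(5) by simp
    then have "oscillates f \<epsilon> S (Suc k) u" unfolding oscillates.simps using uv by blast
    then show ?case using uv(3) by blast
  qed
  then obtain b where "b > t" "oscillates f \<epsilon> S m b" by blast
  then have "oscillates f \<epsilon> S m a" using oscillates_mono_start[of f \<epsilon> S m b a] \<open>a \<le> t\<close> by simp
  with fin show False by contradiction
qed

lemma oscillates_cauchy_left:
  assumes fin: "\<not> oscillates f \<epsilon> S m a" and "a < t" "\<epsilon> > 0"
  shows "\<exists>\<eta>>0. \<forall>u\<in>S \<inter> {t - \<eta><..<t}. \<forall>v\<in>S \<inter> {t - \<eta><..<t}. \<bar>f u - f v\<bar> < \<epsilon>"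
proof (rule ccontr)
  assume neg: "\<not> ?thesis"
  have pair: "\<exists>u\<in>S. \<exists>v\<in>S. b < u \<and> u < v \<and> v < t \<and> \<epsilon> \<le> \<bar>f u - f v\<bar>" if "b < t" for b
  proof -
    from neg that obtain u v where uv: "u \<in> S" "v \<in> S" "b < u" "u < t" "b < v" "v < t" "\<epsilon> \<le> \<bar>f u - f v\<bar>"
      by (auto simp: not_less dest!: spec[of _ "t - b"])
    then have "u \<noteq> v" using \<open>\<epsilon> > 0\<close> by auto
    then consider "u < v" | "v < u" by linarith
    then show ?thesis
    proof cases
      case 1
      then show ?thesis using uv by blast
    next
      case 2
      have "\<bar>f v - f u\<bar> = \<bar>f u - f v\<bar>" by (rule abs_minus_commute)
      then show ?thesis using uv 2 by metis
    qed
  qed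
  have "oscillates f \<epsilon> S k b" if "b < t" for k b
    using that
  proof (induction k arbitrary: b)
    case (Suc k)
    from pair[OF Suc.prems] obtain u v where uv: "u \<in> S" "v \<in> S" "b < u" "u < v" "v < t" "\<epsilon> \<le> \<bar>f u - f v\<bar>" by blast
    have "oscillates f \<epsilon> S k v" by (rule Suc.IH[OF uv(5)])
    then show ?case unfolding oscillates.simps using uv less_imp_le by blast
  qed simp
  with fin \<open>a < t\<close> show False by blast
qed

lemma limit_of_cauchy_within:
  fixes f :: "real \<Rightarrow> real"
  assumes lp: "t islimpt S"
    and cauchy: "\<And>\<epsilon>. \<epsilon> > 0 \<Longrightarrow> \<exists>\<eta>>0. \<forall>u\<in>S. \<forall>v\<in>S. dist u t < \<eta> \<longrightarrow> dist v t < \<eta> \<longrightarrow> u \<noteq> t \<longrightarrow> v \<noteq> t \<longrightarrow> \<bar>f u - f v\<bar> < \<epsilon>"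
  shows "\<exists>l. (f \<longlongrightarrow> l) (at t within S)"
proof -
  from lp obtain q where q: "\<And>n::nat. q n \<in> S - {t}" "q \<longlonglongrightarrow> t"
    unfolding islimpt_sequential by blast
  have "Cauchy (\<lambda>n. f (q n))"
  proof (rule metric_CauchyI)
    fix \<epsilon> :: real assume "\<epsilon> > 0"
    from cauchy[OF this] obtain \<eta> where \<eta>: "\<eta> > 0" "\<And>u v. u \<in> S \<Longrightarrow> v \<in> S \<Longrightarrow> dist u t < \<eta> \<Longrightarrow> dist v t < \<eta> \<Longrightarrow> u \<noteq> t \<Longrightarrow> v \<noteq> t \<Longrightarrow> \<bar>f u - f v\<bar> < \<epsilon>"
      by metis
    from metric_LIMSEQ_D[OF q(2) \<eta>(1)] obtain M where M: "\<And>n. n \<ge> M \<Longrightarrow> dist (q n) t < \<eta>" by blast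
    show "\<exists>M. \<forall>m\<ge>M. \<forall>n\<ge>M. dist (f (q m)) (f (q n)) < \<epsilon>"
      using q(1) M by (intro exI[of _ M]) (auto simp: dist_real_def intro!: \<eta>(2))
  qed
  then obtain l where l: "(\<lambda>n. f (q n)) \<longlonglongrightarrow> l"
    using Cauchy_convergent convergent_def by blast
  have "(f \<longlongrightarrow> l) (at t within S)"
  proof (rule tendstoI)
    fix \<epsilon> :: real assume \<epsilon>: "\<epsilon> > 0"
    from cauchy[of "\<epsilon> / 2"] \<epsilon> obtain \<eta> where \<eta>: "\<eta> > 0" "\<And>u v. u \<in> S \<Longrightarrow> v \<in> S \<Longrightarrow> dist u t < \<eta> \<Longrightarrow> dist v t < \<eta> \<Longrightarrow> u \<noteq> t \<Longrightarrow> v \<noteq> t \<Longrightarrow> \<bar>f u - f v\<bar> < \<epsilon> / 2"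
      by (metis half_gt_zero)
    from metric_LIMSEQ_D[OF q(2) \<eta>(1)] obtain M where M: "\<And>n. n \<ge> M \<Longrightarrow> dist (q n) t < \<eta>" by blast
    from metric_LIMSEQ_D[OF l, of "\<epsilon> / 2"] \<epsilon> obtain M' where M': "\<And>n. n \<ge> M' \<Longrightarrow> dist (f (q n)) l < \<epsilon> / 2" by auto
    define n where "n = max M M'"
    have "dist (f u) l < \<epsilon>" if "u \<in> S" "u \<noteq> t" "dist u t < \<eta>" for u
    proof -
      have "\<bar>f u - f (q n)\<bar> < \<epsilon> / 2" using q(1)[of n] M[of n] that by (intro \<eta>(2)) (auto simp: n_def)
      moreover have "\<bar>f (q n) - l\<bar> < \<epsilon> / 2" using M'[of n] by (simp add: n_def dist_real_def)
      ultimately show ?thesis unfolding dist_real_def by linarith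
    qed
    then show "\<forall>\<^sub>F u in at t within S. dist (f u) l < \<epsilon>"
      unfolding eventually_at using \<eta>(1) by (intro exI[of _ \<eta>]) auto
  qed
  then show ?thesis ..
qed

abbreviation at_right_rat :: "real \<Rightarrow> real filter" where
  "at_right_rat t \<equiv> at t within (\<rat> \<inter> {t<..})"

abbreviation at_left_rat :: "real \<Rightarrow> real filter" where
  "at_left_rat t \<equiv> at t within (\<rat> \<inter> {0..<t})"

lemma islimpt_rat_right: "t islimpt (\<rat> \<inter> {t<..})" for t :: real
  unfolding islimpt_approachable
proof (intro allI impI)
  fix e :: real assume "e > 0"
  then obtain q where "q \<in> \<rat>" "t < q" "q < t + e" using Rats_dense_in_real[of t "t + e"] by auto
  then show "\<exists>x'\<in>\<rat> \<inter> {t<..}. x' \<noteq> t \<and> dist x' t < e" by (intro bexI[of _ q]) (auto simp: dist_real_def)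
qed

lemma islimpt_rat_left: "t > 0 \<Longrightarrow> t islimpt (\<rat> \<inter> {0..<t})" for t :: real
  unfolding islimpt_approachable
proof (intro allI impI)
  fix e :: real assume "e > 0" "t > 0"
  then obtain q where "q \<in> \<rat>" "max 0 (t - e) < q" "q < t" using Rats_dense_in_real[of "max 0 (t - e)" t] by auto
  then show "\<exists>x'\<in>\<rat> \<inter> {0..<t}. x' \<noteq> t \<and> dist x' t < e" by (intro bexI[of _ q]) (auto simp: dist_real_def)
qed

lemma eventually_at_right_rat:
  "(\<forall>\<^sub>F q in at_right_rat t. Q q) \<longleftrightarrow> (\<exists>\<eta>>0. \<forall>q\<in>\<rat>. t < q \<longrightarrow> q < t + \<eta> \<longrightarrow> Q q)"
  unfolding eventually_at by (auto simp: dist_real_def)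

lemma eventually_at_left_rat:
  "(\<forall>\<^sub>F q in at_left_rat t. Q q) \<longleftrightarrow> (\<exists>\<eta>>0. \<forall>q\<in>\<rat>. 0 \<le> q \<longrightarrow> t - \<eta> < q \<longrightarrow> q < t \<longrightarrow> Q q)"
  unfolding eventually_at by (auto simp: dist_real_def)

lemma right_limits_right_continuous:
  fixes f g :: "real \<Rightarrow> real"
  assumes lim: "\<And>s. s \<ge> 0 \<Longrightarrow> (f \<longlongrightarrow> g s) (at_right_rat s)" and "t \<ge> 0"
  shows "(g \<longlongrightarrow> g t) (at_right t)"
proof (rule tendstoI)
  fix \<epsilon> :: real assume \<epsilon>: "\<epsilon> > 0"
  obtain \<eta> where \<eta>: "\<eta> > 0" "\<And>q. q \<in> \<rat> \<Longrightarrow> t < q \<Longrightarrow> q < t + \<eta> \<Longrightarrow> dist (f q) (g t) < \<epsilon> / 2"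
    using tendstoD[OF lim[OF assms(2)], of "\<epsilon> / 2"] \<epsilon> unfolding eventually_at_right_rat by auto
  have "dist (g s) (g t) < \<epsilon>" if s: "t < s" "s < t + \<eta>" for s
  proof -
    obtain \<eta>' where \<eta>': "\<eta>' > 0" "\<And>q. q \<in> \<rat> \<Longrightarrow> s < q \<Longrightarrow> q < s + \<eta>' \<Longrightarrow> dist (f q) (g s) < \<epsilon> / 2"
      using tendstoD[OF lim[of s], of "\<epsilon> / 2"] \<epsilon> s assms(2) unfolding eventually_at_right_rat by auto
    obtain q where q: "q \<in> \<rat>" "s < q" "q < min (s + \<eta>') (t + \<eta>)"
      using Rats_dense_in_real[of s "min (s + \<eta>') (t + \<eta>)"] s \<eta>'(1) by auto
    have "dist (f q) (g s) < \<epsilon> / 2" using q s by (intro \<eta>'(2)) auto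
    moreover have "dist (f q) (g t) < \<epsilon> / 2" using q s by (intro \<eta>(2)) auto
    ultimately show ?thesis unfolding dist_real_def by linarith
  qed
  then show "\<forall>\<^sub>F s in at_right t. dist (g s) (g t) < \<epsilon>"
    unfolding eventually_at_right_field using \<eta>(1) by (intro exI[of _ "t + \<eta>"]) auto
qed

lemma right_limits_left_limit:
  fixes f g :: "real \<Rightarrow> real"
  assumes lim: "\<And>s. s \<ge> 0 \<Longrightarrow> (f \<longlongrightarrow> g s) (at_right_rat s)" and "t > 0" and left: "(f \<longlongrightarrow> l) (at_left_rat t)"
  shows "(g \<longlongrightarrow> l) (at_left t)"
proof (rule tendstoI)
  fix \<epsilon> :: real assume \<epsilon>: "\<epsilon> > 0"
  obtain \<eta> where \<eta>: "\<eta> > 0" "\<And>q. q \<in> \<rat> \<Longrightarrow> 0 \<le> q \<Longrightarrow> t - \<eta> < q \<Longrightarrow> q < t \<Longrightarrow> dist (f q) l < \<epsilon> / 2"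
    using tendstoD[OF left, of "\<epsilon> / 2"] \<epsilon> unfolding eventually_at_left_rat by auto
  have "dist (g s) l < \<epsilon>" if s: "max 0 (t - \<eta>) < s" "s < t" for s
  proof -
    obtain \<eta>' where \<eta>': "\<eta>' > 0" "\<And>q. q \<in> \<rat> \<Longrightarrow> s < q \<Longrightarrow> q < s + \<eta>' \<Longrightarrow> dist (f q) (g s) < \<epsilon> / 2"
      using tendstoD[OF lim[of s], of "\<epsilon> / 2"] \<epsilon> s unfolding eventually_at_right_rat by auto
    obtain q where q: "q \<in> \<rat>" "s < q" "q < min (s + \<eta>') t"
      using Rats_dense_in_real[of s "min (s + \<eta>') t"] s \<eta>'(1) by auto
    have "dist (f q) (g s) < \<epsilon> / 2" using q s by (intro \<eta>'(2)) auto
    moreover have "dist (f q) l < \<epsilon> / 2" using q s by (intro \<eta>(2)) auto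
    ultimately show ?thesis unfolding dist_real_def by linarith
  qed
  then show "\<forall>\<^sub>F s in at_left t. dist (g s) l < \<epsilon>"
    unfolding eventually_at_left_field using \<eta>(1) \<open>t > 0\<close> by (intro exI[of _ "max 0 (t - \<eta>)"]) auto
qed

section \<open>Kernels on the augmented state space\<close>

primrec unPt :: "'v::zero state \<Rightarrow> 'v" where
  "unPt (Pt x) = x"
| "unPt Cemetery = 0"

lemma cem_cases: "y \<in> cem D \<Longrightarrow> (\<And>x. x \<in> D \<Longrightarrow> y = Pt x \<Longrightarrow> R) \<Longrightarrow> (y = Cemetery \<Longrightarrow> R) \<Longrightarrow> R"
  by (auto simp: cem_def)

lemma cem_generators_Pow: "insert {Cemetery} (image Pt ` sets (restrict_space borel D)) \<subseteq> Pow (cem D)"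
  using sets.sets_into_space[of _ "restrict_space borel D"] by (auto simp: cem_def space_restrict_space)

lemma space_cem: "space (cem_algebra D) = cem D"
  unfolding cem_algebra_def using cem_generators_Pow by (rule space_measure_of)

lemma sets_cem:
  assumes "closed D"
  shows "A \<in> sets (cem_algebra D) \<longleftrightarrow> A \<subseteq> cem D \<and> Pt -` A \<in> sets borel"
proof
  assume "A \<in> sets (cem_algebra D)"
  then have "A \<in> sigma_sets (cem D) (insert {Cemetery} (image Pt ` sets (restrict_space borel D)))"
    unfolding cem_algebra_def by (simp only: sets_measure_of[OF cem_generators_Pow])
  then show "A \<subseteq> cem D \<and> Pt -` A \<in> sets borel"
  proof (induction rule: sigma_sets.induct)
    case (Basic a)
    then show ?case
    proof
      assume "a \<in> image Pt ` sets (restrict_space borel D)"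
      then obtain B where B: "a = Pt ` B" "B \<in> sets borel" "B \<subseteq> D"
        using assms by (auto simp: sets_restrict_space_iff)
      then have "Pt -` a = B" by auto
      then show ?thesis using B by (auto simp: cem_def)
    next
      assume "a = {Cemetery}"
      have 1: "Pt -` a = {}" unfolding \<open>a = {Cemetery}\<close> by auto
      have 2: "a \<subseteq> cem D" unfolding \<open>a = {Cemetery}\<close> by (simp add: cem_def)
      show ?thesis using 2 unfolding 1 by simp
    qed
  next
    case (Compl a)
    have "Pt -` (cem D - a) = D - Pt -` a" by (auto simp: cem_def)
    then show ?case using Compl assms by auto
  next
    case (Union a)
    then show ?case by (auto simp: vimage_UN)
  qed auto
next
  assume A: "A \<subseteq> cem D \<and> Pt -` A \<in> sets borel"
  then have "Pt -` A \<subseteq> D" by (auto simp: cem_def)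
  have gen: "B \<in> sets (cem_algebra D)" if "B \<in> insert {Cemetery} (image Pt ` sets (restrict_space borel D))" for B
    unfolding cem_algebra_def sets_measure_of[OF cem_generators_Pow] using that by (rule sigma_sets.Basic)
  have "Pt ` (Pt -` A) \<in> sets (cem_algebra D)"
    by (rule gen, rule insertI2, rule imageI) (use A \<open>Pt -` A \<subseteq> D\<close> assms in \<open>simp add: sets_restrict_space_iff\<close>)
  moreover have "{Cemetery} \<in> sets (cem_algebra D)" by (rule gen) simp
  ultimately have "Pt ` (Pt -` A) \<union> (if Cemetery \<in> A then {Cemetery} else {}) \<in> sets (cem_algebra D)"
    by (cases "Cemetery \<in> A") (simp_all only: if_True if_False Un_empty_right sets.Un)
  also have "Pt ` (Pt -` A) \<union> (if Cemetery \<in> A then {Cemetery} else {}) = A"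
  proof (intro set_eqI)
    fix y show "y \<in> Pt ` (Pt -` A) \<union> (if Cemetery \<in> A then {Cemetery} else {}) \<longleftrightarrow> y \<in> A"
      by (cases y) auto
  qed
  finally show "A \<in> sets (cem_algebra D)" .
qed

lemma sets_Pt_image:
  assumes "closed D"
  shows "Pt ` D \<in> sets (cem_algebra D)" "{Cemetery} \<in> sets (cem_algebra D)"
    and "A \<in> sets borel \<Longrightarrow> Pt ` (A \<inter> D) \<in> sets (cem_algebra D)"
proof -
  have pre: "Pt -` Pt ` B = B" "Pt -` {Cemetery} = {}" for B :: "'a set" by auto
  show "Pt ` D \<in> sets (cem_algebra D)" "{Cemetery} \<in> sets (cem_algebra D)"
    and "A \<in> sets borel \<Longrightarrow> Pt ` (A \<inter> D) \<in> sets (cem_algebra D)"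
    using assms by (auto simp: sets_cem pre cem_def)
qed

lemma Pt_measurable:
  assumes "closed D"
  shows "Pt \<in> measurable (restrict_space borel D) (cem_algebra D)"
proof (rule measurableI)
  fix A assume "A \<in> sets (cem_algebra D)"
  then show "Pt -` A \<inter> space (restrict_space borel D) \<in> sets (restrict_space borel D)"
    using assms by (auto simp: sets_cem space_restrict_space sets_restrict_space_iff)
qed (auto simp: space_cem cem_def space_restrict_space)

lemma unPt_measurable:
  fixes D :: "'v::{topological_space, zero} set"
  assumes "closed D"
  shows "unPt \<in> borel_measurable (cem_algebra D)"
proof (rule measurableI)
  fix A :: "'v set" assume A: "A \<in> sets borel"
  have "Pt -` (unPt -` A \<inter> space (cem_algebra D)) = A \<inter> D"
    by (auto simp: space_cem cem_def)
  then show "unPt -` A \<inter> space (cem_algebra D) \<in> sets (cem_algebra D)"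
    using A assms by (simp add: sets_cem) (simp add: space_cem)
qed simp

lemma zext_measurable:
  fixes g :: "'v::{topological_space, zero} \<Rightarrow> 'b::{topological_space, zero}"
  assumes "closed D" "g \<in> borel_measurable borel"
  shows "zext g \<in> borel_measurable (cem_algebra D)"
proof (rule measurableI)
  fix A :: "'b set" assume A: "A \<in> sets borel"
  have "Pt -` (zext g -` A \<inter> space (cem_algebra D)) = (g -` A \<inter> space borel) \<inter> D"
    by (auto simp: space_cem cem_def)
  moreover have "g -` A \<inter> space borel \<in> sets borel" using assms(2) A by (rule measurable_sets)
  ultimately show "zext g -` A \<inter> space (cem_algebra D) \<in> sets (cem_algebra D)"
    using assms(1) by (simp add: sets_cem) (simp add: space_cem)
qed simp

lemma transition_functionD:
  assumes "transition_function D p"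
  shows "\<And>t x. t \<ge> 0 \<Longrightarrow> x \<in> cem D \<Longrightarrow> sets (p t x) = sets (cem_algebra D)"
    and "\<And>t x. t \<ge> 0 \<Longrightarrow> x \<in> cem D \<Longrightarrow> emeasure (p t x) (Pt ` D) \<le> 1"
    and "\<And>t x. t \<ge> 0 \<Longrightarrow> x \<in> cem D \<Longrightarrow> emeasure (p t x) {Cemetery} = 1 - emeasure (p t x) (Pt ` D)"
    and "\<And>t. t \<ge> 0 \<Longrightarrow> emeasure (p t Cemetery) {Cemetery} = 1"
    and "\<And>x. x \<in> cem D \<Longrightarrow> p 0 x = return (cem_algebra D) x"
    and "\<And>t \<Gamma>. t \<ge> 0 \<Longrightarrow> \<Gamma> \<in> sets (cem_algebra D) \<Longrightarrow> (\<lambda>x. emeasure (p t x) \<Gamma>) \<in> borel_measurable (cem_algebra D)"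
    and "\<And>s t x \<Gamma>. s \<ge> 0 \<Longrightarrow> t \<ge> 0 \<Longrightarrow> x \<in> cem D \<Longrightarrow> \<Gamma> \<in> sets (cem_algebra D) \<Longrightarrow>
        emeasure (p (t + s) x) \<Gamma> = (\<integral>\<^sup>+\<xi>. emeasure (p t \<xi>) \<Gamma> \<partial>(p s x))"
  using assms unfolding transition_function_def by blast+

text \<open>A transition function on the augmented state space gives rise to kernels on the vector space itself.\<close>

locale state_kernel =
  fixes D :: "'v::euclidean_space set" and p :: "real \<Rightarrow> 'v state \<Rightarrow> 'v state measure"
  assumes closed_D: "closed D" and transition: "transition_function D p"
begin

text \<open>The null measure off \<open>D\<close> makes the kernel measurable in its starting point on the whole space.\<close>

definition \<kappa> :: "real \<Rightarrow> 'v \<Rightarrow> 'v measure" where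
  "\<kappa> s x = (if x \<in> D then distr (restrict_space (p s (Pt x)) (Pt ` D)) borel unPt else null_measure borel)"

lemma sets_p: "t \<ge> 0 \<Longrightarrow> y \<in> cem D \<Longrightarrow> sets (p t y) = sets (cem_algebra D)"
  by (rule transition_functionD(1)[OF transition])

lemma space_p: "t \<ge> 0 \<Longrightarrow> y \<in> cem D \<Longrightarrow> space (p t y) = cem D"
  using sets_eq_imp_space_eq[OF sets_p] by (simp add: space_cem)

lemma p_mass: "t \<ge> 0 \<Longrightarrow> y \<in> cem D \<Longrightarrow> emeasure (p t y) (Pt ` D) \<le> 1"
  and p_cem: "t \<ge> 0 \<Longrightarrow> y \<in> cem D \<Longrightarrow> emeasure (p t y) {Cemetery} = 1 - emeasure (p t y) (Pt ` D)"
  by (rule transition_functionD[OF transition]; assumption)+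

lemma Pt_in_cem: "x \<in> D \<Longrightarrow> Pt x \<in> cem D" and Cem_in_cem: "Cemetery \<in> cem D"
  by (auto simp: cem_def)

lemma prob_p:
  assumes "t \<ge> 0" "y \<in> cem D"
  shows "prob_space (p t y)"
proof
  have "emeasure (p t y) (Pt ` D \<union> {Cemetery}) = emeasure (p t y) (Pt ` D) + emeasure (p t y) {Cemetery}"
    using assms closed_D by (intro plus_emeasure[symmetric]) (auto simp: sets_p sets_Pt_image)
  also have "\<dots> = 1"
    using p_cem[OF assms] p_mass[OF assms] by (simp add: add_diff_inverse_ennreal)
  also have "Pt ` D \<union> {Cemetery} = space (p t y)" using assms by (auto simp: space_p cem_def)
  finally show "emeasure (p t y) (space (p t y)) = 1" .
qed

lemma cemetery_absorbing: "t \<ge> 0 \<Longrightarrow> emeasure (p t Cemetery) (Pt ` D) = 0"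
proof -
  assume t: "t \<ge> 0"
  have "emeasure (p t Cemetery) {Cemetery} = 1" by (rule transition_functionD(4)[OF transition t])
  then have one: "1 - emeasure (p t Cemetery) (Pt ` D) = 1" using p_cem[OF t Cem_in_cem] by simp
  have "emeasure (p t Cemetery) (Pt ` D) + (1 - emeasure (p t Cemetery) (Pt ` D)) = 1"
    by (rule add_diff_inverse_ennreal[OF p_mass[OF t Cem_in_cem]])
  then have "1 + emeasure (p t Cemetery) (Pt ` D) = 1 + 0"
    unfolding one by (simp only: add.commute add_0_right)
  then show ?thesis by (simp only: ennreal_add_left_cancel) simp
qed

lemma set_integral_p_zero:
  fixes f :: "'v state \<Rightarrow> 'b::{banach, second_countable_topology}"
  assumes "t \<ge> 0"
  shows "set_lebesgue_integral (p t Cemetery) (Pt ` D) f = 0"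
proof -
  have "AE y in p t Cemetery. y \<notin> Pt ` D"
    using assms cemetery_absorbing[OF assms] sets_Pt_image(1)[OF closed_D]
    by (intro AE_not_in) (auto simp: null_sets_def sets_p Cem_in_cem)
  then show ?thesis
    unfolding set_lebesgue_integral_def by (intro integral_eq_zero_AE) (auto elim!: eventually_mono)
qed

lemma restrict_p_measurable: "s \<ge> 0 \<Longrightarrow> x \<in> D \<Longrightarrow> unPt \<in> measurable (restrict_space (p s (Pt x)) (Pt ` D)) borel"
proof (rule measurable_restrict_space1)
  assume "s \<ge> 0" "x \<in> D"
  then have "sets (p s (Pt x)) = sets (cem_algebra D)" by (intro sets_p Pt_in_cem)
  then show "unPt \<in> borel_measurable (p s (Pt x))"
    using unPt_measurable[OF closed_D] by (subst measurable_cong_sets[OF _ refl])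
qed

lemma sets_kappa: "sets (\<kappa> s x) = sets borel"
  by (simp add: \<kappa>_def)

lemma Pt_inter:
  assumes "s \<ge> 0" "x \<in> D"
  shows "Pt ` D \<inter> space (p s (Pt x)) \<in> sets (p s (Pt x))"
proof -
  have "Pt ` D \<in> sets (p s (Pt x))"
    unfolding sets_p[OF assms(1) Pt_in_cem[OF assms(2)]] by (rule sets_Pt_image(1)[OF closed_D])
  then show ?thesis by (rule sets.Int[OF _ sets.top])
qed

lemma kappa_eq: "x \<in> D \<Longrightarrow> \<kappa> s x = distr (restrict_space (p s (Pt x)) (Pt ` D)) borel unPt"
  by (simp add: \<kappa>_def)

lemma emeasure_kappa:
  assumes "s \<ge> 0" "x \<in> D" "A \<in> sets borel"
  shows "emeasure (\<kappa> s x) A = emeasure (p s (Pt x)) (Pt ` (A \<inter> D))"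
proof -
  have "emeasure (\<kappa> s x) A = emeasure (restrict_space (p s (Pt x)) (Pt ` D)) (unPt -` A \<inter> space (restrict_space (p s (Pt x)) (Pt ` D)))"
    unfolding kappa_eq[OF assms(2)] by (rule emeasure_distr[OF restrict_p_measurable[OF assms(1,2)] assms(3)])
  also have "unPt -` A \<inter> space (restrict_space (p s (Pt x)) (Pt ` D)) = Pt ` (A \<inter> D)"
    using assms by (auto simp: space_restrict_space space_p Pt_in_cem)
  also have "emeasure (restrict_space (p s (Pt x)) (Pt ` D)) (Pt ` (A \<inter> D)) = emeasure (p s (Pt x)) (Pt ` (A \<inter> D))"
    by (rule emeasure_restrict_space[OF Pt_inter[OF assms(1,2)]]) auto
  finally show ?thesis .
qed

lemma integral_kappa:
  fixes g :: "'v \<Rightarrow> 'b::{banach, second_countable_topology}"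
  assumes "s \<ge> 0" "x \<in> D" "g \<in> borel_measurable borel"
  shows "integral\<^sup>L (\<kappa> s x) g = set_lebesgue_integral (p s (Pt x)) (Pt ` D) (zext g)"
proof -
  have "integral\<^sup>L (\<kappa> s x) g = (LINT y|restrict_space (p s (Pt x)) (Pt ` D). g (unPt y))"
    unfolding kappa_eq[OF assms(2)] by (rule integral_distr[OF restrict_p_measurable[OF assms(1,2)] assms(3)])
  also have "\<dots> = (LINT y|p s (Pt x). indicator (Pt ` D) y *\<^sub>R g (unPt y))"
    by (rule integral_restrict_space[OF Pt_inter[OF assms(1,2)]])
  also have "\<dots> = set_lebesgue_integral (p s (Pt x)) (Pt ` D) (zext g)"
    unfolding set_lebesgue_integral_def by (rule Bochner_Integration.integral_cong) (auto simp: indicator_def)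
  finally show ?thesis .
qed

lemma kappa_measurable:
  assumes "t \<ge> 0" "A \<in> sets borel"
  shows "(\<lambda>\<xi>. emeasure (\<kappa> t \<xi>) A) \<in> borel_measurable borel"
proof -
  have "(\<lambda>y. emeasure (p t y) (Pt ` (A \<inter> D))) \<in> borel_measurable (cem_algebra D)"
    by (rule transition_functionD(6)[OF transition assms(1) sets_Pt_image(3)[OF closed_D assms(2)]])
  then have "(\<lambda>\<xi>. emeasure (p t (Pt \<xi>)) (Pt ` (A \<inter> D))) \<in> borel_measurable (restrict_space borel D)"
    by (rule measurable_compose[OF Pt_measurable[OF closed_D]])
  then have "(\<lambda>\<xi>. if \<xi> \<in> D then emeasure (p t (Pt \<xi>)) (Pt ` (A \<inter> D)) else 0) \<in> borel_measurable borel"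
    using closed_D by (subst measurable_If_restrict_space_iff) auto
  also have "(\<lambda>\<xi>. if \<xi> \<in> D then emeasure (p t (Pt \<xi>)) (Pt ` (A \<inter> D)) else 0) = (\<lambda>\<xi>. emeasure (\<kappa> t \<xi>) A)"
    using assms by (auto simp: fun_eq_iff emeasure_kappa) (simp add: \<kappa>_def)
  finally show ?thesis .
qed

lemma kappa_chapman_kolmogorov:
  assumes "s \<ge> 0" "t \<ge> 0" "x \<in> D" "A \<in> sets borel"
  shows "emeasure (\<kappa> (t + s) x) A = (\<integral>\<^sup>+\<xi>. emeasure (\<kappa> t \<xi>) A \<partial>\<kappa> s x)"
proof -
  let ?A = "Pt ` (A \<inter> D)"
  have "emeasure (\<kappa> (t + s) x) A = emeasure (p (t + s) (Pt x)) ?A"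
    using assms by (intro emeasure_kappa) auto
  also have "\<dots> = (\<integral>\<^sup>+y. emeasure (p t y) ?A \<partial>p s (Pt x))"
    by (rule transition_functionD(7)[OF transition assms(1,2) Pt_in_cem[OF assms(3)] sets_Pt_image(3)[OF closed_D assms(4)]])
  also have "\<dots> = (\<integral>\<^sup>+y. emeasure (\<kappa> t (unPt y)) A * indicator (Pt ` D) y \<partial>p s (Pt x))"
  proof (rule nn_integral_cong)
    fix y assume "y \<in> space (p s (Pt x))"
    then have "y \<in> cem D" using assms by (simp add: space_p Pt_in_cem)
    then show "emeasure (p t y) ?A = emeasure (\<kappa> t (unPt y)) A * indicator (Pt ` D) y"
    proof (rule cem_cases)
      assume y: "y = Cemetery"
      have "emeasure (p t y) ?A \<le> emeasure (p t y) (Pt ` D)"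
        using assms sets_Pt_image(1)[OF closed_D] y by (intro emeasure_mono) (auto simp: sets_p Cem_in_cem)
      moreover have "y \<notin> Pt ` D" using y by auto
      ultimately show ?thesis using cemetery_absorbing[OF assms(2)] y by simp
    next
      fix x' assume x': "x' \<in> D" "y = Pt x'"
      then show ?thesis using emeasure_kappa[OF assms(2) x'(1) assms(4)] by simp
    qed
  qed
  also have "\<dots> = (\<integral>\<^sup>+y. emeasure (\<kappa> t (unPt y)) A \<partial>restrict_space (p s (Pt x)) (Pt ` D))"
    by (rule nn_integral_restrict_space[OF Pt_inter[OF assms(1,3)], symmetric])
  also have "\<dots> = (\<integral>\<^sup>+\<xi>. emeasure (\<kappa> t \<xi>) A \<partial>\<kappa> s x)"
    unfolding kappa_eq[OF assms(3), of s]
    by (rule nn_integral_distr[OF restrict_p_measurable[OF assms(1,3)], symmetric]) (simp add: kappa_measurable assms)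
  finally show ?thesis .
qed

lemma kappa_zero:
  assumes "x \<in> D"
  shows "\<kappa> 0 x = return borel x"
proof (rule measure_eqI)
  fix A assume "A \<in> sets (\<kappa> 0 x)"
  then have A: "A \<in> sets borel" by (simp add: sets_kappa)
  have "p 0 (Pt x) = return (cem_algebra D) (Pt x)"
    by (rule transition_functionD(5)[OF transition Pt_in_cem[OF assms]])
  then show "emeasure (\<kappa> 0 x) A = emeasure (return borel x) A"
    using A assms sets_Pt_image(3)[OF closed_D A] by (auto simp: emeasure_kappa indicator_def)
qed (simp add: sets_kappa)

end

text \<open>The arguments \<open>(0, v)\<close> all belong to the level set for \<open>m = 1\<close>, and the affinely independent points of \<open>D\<close> span.\<close>

lemma affine_kernel_of_affine_process:
  fixes D :: "'v::euclidean_space set"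
  assumes "closed D" and S: "\<exists>S\<subseteq>D. finite S \<and> card S = DIM('v) + 1 \<and> \<not> affine_dependent S"
    and aff: "affine_process D \<Omega> P Fil X p"
  shows "\<exists>\<Phi> \<psi>R \<psi>I y0. affine_kernel D (state_kernel.\<kappa> D p) \<Phi> \<psi>R \<psi>I y0"
proof -
  have tf: "transition_function D p" and sc: "stoch_continuous D p"
    using aff by (auto simp: affine_process_def markov_process_def)
  interpret state_kernel D p using assms(1) tf by unfold_locales
  obtain \<Phi> \<psi> where cont: "\<And>x m. x \<in> D \<Longrightarrow> m \<ge> 1 \<Longrightarrow> continuous_on (Q_level D \<Phi> m) (\<lambda>(t, u). pairing (\<psi> t u) x)"
    and four: "\<And>x t u. x \<in> D \<Longrightarrow> t \<ge> 0 \<Longrightarrow> u \<in> U_set D \<Longrightarrow>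
        set_lebesgue_integral (p t (Pt x)) (Pt ` D) (zext (\<lambda>\<xi>. exp (pairing u \<xi>))) = \<Phi> t u * exp (pairing (\<psi> t u) x)"
    using aff by (simp add: affine_process_def) metis
  obtain S where S: "S \<subseteq> D" "finite S" "card S = DIM('v) + 1" "\<not> affine_dependent S" using S by blast
  have "aff_dim S = int (DIM('v))" using aff_dim_affine_independent[OF S(4)] S(3) by simp
  then have hull: "affine hull S = UNIV" using aff_dim_eq_full by blast
  have "S \<noteq> {}" using S by auto
  then obtain y0 where y0: "y0 \<in> S" by blast
  have span: "span ((\<lambda>x. x - y0) ` D) = UNIV"
  proof -
    let ?W = "span ((\<lambda>x. x - y0) ` D)"
    have "affine {y. y - y0 \<in> ?W}"
      unfolding affine_def
    proof (intro ballI allI impI)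
      fix x y u v assume "x \<in> {y. y - y0 \<in> ?W}" "y \<in> {y. y - y0 \<in> ?W}" "u + v = (1::real)"
      then have "u *\<^sub>R (x - y0) + v *\<^sub>R (y - y0) \<in> ?W" by (intro span_add span_scale) auto
      also have "u *\<^sub>R (x - y0) + v *\<^sub>R (y - y0) = u *\<^sub>R x + v *\<^sub>R y - (u + v) *\<^sub>R y0"
        by (simp add: algebra_simps)
      finally show "u *\<^sub>R x + v *\<^sub>R y \<in> {y. y - y0 \<in> ?W}" using \<open>u + v = 1\<close> by simp
    qed
    moreover have "S \<subseteq> {y. y - y0 \<in> ?W}" using S(1) by (auto intro: span_base)
    ultimately have "affine hull S \<subseteq> {y. y - y0 \<in> ?W}" by (intro hull_minimal)
    then have "z + y0 \<in> {y. y - y0 \<in> ?W}" for z using hull by blast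
    then show ?thesis by (metis UNIV_eq_I add_diff_cancel_right' mem_Collect_eq)
  qed
  have pair0: "pairing (0, v) \<xi> = \<i> * complex_of_real (v \<bullet> \<xi>)" for v \<xi> :: 'v
    by (simp add: pairing_def complex_eq_iff)
  have U: "(0, v) \<in> U_set D" for v
    unfolding U_set_def by (auto intro!: boundedI[where B=1] simp: pair0)
  have "affine_kernel D \<kappa> (\<lambda>s v. \<Phi> s (0, v)) (\<lambda>s v. fst (\<psi> s (0, v))) (\<lambda>s v. snd (\<psi> s (0, v))) y0"
  proof
    show "y0 \<in> D" using y0 S by auto
    show "emeasure (\<kappa> s x) UNIV \<le> 1" if "s \<ge> 0" "x \<in> D" for s x
      using that p_mass[OF _ Pt_in_cem] by (simp add: emeasure_kappa)
    show "emeasure (\<kappa> s x) (- D) = 0" if "s \<ge> 0" "x \<in> D" for s x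
      using that closed_D by (subst emeasure_kappa) auto
    show "((\<lambda>s. LINT \<xi>|\<kappa> s x. g \<xi>) \<longlongrightarrow> (LINT \<xi>|\<kappa> t x. g \<xi>)) (at t within {0..})"
      if "x \<in> D" "t \<ge> 0" "continuous_on UNIV g" "bounded (range g)" for x t and g :: "'v \<Rightarrow> real"
    proof -
      have gm: "g \<in> borel_measurable borel" using that(3) by (rule borel_measurable_continuous_onI)
      have "continuous_on D g" using that(3) by (rule continuous_on_subset) simp
      moreover have "bounded (g ` D)" using that(4) by (rule bounded_subset) auto
      ultimately have "((\<lambda>s. set_lebesgue_integral (p s (Pt x)) (Pt ` D) (zext g)) \<longlongrightarrow>
          set_lebesgue_integral (p t (Pt x)) (Pt ` D) (zext g)) (at t within {0..})"
        using sc that unfolding stoch_continuous_def by blast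
      moreover have "\<forall>\<^sub>F s in at t within {0..}. set_lebesgue_integral (p s (Pt x)) (Pt ` D) (zext g) = (LINT \<xi>|\<kappa> s x. g \<xi>)"
        unfolding eventually_at_filter by (rule always_eventually) (use that gm in \<open>auto simp: integral_kappa\<close>)
      ultimately show ?thesis
        using that gm by (simp add: integral_kappa) (rule Lim_transform_eventually)
    qed
    show "(CLINT \<xi>|\<kappa> s x. iexp (v \<bullet> \<xi>)) = \<Phi> s (0, v) * exp (Complex (fst (\<psi> s (0, v)) \<bullet> x) (snd (\<psi> s (0, v)) \<bullet> x))"
      if "s \<ge> 0" "x \<in> D" for s x v
    proof -
      have "(\<lambda>\<xi>. iexp (v \<bullet> \<xi>)) \<in> borel_measurable borel"
        by (intro borel_measurable_continuous_onI continuous_intros)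
      then show ?thesis using four[OF that(2,1) U, of v] that by (simp add: integral_kappa pair0) (simp add: pairing_def)
    qed
    show "continuous_on {(s, v). 0 \<le> s \<and> (\<forall>r\<in>{0..s}. \<Phi> r (0, v) \<noteq> 0)}
          (\<lambda>(s, v). Complex (fst (\<psi> s (0, v)) \<bullet> x) (snd (\<psi> s (0, v)) \<bullet> x))" if "x \<in> D" for x
    proof -
      let ?K = "{(s, v). 0 \<le> s \<and> (\<forall>r\<in>{0..s}. \<Phi> r (0, v) \<noteq> 0)}"
      have map: "continuous_on ?K (\<lambda>p. (fst p, (0::'v, snd p)))" by (intro continuous_intros)
      have into: "(\<lambda>p. (fst p, (0::'v, snd p))) ` ?K \<subseteq> Q_level D \<Phi> 1"
        by (auto simp: Q_level_def U_level_def)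
      show ?thesis
        using continuous_on_compose2[OF cont[OF that order_refl] map into] by (simp add: case_prod_beta pairing_def)
    qed
  qed (use closed_D span in \<open>auto simp: sets_kappa kappa_zero kappa_chapman_kolmogorov\<close>)
  then show ?thesis by blast
qed

section \<open>Charts of the compactified state space\<close>

text \<open>Stereographic coordinates: these finitely many functions vanish at infinity, and a point is recovered
from them as \<open>x \<bullet> b = chart (Some b) x / chart None x\<close>. Extended by 0 they also tell apart the cemetery from the
points of \<open>D\<close>, so convergence of paths can be tested on them.\<close>

primrec chart :: "'v::euclidean_space option \<Rightarrow> 'v \<Rightarrow> real" where
  "chart None x = 1 / (1 + (norm x)\<^sup>2)"
| "chart (Some b) x = (b \<bullet> x) / (1 + (norm x)\<^sup>2)"

definition chart_index :: "'v::euclidean_space option set" where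
  "chart_index = insert None (Some ` Basis)"

lemma chart_index_finite: "finite chart_index" and None_chart_index: "None \<in> chart_index"
  and Some_chart_index: "b \<in> Basis \<Longrightarrow> Some b \<in> chart_index"
  by (auto simp: chart_index_def)

lemma chart_denominator_pos: "1 + (norm x)\<^sup>2 > (0::real)" for x :: "'v::euclidean_space"
  by (simp add: add_pos_nonneg)

lemma chart_cont: "continuous_on UNIV (chart i)"
proof -
  have "1 + (norm x)\<^sup>2 \<noteq> (0::real)" for x :: "'v::euclidean_space"
    using chart_denominator_pos[of x] by simp
  then show ?thesis by (cases i) (auto intro!: continuous_intros)
qed

lemma chart_None_pos: "chart None x > 0"
  using chart_denominator_pos[of x] by simp

lemma chart_le_inverse_norm:
  assumes "i \<in> chart_index"
  shows "\<bar>chart i x\<bar> \<le> 1" and "x \<noteq> 0 \<Longrightarrow> \<bar>chart i x\<bar> \<le> inverse (norm x)"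
proof -
  let ?n = "norm x"
  have "2 * ?n \<le> 1 + ?n\<^sup>2" using sum_squares_bound[of 1 ?n] by simp
  then have n: "?n \<le> 1 + ?n\<^sup>2" "1 \<le> 1 + ?n\<^sup>2" "?n * ?n \<le> 1 + ?n\<^sup>2"
    using norm_ge_zero[of x] zero_le_power2[of ?n] power2_eq_square[of ?n] by linarith+
  have denom: "\<bar>1 + ?n\<^sup>2\<bar> = 1 + ?n\<^sup>2" by (rule abs_of_pos[OF chart_denominator_pos])
  have num: "\<exists>c. \<bar>chart i x\<bar> = c / (1 + ?n\<^sup>2) \<and> 0 \<le> c \<and> (c \<le> 1 \<or> c \<le> ?n)"
  proof (cases i)
    case None
    show ?thesis unfolding None chart.simps abs_divide denom by (rule exI[of _ 1]) auto
  next
    case (Some b)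
    then have "norm b = 1" using assms by (auto simp: chart_index_def)
    then have "\<bar>b \<bullet> x\<bar> \<le> ?n" using Cauchy_Schwarz_ineq2[of b x] by simp
    then show ?thesis unfolding Some chart.simps abs_divide denom by (intro exI[of _ "\<bar>b \<bullet> x\<bar>"]) auto
  qed
  then obtain c where c: "\<bar>chart i x\<bar> = c / (1 + ?n\<^sup>2)" "0 \<le> c" "c \<le> 1 \<or> c \<le> ?n" by blast
  have "c \<le> 1 + ?n\<^sup>2" using c n by linarith
  then show "\<bar>chart i x\<bar> \<le> 1" unfolding c(1) using chart_denominator_pos[of x] by simp
  assume "x \<noteq> 0"
  have "c * ?n \<le> 1 + ?n\<^sup>2"
    using c(3)
  proof
    assume "c \<le> 1"
    then have "c * ?n \<le> 1 * ?n" by (intro mult_right_mono) auto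
    then show ?thesis using n by simp
  next
    assume "c \<le> ?n"
    then have "c * ?n \<le> ?n * ?n" by (intro mult_right_mono) auto
    then show ?thesis using n by simp
  qed
  then show "\<bar>chart i x\<bar> \<le> inverse (norm x)"
    unfolding c(1) using chart_denominator_pos[of x] \<open>x \<noteq> 0\<close> by (simp add: field_simps)
qed

lemma chart_tendsto_0:
  assumes "i \<in> chart_index"
  shows "(chart i \<longlongrightarrow> 0) at_infinity"
proof (rule Lim_null_comparison)
  show "((\<lambda>x. inverse (norm x)) \<longlongrightarrow> 0) at_infinity"
    by (rule tendsto_inverse_0_at_top[OF filterlim_norm_at_top])
  show "\<forall>\<^sub>F x in at_infinity. norm (chart i x) \<le> inverse (norm x)"
    unfolding eventually_at_infinity real_norm_def
  proof (intro exI[of _ 1] allI impI)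
    fix x :: 'a assume "1 \<le> norm x"
    then have "x \<noteq> 0" by auto
    then show "\<bar>chart i x\<bar> \<le> inverse (norm x)" by (rule chart_le_inverse_norm(2)[OF assms])
  qed
qed

lemma chart_recover: "x = (\<Sum>b\<in>Basis. (chart (Some b) x / chart None x) *\<^sub>R b)"
proof -
  have "(c / d) / (1 / d) = c" if "d > 0" for c d :: real using that by simp
  from this[OF chart_denominator_pos] have "chart (Some b) x / chart None x = x \<bullet> b" for b
    unfolding chart.simps inner_commute[of x b] .
  then show ?thesis by (simp only: euclidean_representation)
qed

declare chart.simps [simp del]

lemma chart_determines_state:
  assumes eq: "\<And>i. i \<in> chart_index \<Longrightarrow> zext (chart i) y = zext (chart i) z"
  shows "y = z"
proof (cases y)
  case (Pt x)
  then have "zext (chart None) z > 0" using eq[OF None_chart_index] chart_None_pos[of x] by simp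
  then obtain x' where z: "z = Pt x'" by (cases z) auto
  have "chart i x = chart i x'" if "i \<in> chart_index" for i using eq[OF that] Pt z by simp
  then have "x = x'" using chart_recover[of x] chart_recover[of x'] None_chart_index Some_chart_index
    by (metis (no_types, lifting) sum.cong)
  then show ?thesis using Pt z by simp
next
  case Cemetery
  then have "zext (chart None) z = 0" using eq[OF None_chart_index] by simp
  have "z = Cemetery"
  proof (cases z)
    case (Pt u)
    then show ?thesis using \<open>zext (chart None) z = 0\<close> chart_None_pos[of u] by simp
  qed
  then show ?thesis using Cemetery by simp
qed

text \<open>A positive limit of \<open>chart None\<close> keeps the state bounded, and the other coordinates locate the limit.\<close>

lemma chart_limit_finite:
  fixes y :: "real \<Rightarrow> 'v::euclidean_space state"
  assumes "closed D" "\<F> \<noteq> bot" and state: "\<forall>\<^sub>F s in \<F>. y s \<in> cem D"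
    and lim: "\<And>i. i \<in> chart_index \<Longrightarrow> ((\<lambda>s. zext (chart i) (y s)) \<longlongrightarrow> L i) \<F>" and pos: "L None > 0"
  shows "\<exists>x\<in>D. (\<forall>\<^sub>F s in \<F>. y s \<in> Pt ` D) \<and> ((\<lambda>s. unPt (y s)) \<longlongrightarrow> x) \<F> \<and> (\<forall>i\<in>chart_index. L i = chart i x)"
proof -
  define x where "x = (\<Sum>b\<in>Basis. (L (Some b) / L None) *\<^sub>R b)"
  have "\<forall>\<^sub>F s in \<F>. zext (chart None) (y s) > 0"
    by (rule order_tendstoD(1)[OF lim[OF None_chart_index] pos])
  with state have fin: "\<forall>\<^sub>F s in \<F>. y s \<in> Pt ` D"
  proof eventually_elim
    case (elim s)
    then show ?case by (cases "y s") (auto simp: cem_def)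
  qed
  have "((\<lambda>s. \<Sum>b\<in>Basis. (zext (chart (Some b)) (y s) / zext (chart None) (y s)) *\<^sub>R b) \<longlongrightarrow> x) \<F>"
    unfolding x_def using pos by (intro tendsto_intros lim None_chart_index Some_chart_index) auto
  moreover have "\<forall>\<^sub>F s in \<F>. (\<Sum>b\<in>Basis. (zext (chart (Some b)) (y s) / zext (chart None) (y s)) *\<^sub>R b) = unPt (y s)"
    using fin
  proof eventually_elim
    case (elim s)
    then obtain u where "y s = Pt u" by auto
    then show ?case using chart_recover[of u] by simp
  qed
  ultimately have conv: "((\<lambda>s. unPt (y s)) \<longlongrightarrow> x) \<F>" by (rule Lim_transform_eventually)
  have "\<forall>\<^sub>F s in \<F>. unPt (y s) \<in> D" using fin by eventually_elim auto
  then have x: "x \<in> D" by (rule Lim_in_closed_set[OF assms(1) _ assms(2) conv])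
  have "L i = chart i x" if "i \<in> chart_index" for i
  proof (rule tendsto_unique[OF assms(2)])
    show "((\<lambda>s. zext (chart i) (y s)) \<longlongrightarrow> L i) \<F>" by (rule lim[OF that])
    have "isCont (chart i) x" using chart_cont[of i] by (simp add: continuous_on_eq_continuous_at)
    then have "((\<lambda>s. chart i (unPt (y s))) \<longlongrightarrow> chart i x) \<F>" using conv by (rule isCont_tendsto_compose)
    moreover have "\<forall>\<^sub>F s in \<F>. chart i (unPt (y s)) = zext (chart i) (y s)"
      using fin by eventually_elim auto
    ultimately show "((\<lambda>s. zext (chart i) (y s)) \<longlongrightarrow> chart i x) \<F>" by (rule Lim_transform_eventually)
  qed
  with x fin conv show ?thesis by blast
qed

lemma limitin_cem_finite:
  fixes y :: "real \<Rightarrow> 'v::euclidean_space state"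
  assumes "x \<in> D" "\<forall>\<^sub>F s in \<F>. y s \<in> Pt ` D" "((\<lambda>s. unPt (y s)) \<longlongrightarrow> x) \<F>"
  shows "limitin (cem_topology D) y (Pt x) \<F>"
  unfolding limitin_def
proof (intro conjI allI impI)
  show "Pt x \<in> topspace (cem_topology D)" using assms(1) by (simp add: topspace_cem_topology cem_def)
  fix U assume "openin (cem_topology D) U \<and> Pt x \<in> U"
  then obtain V where V: "open V" "Pt -` U = D \<inter> V" "x \<in> V"
    by (auto simp: openin_cem_topology openin_open)
  have "\<forall>\<^sub>F s in \<F>. unPt (y s) \<in> V" by (rule topological_tendstoD[OF assms(3) V(1,3)])
  with assms(2) show "\<forall>\<^sub>F s in \<F>. y s \<in> U"
  proof eventually_elim
    case (elim s)
    then obtain u where "y s = Pt u" "u \<in> D \<inter> V" by auto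
    then have "u \<in> Pt -` U" unfolding V(2) by simp
    then show ?case using \<open>y s = Pt u\<close> by simp
  qed
qed

lemma limitin_cem_Cemetery:
  assumes "\<forall>\<^sub>F s in \<F>. y s = Cemetery"
  shows "limitin (cem_topology D) y Cemetery \<F>"
  unfolding limitin_def
proof (intro conjI allI impI)
  fix U assume "openin (cem_topology D) U \<and> Cemetery \<in> U"
  with assms show "\<forall>\<^sub>F s in \<F>. y s \<in> U" by (auto elim: eventually_mono)
qed (simp add: topspace_cem_topology cem_def)

lemma limitin_Alexandroff_Some:
  assumes "limitin T y l \<F>"
  shows "limitin (Alexandroff_compactification T) (\<lambda>s. Some (y s)) (Some l) \<F>"
  unfolding limitin_def
proof (intro conjI allI impI)
  have l: "l \<in> topspace T" using assms by (simp add: limitin_def)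
  then show "Some l \<in> topspace (Alexandroff_compactification T)" by simp
  fix U assume U: "openin (Alexandroff_compactification T) U \<and> Some l \<in> U"
  then have "openin T {x \<in> topspace T. Some x \<in> U}"
    using openin_continuous_map_preimage[OF continuous_map_Some] by blast
  with assms l U have "\<forall>\<^sub>F s in \<F>. y s \<in> {x \<in> topspace T. Some x \<in> U}"
    unfolding limitin_def by blast
  then show "\<forall>\<^sub>F s in \<F>. Some (y s) \<in> U" by (auto elim: eventually_mono)
qed

text \<open>Balls, together with the isolated cemetery, form an open cover of the augmented space.\<close>

lemma compactin_cem_bounded:
  fixes D :: "'v::euclidean_space set"
  assumes "compactin (cem_topology D) C"
  shows "bounded (Pt -` C)"
proof -
  let ?U = "\<lambda>n::nat. insert Cemetery (Pt ` (D \<inter> ball 0 (real n)))"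
  have vim: "Pt -` ?U n = D \<inter> ball 0 (real n)" for n by auto
  have open_U: "openin (cem_topology D) (?U n)" for n
    unfolding openin_cem_topology vim by (auto simp: cem_def openin_open_Int)
  have C: "C \<subseteq> cem D" using compactin_subset_topspace[OF assms] by (simp add: topspace_cem_topology)
  have cover: "C \<subseteq> \<Union> (range ?U)"
  proof
    fix y assume "y \<in> C"
    with C have "y \<in> cem D" by blast
    then show "y \<in> \<Union> (range ?U)"
    proof (rule cem_cases)
      fix x assume x: "x \<in> D" "y = Pt x"
      obtain n :: nat where "norm x < real n" using reals_Archimedean2 by blast
      then show ?thesis using x by (auto intro!: exI[of _ n])
    qed auto
  qed
  obtain \<G> where G: "finite \<G>" "\<G> \<subseteq> range ?U" "C \<subseteq> \<Union> \<G>"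
    using assms cover open_U unfolding compactin_def by (metis (no_types, lifting) imageE)
  obtain I where I: "finite I" "\<G> = ?U ` I" using finite_subset_image[OF G(1,2)] by blast
  have "Pt -` C \<subseteq> (\<Union>n\<in>I. ball 0 (real n))" 
  proof
    fix x assume "x \<in> Pt -` C"
    then obtain n where "n \<in> I" "Pt x \<in> ?U n" using G(3) I(2) by blast
    then show "x \<in> (\<Union>n\<in>I. ball 0 (real n))" by auto
  qed
  moreover have "bounded (\<Union>n\<in>I. ball (0::'v) (real n))" using I(1) by (intro bounded_UN) auto
  ultimately show ?thesis by (rule bounded_subset[rotated])
qed

lemma limitin_Alexandroff_infinity:
  fixes y :: "real \<Rightarrow> 'v::euclidean_space state"
  assumes fin: "\<forall>\<^sub>F s in \<F>. y s \<in> Pt ` D" and zero: "((\<lambda>s. zext (chart None) (y s)) \<longlongrightarrow> 0) \<F>"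
  shows "limitin (Alexandroff_compactification (cem_topology D)) (\<lambda>s. Some (y s)) None \<F>"
  unfolding limitin_def
proof (intro conjI allI impI)
  fix U assume U: "openin (Alexandroff_compactification (cem_topology D)) U \<and> None \<in> U"
  then obtain C where C: "compactin (cem_topology D) C" "U = insert None (Some ` (topspace (cem_topology D) - C))"
    by (auto simp: openin_Alexandroff_compactification)
  obtain r where r: "\<And>x. x \<in> Pt -` C \<Longrightarrow> norm x \<le> r"
    using compactin_cem_bounded[OF C(1)] unfolding bounded_iff by blast
  have "1 / (1 + r\<^sup>2) > 0" by (simp add: add_pos_nonneg)
  then have "\<forall>\<^sub>F s in \<F>. zext (chart None) (y s) < 1 / (1 + r\<^sup>2)"
    by (rule order_tendstoD(2)[OF zero])
  with fin show "\<forall>\<^sub>F s in \<F>. Some (y s) \<in> U"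
  proof eventually_elim
    case (elim s)
    then obtain u where u: "y s = Pt u" "u \<in> D" by auto
    have "Pt u \<notin> C"
    proof
      assume "Pt u \<in> C"
      then have "norm u \<le> r" using r by simp
      then have "(norm u)\<^sup>2 \<le> r\<^sup>2" by (intro power_mono) auto
      then have "1 / (1 + r\<^sup>2) \<le> 1 / (1 + (norm u)\<^sup>2)" by (intro divide_left_mono) (auto simp: add_pos_nonneg)
      then show False using elim u by (simp add: chart.simps)
    qed
    then show ?case using u C(2) by (simp add: topspace_cem_topology cem_def)
  qed
qed simp

section \<open>Regularization of Feller processes\<close>

lemma markov_processD:
  assumes "markov_process D \<Omega> P F X p"
  shows "transition_function D p"
    and "\<And>s \<omega>. s \<ge> 0 \<Longrightarrow> \<omega> \<in> \<Omega> \<Longrightarrow> X s \<omega> \<in> cem D"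
    and "\<And>s t \<omega>. s \<ge> 0 \<Longrightarrow> t \<ge> s \<Longrightarrow> \<omega> \<in> \<Omega> \<Longrightarrow> X s \<omega> = Cemetery \<Longrightarrow> X t \<omega> = Cemetery"
    and "\<And>x. x \<in> cem D \<Longrightarrow> prob_space (P x)"
    and "\<And>x. x \<in> cem D \<Longrightarrow> space (P x) = \<Omega>"
    and "\<And>x t. x \<in> cem D \<Longrightarrow> t \<ge> 0 \<Longrightarrow> subalgebra (P x) (F x t)"
    and "\<And>x s t. x \<in> cem D \<Longrightarrow> s \<ge> 0 \<Longrightarrow> t \<ge> s \<Longrightarrow> sets (F x s) \<subseteq> sets (F x t)"
    and "\<And>x t. x \<in> cem D \<Longrightarrow> t \<ge> 0 \<Longrightarrow> X t \<in> measurable (F x t) (cem_algebra D)"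
    and "\<And>x s t f. x \<in> cem D \<Longrightarrow> s \<ge> 0 \<Longrightarrow> t \<ge> 0 \<Longrightarrow> f \<in> borel_measurable (cem_algebra D) \<Longrightarrow> bounded (f ` cem D) \<Longrightarrow>
        f Cemetery = (0::real) \<Longrightarrow>
        AE \<omega> in P x. real_cond_exp (P x) (F x s) (\<lambda>\<omega>'. f (X (t + s) \<omega>')) \<omega> = (\<integral>\<omega>'. f (X t \<omega>') \<partial>(P (X s \<omega>))) \<and>
              (\<integral>\<omega>'. f (X t \<omega>') \<partial>(P (X s \<omega>))) = set_lebesgue_integral (p t (X s \<omega>)) (Pt ` D) f"
proof -
  note all = assms[unfolded markov_process_def]
  note rest = conjunct2[OF all]
  show "transition_function D p" by (rule conjunct1[OF all])
  show "X s \<omega> \<in> cem D" if "s \<ge> 0" "\<omega> \<in> \<Omega>" for s \<omega>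
    using conjunct1[OF rest] that by simp
  show "X t \<omega> = Cemetery" if "s \<ge> 0" "t \<ge> s" "\<omega> \<in> \<Omega>" "X s \<omega> = Cemetery" for s t \<omega>
    using conjunct1[OF conjunct2[OF rest], rule_format, OF that] .
  fix x assume x: "x \<in> cem D"
  note y = conjunct2[OF conjunct2[OF rest], THEN bspec, OF x]
  note y1 = conjunct1[OF y] and y2 = conjunct2[OF y]
  note z1 = conjunct1[OF y2] and z2 = conjunct2[OF y2]
  note w1 = conjunct1[OF z2] and w2 = conjunct2[OF z2]
  note v1 = conjunct1[OF w2] and v2 = conjunct2[OF w2]
  note u1 = conjunct1[OF v2] and u2 = conjunct2[OF v2]
  show "prob_space (P x)" "space (P x) = \<Omega>" by (rule y1, rule z1)
  show "subalgebra (P x) (F x t)" if "t \<ge> 0" for t by (rule w1[rule_format, OF that])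
  show "sets (F x s) \<subseteq> sets (F x t)" if "s \<ge> 0" "t \<ge> s" for s t by (rule v1[rule_format, OF that])
  show "X t \<in> measurable (F x t) (cem_algebra D)" if "t \<ge> 0" for t by (rule u1[rule_format, OF that])
  show "AE \<omega> in P x. real_cond_exp (P x) (F x s) (\<lambda>\<omega>'. f (X (t + s) \<omega>')) \<omega> = (\<integral>\<omega>'. f (X t \<omega>') \<partial>(P (X s \<omega>))) \<and>
              (\<integral>\<omega>'. f (X t \<omega>') \<partial>(P (X s \<omega>))) = set_lebesgue_integral (p t (X s \<omega>)) (Pt ` D) f"
    if "s \<ge> 0" "t \<ge> 0" "f \<in> borel_measurable (cem_algebra D)" "bounded (f ` cem D)" "f Cemetery = (0::real)" for s t f
    by (rule u2[rule_format, OF that])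
qed

text \<open>A Markov process whose transition operators are, for small times, strongly continuous on the continuous
functions vanishing at infinity and map these functions to functions vanishing at infinity, uniformly in
time. This is what the construction of a regular version uses.\<close>

locale feller_markov_process =
  fixes D :: "'v::euclidean_space set" and \<Omega> :: "'w set" and P :: "'v state \<Rightarrow> 'w measure"
    and X :: "real \<Rightarrow> 'w \<Rightarrow> 'v state" and p :: "real \<Rightarrow> 'v state \<Rightarrow> 'v state measure"
  assumes closed_D: "closed D"
    and markov: "markov_process D \<Omega> P (\<lambda>x. nat_filt D \<Omega> X) X p"
    and strongly_continuous: "\<And>h B e. continuous_on UNIV h \<Longrightarrow> (\<And>x. \<bar>h x\<bar> \<le> B) \<Longrightarrow> (h \<longlongrightarrow> (0::real)) at_infinity \<Longrightarrow> e > 0 \<Longrightarrow>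
        \<exists>\<delta>>0. \<forall>s\<in>{0..\<delta>}. \<forall>x\<in>D. \<bar>set_lebesgue_integral (p s (Pt x)) (Pt ` D) (zext h) - h x\<bar> \<le> e"
    and vanishing: "\<exists>\<delta>>0. \<forall>h B. continuous_on UNIV h \<longrightarrow> (\<forall>x. \<bar>h x\<bar> \<le> B) \<longrightarrow> (h \<longlongrightarrow> (0::real)) at_infinity \<longrightarrow>
        (\<forall>e>0. \<exists>M. \<forall>s\<in>{0..\<delta>}. \<forall>x\<in>D. norm x \<ge> M \<longrightarrow> \<bar>set_lebesgue_integral (p s (Pt x)) (Pt ` D) (zext h)\<bar> \<le> e)"

sublocale feller_markov_process \<subseteq> state_kernel D p
  using closed_D markov_processD(1)[OF markov] by (rule state_kernel.intro)

context feller_markov_process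
begin

definition trans :: "real \<Rightarrow> ('v state \<Rightarrow> real) \<Rightarrow> 'v state \<Rightarrow> real" where
  "trans s f y = (if s \<ge> 0 \<and> y \<in> cem D then set_lebesgue_integral (p s y) (Pt ` D) f else 0)"

lemmas X_state = markov_processD(2)[OF markov]
  and X_absorbed = markov_processD(3)[OF markov]
  and P_prob = markov_processD(4)[OF markov]
  and P_space = markov_processD(5)[OF markov]
  and F_subalgebra = markov_processD(6)[OF markov]
  and F_mono = markov_processD(7)[OF markov]
  and X_measurable = markov_processD(8)[OF markov]

abbreviation "\<F> \<equiv> nat_filt D \<Omega> X"

lemma X_measurable_P: "x \<in> cem D \<Longrightarrow> t \<ge> 0 \<Longrightarrow> X t \<in> measurable (P x) (cem_algebra D)"
  using measurable_from_subalg[OF F_subalgebra X_measurable] by blast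

lemma trans_eq_integral:
  assumes "s \<ge> 0" "y \<in> cem D" "f Cemetery = 0"
  shows "trans s f y = integral\<^sup>L (p s y) f"
proof -
  have "indicator (Pt ` D) z *\<^sub>R f z = f z" if "z \<in> cem D" for z
    using that assms(3) by (auto simp: cem_def indicator_def)
  then show ?thesis
    using assms unfolding trans_def set_lebesgue_integral_def
    by (auto intro!: Bochner_Integration.integral_cong simp: space_p)
qed

lemma trans_measurable:
  assumes "s \<ge> 0" "f \<in> borel_measurable (cem_algebra D)" "f Cemetery = 0"
  shows "trans s f \<in> borel_measurable (cem_algebra D)"
proof -
  have "p s \<in> measurable (cem_algebra D) (subprob_algebra (cem_algebra D))"
  proof (rule measurable_subprob_algebra)
    fix y assume "y \<in> space (cem_algebra D)"
    then have y: "y \<in> cem D" by (simp add: space_cem)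
    show "subprob_space (p s y)" using prob_p[OF assms(1) y] by (rule prob_space_imp_subprob_space)
    show "sets (p s y) = sets (cem_algebra D)" by (rule sets_p[OF assms(1) y])
  next
    fix A assume "A \<in> sets (cem_algebra D)"
    then show "(\<lambda>y. emeasure (p s y) A) \<in> borel_measurable (cem_algebra D)"
      by (rule transition_functionD(6)[OF transition assms(1)])
  qed
  moreover have "(\<lambda>M. integral\<^sup>L M f) \<in> borel_measurable (subprob_algebra (cem_algebra D))"
    by (rule integral_measurable_subprob_algebra[OF assms(2)])
  ultimately have "(\<lambda>y. integral\<^sup>L (p s y) f) \<in> borel_measurable (cem_algebra D)"
    by (rule measurable_compose)
  moreover have "(\<lambda>y. integral\<^sup>L (p s y) f) \<in> borel_measurable (cem_algebra D) \<longleftrightarrow> trans s f \<in> borel_measurable (cem_algebra D)"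
    by (rule measurable_cong) (simp add: trans_eq_integral assms space_cem)
  ultimately show ?thesis by simp
qed

lemma trans_bound:
  assumes "f \<in> borel_measurable (cem_algebra D)" "f Cemetery = 0" "\<And>y. \<bar>f y\<bar> \<le> B"
  shows "\<bar>trans s f y\<bar> \<le> B"
proof (cases "s \<ge> 0 \<and> y \<in> cem D")
  case True
  then have sy: "s \<ge> 0" "y \<in> cem D" by auto
  interpret prob_space "p s y" by (rule prob_p[OF sy])
  have "f \<in> borel_measurable (p s y)" using assms(1) by (subst measurable_cong_sets[OF sets_p[OF sy] refl])
  then have int: "integrable (p s y) f" using assms(3) by (intro integrable_const_bound[where B=B]) auto
  have "\<bar>trans s f y\<bar> \<le> (LINT z|p s y. \<bar>f z\<bar>)"
    unfolding trans_eq_integral[where f=f, OF sy assms(2)] by (rule integral_abs_bound)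
  also have "\<dots> \<le> (LINT z|p s y. B)" using int assms(3) by (intro integral_mono) auto
  finally show ?thesis by (simp add: prob_space)
next
  case False
  have "0 \<le> B" using assms(3)[of Cemetery] by linarith
  then show ?thesis using False by (auto simp: trans_def)
qed

lemma trans_nonneg:
  assumes "\<And>y. f y \<ge> 0"
  shows "trans s f y \<ge> 0"
  using assms by (auto simp: trans_def set_lebesgue_integral_def intro!: Bochner_Integration.integral_nonneg)

text \<open>The Markov property in weak form: the conditional expectation is replaced by its defining pairing with
bounded functions of the past.\<close>

lemma markov_projection:
  assumes x: "x \<in> cem D" and st: "s \<ge> 0" "t \<ge> 0"
    and f: "f \<in> borel_measurable (cem_algebra D)" "\<And>y. \<bar>f y\<bar> \<le> B" "f Cemetery = 0"
    and Z: "Z \<in> borel_measurable (\<F> s)" "\<And>\<omega>. \<bar>Z \<omega>\<bar> \<le> K"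
  shows "(LINT \<omega>|P x. f (X (t + s) \<omega>) * Z \<omega>) = (LINT \<omega>|P x. trans t f (X s \<omega>) * Z \<omega>)"
proof -
  interpret prob_space "P x" by (rule P_prob[OF x])
  interpret S: finite_measure_subalgebra "P x" "\<F> s"
    by unfold_locales (use F_subalgebra[OF x st(1)] in auto)
  have fm: "(\<lambda>\<omega>. f (X (t + s) \<omega>)) \<in> borel_measurable (P x)"
    by (rule measurable_compose[OF X_measurable_P[OF x] f(1)]) (use st in auto)
  have ZP: "Z \<in> borel_measurable (P x)" by (rule measurable_from_subalg[OF F_subalgebra[OF x st(1)] Z(1)])
  have BK: "B \<ge> 0" "K \<ge> 0" using f(2)[of Cemetery] Z(2)[of undefined] by linarith+
  have "integrable (P x) (\<lambda>\<omega>. Z \<omega> * f (X (t + s) \<omega>))"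
    using f(2) Z(2) BK by (intro integrable_const_bound[where B="K * B"] borel_measurable_times ZP fm) (auto simp: abs_mult intro!: mult_mono)
  from S.real_cond_exp_intg(2)[OF this Z(1) fm]
  have "(LINT \<omega>|P x. f (X (t + s) \<omega>) * Z \<omega>) = (LINT \<omega>|P x. Z \<omega> * real_cond_exp (P x) (\<F> s) (\<lambda>\<omega>. f (X (t + s) \<omega>)) \<omega>)"
    by (simp add: mult.commute)
  also have "\<dots> = (LINT \<omega>|P x. trans t f (X s \<omega>) * Z \<omega>)"
  proof (rule integral_cong_AE)
    have "bounded (f ` cem D)" using f(2) by (intro boundedI[where B=B]) auto
    from markov_processD(9)[OF markov x st f(1) this f(3)]
    show "AE \<omega> in P x. Z \<omega> * real_cond_exp (P x) (\<F> s) (\<lambda>\<omega>. f (X (t + s) \<omega>)) \<omega> = trans t f (X s \<omega>) * Z \<omega>"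
    proof (rule AE_mp, intro AE_I2 impI)
      fix \<omega> assume "\<omega> \<in> space (P x)"
      then have "X s \<omega> \<in> cem D" using X_state st P_space[OF x] by simp
      moreover assume "real_cond_exp (P x) (\<F> s) (\<lambda>\<omega>'. f (X (t + s) \<omega>')) \<omega> = (\<integral>\<omega>'. f (X t \<omega>') \<partial>(P (X s \<omega>))) \<and>
              (\<integral>\<omega>'. f (X t \<omega>') \<partial>(P (X s \<omega>))) = set_lebesgue_integral (p t (X s \<omega>)) (Pt ` D) f"
      ultimately show "Z \<omega> * real_cond_exp (P x) (\<F> s) (\<lambda>\<omega>. f (X (t + s) \<omega>)) \<omega> = trans t f (X s \<omega>) * Z \<omega>"
        using st by (simp add: trans_def)
    qed
    show "(\<lambda>\<omega>. Z \<omega> * real_cond_exp (P x) (\<F> s) (\<lambda>\<omega>. f (X (t + s) \<omega>)) \<omega>) \<in> borel_measurable (P x)"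
      by (intro borel_measurable_times ZP borel_measurable_cond_exp2)
    show "(\<lambda>\<omega>. trans t f (X s \<omega>) * Z \<omega>) \<in> borel_measurable (P x)"
      by (intro borel_measurable_times ZP measurable_compose[OF X_measurable_P[OF x st(1)] trans_measurable[OF st(2) f(1,3)]])
  qed
  finally show ?thesis .
qed

lemma trans_strongly_continuous:
  assumes h: "continuous_on UNIV h" "\<And>x. \<bar>h x\<bar> \<le> B" "(h \<longlongrightarrow> 0) at_infinity" and e: "e > 0"
  shows "\<exists>\<delta>>0. \<forall>s\<in>{0..\<delta>}. \<forall>y\<in>cem D. \<bar>trans s (zext h) y - zext h y\<bar> \<le> e"
proof -
  obtain \<delta> where \<delta>: "\<delta> > 0" "\<And>s x. s \<in> {0..\<delta>} \<Longrightarrow> x \<in> D \<Longrightarrow> \<bar>set_lebesgue_integral (p s (Pt x)) (Pt ` D) (zext h) - h x\<bar> \<le> e"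
    using strongly_continuous[OF h e] by blast
  have "\<bar>trans s (zext h) y - zext h y\<bar> \<le> e" if s: "s \<in> {0..\<delta>}" and y: "y \<in> cem D" for s y
    using y
  proof (rule cem_cases)
    fix x assume "x \<in> D" "y = Pt x"
    then show ?thesis using \<delta>(2)[OF s] s Pt_in_cem by (simp add: trans_def)
  next
    assume "y = Cemetery"
    then show ?thesis using s e by (simp add: trans_def set_integral_p_zero)
  qed
  with \<delta>(1) show ?thesis by blast
qed

text \<open>A length of time for which starting far out implies staying far out.\<close>

definition vanish_time :: real where
  "vanish_time = (SOME \<delta>. \<delta> > 0 \<and> (\<forall>e>0. \<exists>M. \<forall>s\<in>{0..\<delta>}. \<forall>x\<in>D. norm x \<ge> M \<longrightarrow> trans s (zext (chart None)) (Pt x) \<le> e))"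

lemma vanish_time:
  "vanish_time > 0"
  "e > 0 \<Longrightarrow> \<exists>M. \<forall>s\<in>{0..vanish_time}. \<forall>x\<in>D. norm x \<ge> M \<longrightarrow> trans s (zext (chart None)) (Pt x) \<le> e"
proof -
  obtain \<delta> where \<delta>: "\<delta> > 0" and van: "\<forall>h B. continuous_on UNIV h \<longrightarrow> (\<forall>x. \<bar>h x\<bar> \<le> B) \<longrightarrow> (h \<longlongrightarrow> (0::real)) at_infinity \<longrightarrow>
        (\<forall>e>0. \<exists>M. \<forall>s\<in>{0..\<delta>}. \<forall>x\<in>D. norm x \<ge> M \<longrightarrow> \<bar>set_lebesgue_integral (p s (Pt x)) (Pt ` D) (zext h)\<bar> \<le> e)"
    using vanishing by blast
  have "\<exists>M. \<forall>s\<in>{0..\<delta>}. \<forall>x\<in>D. norm x \<ge> M \<longrightarrow> trans s (zext (chart None)) (Pt x) \<le> e" if e: "e > 0" for e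
  proof -
    obtain M where M: "\<And>s x. s \<in> {0..\<delta>} \<Longrightarrow> x \<in> D \<Longrightarrow> norm x \<ge> M \<Longrightarrow> \<bar>set_lebesgue_integral (p s (Pt x)) (Pt ` D) (zext (chart None))\<bar> \<le> e"
      using van[rule_format, OF chart_cont chart_le_inverse_norm(1)[OF None_chart_index] chart_tendsto_0[OF None_chart_index] e] by blast
    have "trans s (zext (chart None)) (Pt x) \<le> e" if "s \<in> {0..\<delta>}" "x \<in> D" "norm x \<ge> M" for s x
      using M[OF that] that Pt_in_cem by (simp add: trans_def)
    then show ?thesis by blast
  qed
  with \<delta> have "\<exists>\<delta>. \<delta> > 0 \<and> (\<forall>e>0. \<exists>M. \<forall>s\<in>{0..\<delta>}. \<forall>x\<in>D. norm x \<ge> M \<longrightarrow> trans s (zext (chart None)) (Pt x) \<le> e)" by blast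
  note * = someI_ex[OF this, folded vanish_time_def]
  show "vanish_time > 0" by (rule conjunct1[OF *])
  show "\<exists>M. \<forall>s\<in>{0..vanish_time}. \<forall>x\<in>D. norm x \<ge> M \<longrightarrow> trans s (zext (chart None)) (Pt x) \<le> e" if "e > 0"
    using conjunct2[OF *] that by simp
qed

lemma chart_state_measurable: "zext (chart i) \<in> borel_measurable (cem_algebra D)"
  by (rule zext_measurable[OF closed_D borel_measurable_continuous_onI[OF chart_cont]])

lemma chart_state_bound: "i \<in> chart_index \<Longrightarrow> \<bar>zext (chart i) y\<bar> \<le> 1"
  by (cases y) (auto simp: chart_le_inverse_norm(1))

lemma chart_state_nonneg: "zext (chart None) y \<ge> 0"
  by (cases y) (auto simp: less_imp_le[OF chart_None_pos])

text \<open>The conditional expectations of \<open>chart i\<close> at the time \<open>T\<close> form a martingale, and by strong continuity it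
is uniformly close to \<open>chart i\<close> along the path at times shortly before \<open>T\<close>.\<close>

lemma martingale:
  assumes x: "x \<in> cem D" and T: "T > 0" "T \<in> \<rat>" and i: "i \<in> chart_index"
  shows "closed_martingale_process (P x) \<F> (\<lambda>q \<omega>. trans (T - q) (zext (chart i)) (X q \<omega>)) (\<lambda>\<omega>. zext (chart i) (X T \<omega>)) 1 T"
proof -
  interpret prob_space "P x" by (rule P_prob[OF x])
  show ?thesis
  proof
    show "subalgebra (P x) (\<F> t)" if "t \<ge> 0" for t by (rule F_subalgebra[OF x that])
    show "sets (\<F> s) \<subseteq> sets (\<F> t)" if "0 \<le> s" "s \<le> t" for s t by (rule F_mono[OF x that])
    show "(\<lambda>\<omega>. trans (T - q) (zext (chart i)) (X q \<omega>)) \<in> borel_measurable (\<F> q)" if "0 \<le> q" "q \<le> T" for q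
      using that by (intro measurable_compose[OF X_measurable[OF x] trans_measurable] chart_state_measurable) auto
    show "\<bar>trans (T - q) (zext (chart i)) (X q \<omega>)\<bar> \<le> 1" for q \<omega>
      by (rule trans_bound[OF chart_state_measurable _ chart_state_bound[OF i]]) simp
    show "(\<lambda>\<omega>. zext (chart i) (X T \<omega>)) \<in> borel_measurable (P x)"
      using T by (intro measurable_compose[OF X_measurable_P[OF x] chart_state_measurable]) auto
    show "(LINT \<omega>|P x. zext (chart i) (X T \<omega>) * Z \<omega>) = (LINT \<omega>|P x. trans (T - q) (zext (chart i)) (X q \<omega>) * Z \<omega>)"
      if "0 \<le> q" "q \<le> T" "Z \<in> borel_measurable (\<F> q)" "\<And>\<omega>. \<bar>Z \<omega>\<bar> \<le> K" for q Z K
      using markov_projection[OF x that(1) _ chart_state_measurable chart_state_bound[OF i] _ that(3,4), of "T - q"] that(2) by simp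
  qed (use T chart_state_bound[OF i] in auto)
qed

end

context feller_markov_process
begin

text \<open>The paths for which the two almost sure properties of the martingales hold at once for all rational \<open>T\<close>
and all coordinates. The condition does not mention the initial state, so one process serves all of them.\<close>

definition regular :: "'w \<Rightarrow> bool" where
  "regular \<omega> \<longleftrightarrow> (\<forall>T\<in>\<rat>. T > 0 \<longrightarrow>
     (\<forall>i\<in>chart_index. \<forall>\<epsilon>>0. \<exists>m. \<not> oscillates (\<lambda>q. trans (T - q) (zext (chart i)) (X q \<omega>)) \<epsilon> {q \<in> \<rat>. 0 \<le> q \<and> q \<le> T} m 0) \<and>
     (zext (chart None) (X T \<omega>) > 0 \<longrightarrow>
        (\<exists>c>0. \<forall>q\<in>{q \<in> \<rat>. 0 \<le> q \<and> q \<le> T}. trans (T - q) (zext (chart None)) (X q \<omega>) \<ge> c)))"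

lemma AE_regular:
  assumes x: "x \<in> cem D"
  shows "AE \<omega> in P x. regular \<omega>"
proof -
  have osc: "AE \<omega> in P x. \<forall>\<epsilon>>0. \<exists>m. \<not> oscillates (\<lambda>q. trans (T - q) (zext (chart i)) (X q \<omega>)) \<epsilon> {q \<in> \<rat>. 0 \<le> q \<and> q \<le> T} m 0"
    if "T \<in> \<rat>" "T > 0" "i \<in> chart_index" for T i
  proof -
    interpret N: closed_martingale_process "P x" \<F> "\<lambda>q \<omega>. trans (T - q) (zext (chart i)) (X q \<omega>)" "\<lambda>\<omega>. zext (chart i) (X T \<omega>)" 1 T
      by (rule martingale[OF x that(2,1,3)])
    show ?thesis using N.finite_oscillation unfolding N.rationals_def .
  qed
  have pos: "AE \<omega> in P x. zext (chart None) (X T \<omega>) > 0 \<longrightarrow>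
        (\<exists>c>0. \<forall>q\<in>{q \<in> \<rat>. 0 \<le> q \<and> q \<le> T}. trans (T - q) (zext (chart None)) (X q \<omega>) \<ge> c)"
    if "T \<in> \<rat>" "T > 0" for T
  proof -
    interpret N: closed_martingale_process "P x" \<F> "\<lambda>q \<omega>. trans (T - q) (zext (chart None)) (X q \<omega>)" "\<lambda>\<omega>. zext (chart None) (X T \<omega>)" 1 T
      by (rule martingale[OF x that(2,1) None_chart_index])
    show ?thesis
      using N.positive_terminal_value_bounded_below[OF trans_nonneg[OF chart_state_nonneg] chart_state_nonneg]
      unfolding N.rationals_def .
  qed
  have "AE \<omega> in P x. \<forall>T\<in>{T \<in> \<rat>. T > 0}.
     (\<forall>i\<in>chart_index. \<forall>\<epsilon>>0. \<exists>m. \<not> oscillates (\<lambda>q. trans (T - q) (zext (chart i)) (X q \<omega>)) \<epsilon> {q \<in> \<rat>. 0 \<le> q \<and> q \<le> T} m 0) \<and>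
     (zext (chart None) (X T \<omega>) > 0 \<longrightarrow>
        (\<exists>c>0. \<forall>q\<in>{q \<in> \<rat>. 0 \<le> q \<and> q \<le> T}. trans (T - q) (zext (chart None)) (X q \<omega>) \<ge> c))"
  proof (subst AE_ball_countable)
    show "countable {T \<in> \<rat>. T > (0::real)}" by (rule countable_subset[OF _ countable_rat]) auto
    show "\<forall>T\<in>{T \<in> \<rat>. T > 0}. AE \<omega> in P x.
     (\<forall>i\<in>chart_index. \<forall>\<epsilon>>0. \<exists>m. \<not> oscillates (\<lambda>q. trans (T - q) (zext (chart i)) (X q \<omega>)) \<epsilon> {q \<in> \<rat>. 0 \<le> q \<and> q \<le> T} m 0) \<and>
     (zext (chart None) (X T \<omega>) > 0 \<longrightarrow>
        (\<exists>c>0. \<forall>q\<in>{q \<in> \<rat>. 0 \<le> q \<and> q \<le> T}. trans (T - q) (zext (chart None)) (X q \<omega>) \<ge> c))"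
    proof (rule ballI, rule AE_conjI)
      fix T assume T: "T \<in> {T \<in> \<rat>. T > (0::real)}"
      show "AE \<omega> in P x. \<forall>i\<in>chart_index. \<forall>\<epsilon>>0. \<exists>m. \<not> oscillates (\<lambda>q. trans (T - q) (zext (chart i)) (X q \<omega>)) \<epsilon> {q \<in> \<rat>. 0 \<le> q \<and> q \<le> T} m 0"
        by (subst AE_ball_countable[OF countable_finite[OF chart_index_finite]]) (use osc T in blast)
      show "AE \<omega> in P x. zext (chart None) (X T \<omega>) > 0 \<longrightarrow>
        (\<exists>c>0. \<forall>q\<in>{q \<in> \<rat>. 0 \<le> q \<and> q \<le> T}. trans (T - q) (zext (chart None)) (X q \<omega>) \<ge> c)"
        using pos T by blast
    qed
  qed
  then show ?thesis
    by (rule AE_mp) (intro AE_I2 impI, unfold regular_def, blast)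
qed

lemma chart_close_to_martingale:
  assumes "i \<in> chart_index" "e > 0"
  shows "\<exists>\<delta>>0. \<forall>s\<in>{0..\<delta>}. \<forall>y\<in>cem D. \<bar>trans s (zext (chart i)) y - zext (chart i) y\<bar> \<le> e"
  by (rule trans_strongly_continuous[OF chart_cont chart_le_inverse_norm(1)[OF assms(1)] chart_tendsto_0[OF assms(1)] assms(2)])

text \<open>Shortly after \<open>t\<close> the path is compared with the martingale for a time \<open>T\<close> slightly larger than \<open>t\<close>, which
oscillates only finitely often.\<close>

lemma regular_right_limit:
  assumes reg: "regular \<omega>" and \<omega>: "\<omega> \<in> \<Omega>" and t: "t \<ge> 0" and i: "i \<in> chart_index"
  shows "\<exists>l. ((\<lambda>q. zext (chart i) (X q \<omega>)) \<longlongrightarrow> l) (at_right_rat t)"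
proof (rule limit_of_cauchy_within[OF islimpt_rat_right])
  fix \<epsilon> :: real assume \<epsilon>: "\<epsilon> > 0"
  let ?h = "zext (chart i)"
  obtain \<delta> where \<delta>: "\<delta> > 0" "\<And>s y. s \<in> {0..\<delta>} \<Longrightarrow> y \<in> cem D \<Longrightarrow> \<bar>trans s ?h y - ?h y\<bar> \<le> \<epsilon> / 4"
    using chart_close_to_martingale[OF i, of "\<epsilon> / 4"] \<epsilon> by auto
  obtain T where T: "T \<in> \<rat>" "t < T" "T < t + \<delta>" using Rats_dense_in_real[of t "t + \<delta>"] \<delta>(1) by auto
  let ?N = "\<lambda>q. trans (T - q) ?h (X q \<omega>)"
  have "T > 0" using T t by simp
  then obtain m where m: "\<not> oscillates ?N (\<epsilon> / 4) {q \<in> \<rat>. 0 \<le> q \<and> q \<le> T} m 0"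
    using reg[unfolded regular_def, rule_format, OF T(1)] i \<epsilon> by (meson divide_pos_pos zero_less_numeral)
  obtain \<eta> where \<eta>: "\<eta> > 0" "\<And>u v. u \<in> {q \<in> \<rat>. 0 \<le> q \<and> q \<le> T} \<inter> {t<..<t + \<eta>} \<Longrightarrow> v \<in> {q \<in> \<rat>. 0 \<le> q \<and> q \<le> T} \<inter> {t<..<t + \<eta>} \<Longrightarrow> \<bar>?N u - ?N v\<bar> < \<epsilon> / 4"
    using oscillates_cauchy_right[OF m t] \<epsilon> by auto
  define \<eta>' where "\<eta>' = min \<eta> (T - t)"
  have \<eta>': "\<eta>' > 0" "\<eta>' \<le> \<eta>" "\<eta>' \<le> T - t" using \<eta> T by (auto simp: \<eta>'_def)
  have near: "\<bar>?N u - ?h (X u \<omega>)\<bar> \<le> \<epsilon> / 4" if "t < u" "u < t + \<eta>'" for u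
    using that \<eta>' T t by (intro \<delta>(2) X_state \<omega>) auto
  have "\<bar>?h (X u \<omega>) - ?h (X v \<omega>)\<bar> < \<epsilon>" if "u \<in> \<rat>" "v \<in> \<rat>" "t < u" "u < t + \<eta>'" "t < v" "v < t + \<eta>'" for u v
  proof -
    have "\<bar>?N u - ?N v\<bar> < \<epsilon> / 4" using that \<eta>' t by (intro \<eta>(2)) auto
    then show ?thesis using near[of u] near[of v] that \<epsilon> by linarith
  qed
  then show "\<exists>\<eta>>0. \<forall>u\<in>\<rat> \<inter> {t<..}. \<forall>v\<in>\<rat> \<inter> {t<..}. dist u t < \<eta> \<longrightarrow> dist v t < \<eta> \<longrightarrow> u \<noteq> t \<longrightarrow> v \<noteq> t \<longrightarrow> \<bar>?h (X u \<omega>) - ?h (X v \<omega>)\<bar> < \<epsilon>"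
    using \<eta>'(1) by (intro exI[of _ \<eta>']) (auto simp: dist_real_def)
qed

lemma regular_left_limit:
  assumes reg: "regular \<omega>" and \<omega>: "\<omega> \<in> \<Omega>" and t: "t > 0" and i: "i \<in> chart_index"
  shows "\<exists>l. ((\<lambda>q. zext (chart i) (X q \<omega>)) \<longlongrightarrow> l) (at_left_rat t)"
proof (rule limit_of_cauchy_within[OF islimpt_rat_left[OF t]])
  fix \<epsilon> :: real assume \<epsilon>: "\<epsilon> > 0"
  let ?h = "zext (chart i)"
  obtain \<delta> where \<delta>: "\<delta> > 0" "\<And>s y. s \<in> {0..\<delta>} \<Longrightarrow> y \<in> cem D \<Longrightarrow> \<bar>trans s ?h y - ?h y\<bar> \<le> \<epsilon> / 4"
    using chart_close_to_martingale[OF i, of "\<epsilon> / 4"] \<epsilon> by auto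
  obtain T where T: "T \<in> \<rat>" "t < T" "T < t + \<delta> / 2" using Rats_dense_in_real[of t "t + \<delta> / 2"] \<delta>(1) by auto
  let ?N = "\<lambda>q. trans (T - q) ?h (X q \<omega>)"
  have "T > 0" using T t by simp
  then obtain m where m: "\<not> oscillates ?N (\<epsilon> / 4) {q \<in> \<rat>. 0 \<le> q \<and> q \<le> T} m 0"
    using reg[unfolded regular_def, rule_format, OF T(1)] i \<epsilon> by (meson divide_pos_pos zero_less_numeral)
  obtain \<eta> where \<eta>: "\<eta> > 0" "\<And>u v. u \<in> {q \<in> \<rat>. 0 \<le> q \<and> q \<le> T} \<inter> {t - \<eta><..<t} \<Longrightarrow> v \<in> {q \<in> \<rat>. 0 \<le> q \<and> q \<le> T} \<inter> {t - \<eta><..<t} \<Longrightarrow> \<bar>?N u - ?N v\<bar> < \<epsilon> / 4"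
    using oscillates_cauchy_left[OF m t] \<epsilon> by auto
  define \<eta>' where "\<eta>' = min \<eta> (\<delta> / 2)"
  have \<eta>': "\<eta>' > 0" "\<eta>' \<le> \<eta>" "\<eta>' \<le> \<delta> / 2" using \<eta> \<delta> by (auto simp: \<eta>'_def)
  have near: "\<bar>?N u - ?h (X u \<omega>)\<bar> \<le> \<epsilon> / 4" if "0 \<le> u" "t - \<eta>' < u" "u < t" for u
    using that \<eta>' T t by (intro \<delta>(2) X_state \<omega>) auto
  have "\<bar>?h (X u \<omega>) - ?h (X v \<omega>)\<bar> < \<epsilon>" if "u \<in> \<rat>" "v \<in> \<rat>" "0 \<le> u" "u < t" "t - \<eta>' < u" "0 \<le> v" "v < t" "t - \<eta>' < v" for u v
  proof -
    have "\<bar>?N u - ?N v\<bar> < \<epsilon> / 4" using that \<eta>' T by (intro \<eta>(2)) auto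
    then show ?thesis using near[of u] near[of v] that \<epsilon> by linarith
  qed
  then show "\<exists>\<eta>>0. \<forall>u\<in>\<rat> \<inter> {0..<t}. \<forall>v\<in>\<rat> \<inter> {0..<t}. dist u t < \<eta> \<longrightarrow> dist v t < \<eta> \<longrightarrow> u \<noteq> t \<longrightarrow> v \<noteq> t \<longrightarrow> \<bar>?h (X u \<omega>) - ?h (X v \<omega>)\<bar> < \<epsilon>"
    using \<eta>'(1) by (intro exI[of _ \<eta>']) (auto simp: dist_real_def)
qed

lemma at_right_rat_nontrivial: "at_right_rat t \<noteq> bot"
  using islimpt_rat_right[of t] by (simp add: trivial_limit_within)

text \<open>The limiting state to the right of \<open>t\<close>. The last condition says that the cemetery occurs as a limit only by
absorption, not in place of the point at infinity.\<close>

definition right_limit_state :: "'w \<Rightarrow> real \<Rightarrow> 'v state \<Rightarrow> bool" where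
  "right_limit_state \<omega> t y \<longleftrightarrow> y \<in> cem D \<and>
     (\<forall>i\<in>chart_index. ((\<lambda>q. zext (chart i) (X q \<omega>)) \<longlongrightarrow> zext (chart i) y) (at_right_rat t)) \<and>
     (y = Cemetery \<longrightarrow> (\<forall>s>t. X s \<omega> = Cemetery))"

text \<open>If the path came in from infinity at time \<open>t\<close>, then the martingale of \<open>chart None\<close> for a time \<open>T\<close> shortly after \<open>t\<close>
would have values arbitrarily close to 0, although its terminal value is positive.\<close>

lemma no_right_limit_at_infinity:
  assumes reg: "regular \<omega>" and \<omega>: "\<omega> \<in> \<Omega>" and t: "t \<ge> 0" and s: "s > t"
    and zero: "((\<lambda>q. zext (chart None) (X q \<omega>)) \<longlongrightarrow> 0) (at_right_rat t)"
  shows "X s \<omega> = Cemetery"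
proof (rule ccontr)
  assume alive: "X s \<omega> \<noteq> Cemetery"
  have alive_before: "\<exists>u\<in>D. X r \<omega> = Pt u" if "0 \<le> r" "r \<le> s" for r
  proof -
    have "X r \<omega> \<noteq> Cemetery" using X_absorbed[OF that(1,2) \<omega>] alive by blast
    then show ?thesis using X_state[OF that(1) \<omega>] by (auto simp: cem_def)
  qed
  \<comment> \<open>So close to \<open>t\<close> that the transition operators in question vanish at infinity uniformly.\<close>
  obtain T where T: "T \<in> \<rat>" "t < T" "T < min s (t + vanish_time)"
    using Rats_dense_in_real[of t "min s (t + vanish_time)"] s vanish_time(1) by auto
  have "T > 0" "T \<le> s" using T t by auto
  then obtain uT where "X T \<omega> = Pt uT" using alive_before[of T] by auto
  then have "zext (chart None) (X T \<omega>) > 0" using chart_None_pos[of uT] by simp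
  then obtain c where c: "c > 0" "\<And>q. q \<in> {q \<in> \<rat>. 0 \<le> q \<and> q \<le> T} \<Longrightarrow> trans (T - q) (zext (chart None)) (X q \<omega>) \<ge> c"
    using conjunct2[OF reg[unfolded regular_def, rule_format, OF T(1) \<open>T > 0\<close>]] by blast
  obtain M where M: "\<And>r x. r \<in> {0..vanish_time} \<Longrightarrow> x \<in> D \<Longrightarrow> norm x \<ge> M \<Longrightarrow> trans r (zext (chart None)) (Pt x) \<le> c / 2"
    using vanish_time(2)[OF half_gt_zero[OF c(1)]] by blast
  have "1 / (1 + M\<^sup>2) > 0" by (simp add: add_pos_nonneg)
  then have "\<forall>\<^sub>F q in at_right_rat t. zext (chart None) (X q \<omega>) < 1 / (1 + M\<^sup>2)"
    by (rule order_tendstoD(2)[OF zero])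
  moreover have "\<forall>\<^sub>F q in at_right_rat t. q \<in> \<rat> \<and> t < q \<and> q < T"
    unfolding eventually_at_right_rat using T(2) by (intro exI[of _ "T - t"]) auto
  ultimately have "\<forall>\<^sub>F q in at_right_rat t. zext (chart None) (X q \<omega>) < 1 / (1 + M\<^sup>2) \<and> q \<in> \<rat> \<and> t < q \<and> q < T"
    by (rule eventually_conj)
  then obtain q where q: "zext (chart None) (X q \<omega>) < 1 / (1 + M\<^sup>2)" "q \<in> \<rat>" "t < q" "q < T"
    using eventually_happens'[OF at_right_rat_nontrivial] by blast
  obtain u where u: "u \<in> D" "X q \<omega> = Pt u" using alive_before[of q] q t \<open>T \<le> s\<close> by auto
  have "norm u \<ge> M"
  proof (rule ccontr)
    assume "\<not> norm u \<ge> M"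
    then have "(norm u)\<^sup>2 \<le> M\<^sup>2" by (intro power_mono) auto
    then have "1 / (1 + M\<^sup>2) \<le> 1 / (1 + (norm u)\<^sup>2)" by (intro divide_left_mono) (auto simp: add_pos_nonneg)
    then show False using q(1) u by (simp add: chart.simps)
  qed
  then have "trans (T - q) (zext (chart None)) (X q \<omega>) \<le> c / 2"
    unfolding u(2) using q T u by (intro M) auto
  moreover have "trans (T - q) (zext (chart None)) (X q \<omega>) \<ge> c" using q t by (intro c(2)) auto
  ultimately show False using c(1) by simp
qed

lemma right_limit_state_exists:
  assumes reg: "regular \<omega>" and \<omega>: "\<omega> \<in> \<Omega>" and t: "t \<ge> 0"
  shows "\<exists>y. right_limit_state \<omega> t y"
proof -
  obtain L where L: "\<And>i. i \<in> chart_index \<Longrightarrow> ((\<lambda>q. zext (chart i) (X q \<omega>)) \<longlongrightarrow> L i) (at_right_rat t)"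
    using regular_right_limit[OF reg \<omega> t] by metis
  have state: "\<forall>\<^sub>F q in at_right_rat t. X q \<omega> \<in> cem D"
    unfolding eventually_at_right_rat using X_state[OF _ \<omega>] t by (intro exI[of _ 1]) auto
  have "L None \<ge> 0"
    by (rule tendsto_lowerbound[OF L[OF None_chart_index] _ at_right_rat_nontrivial]) (simp add: chart_state_nonneg)
  then consider "L None > 0" | "L None = 0" by linarith
  then show ?thesis
  proof cases
    case 1
    obtain x where x: "x \<in> D" "\<forall>i\<in>chart_index. L i = chart i x"
      using chart_limit_finite[OF closed_D at_right_rat_nontrivial state L 1] by blast
    have "right_limit_state \<omega> t (Pt x)"
      unfolding right_limit_state_def using x L Pt_in_cem by simp
    then show ?thesis ..
  next
    case 2
    have dead: "X s \<omega> = Cemetery" if "s > t" for s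
      using no_right_limit_at_infinity[OF reg \<omega> t that] L[OF None_chart_index] 2 by simp
    have "\<forall>\<^sub>F q in at_right_rat t. zext (chart i) (X q \<omega>) = 0" for i
      unfolding eventually_at_right_rat using dead by (intro exI[of _ 1]) auto
    then have "((\<lambda>q. zext (chart i) (X q \<omega>)) \<longlongrightarrow> 0) (at_right_rat t)" for i
      by (rule tendsto_eventually)
    then have "right_limit_state \<omega> t Cemetery"
      unfolding right_limit_state_def using dead Cem_in_cem by simp
    then show ?thesis ..
  qed
qed

text \<open>On the exceptional paths the constant value \<open>Cemetery\<close> is a right-continuous absorbed path.\<close>

definition regularized :: "real \<Rightarrow> 'w \<Rightarrow> 'v state" where
  "regularized t \<omega> = (if regular \<omega> then SOME y. right_limit_state \<omega> t y else Cemetery)"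

lemma regularized_right_limit:
  assumes "regular \<omega>" "\<omega> \<in> \<Omega>" "t \<ge> 0"
  shows "right_limit_state \<omega> t (regularized t \<omega>)"
  using someI_ex[OF right_limit_state_exists[OF assms]] assms(1) by (simp add: regularized_def)

lemma regularized_state: "\<omega> \<in> \<Omega> \<Longrightarrow> t \<ge> 0 \<Longrightarrow> regularized t \<omega> \<in> cem D"
  using regularized_right_limit[of \<omega> t] Cem_in_cem by (cases "regular \<omega>") (auto simp: right_limit_state_def, simp add: regularized_def)

lemma regularized_absorbed:
  assumes \<omega>: "\<omega> \<in> \<Omega>" and st: "0 \<le> s" "s \<le> t" and dead: "regularized s \<omega> = Cemetery"
  shows "regularized t \<omega> = Cemetery"
proof (cases "regular \<omega> \<and> s < t")
  case True
  then have reg: "regular \<omega>" and "s < t" by auto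
  have Xdead: "X r \<omega> = Cemetery" if "r > s" for r
    using regularized_right_limit[OF reg \<omega> st(1)] dead that by (simp add: right_limit_state_def)
  have t: "t \<ge> 0" using st by simp
  show ?thesis
  proof (rule chart_determines_state)
    fix i :: "'v option" assume i: "i \<in> chart_index"
    have "((\<lambda>q. zext (chart i) (X q \<omega>)) \<longlongrightarrow> zext (chart i) (regularized t \<omega>)) (at_right_rat t)"
      using regularized_right_limit[OF reg \<omega> t] i by (simp add: right_limit_state_def)
    moreover have "((\<lambda>q. zext (chart i) (X q \<omega>)) \<longlongrightarrow> 0) (at_right_rat t)"
    proof (rule tendsto_eventually)
      show "\<forall>\<^sub>F q in at_right_rat t. zext (chart i) (X q \<omega>) = 0"
        unfolding eventually_at_right_rat using Xdead \<open>s < t\<close> by (intro exI[of _ 1]) auto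
    qed
    ultimately show "zext (chart i) (regularized t \<omega>) = zext (chart i) Cemetery"
      using tendsto_unique[OF at_right_rat_nontrivial] by simp
  qed
next
  case False
  then show ?thesis using st dead by (cases "s = t") (auto simp: regularized_def)
qed

text \<open>Right limits of a function with left limits are right-continuous with left limits; the coordinates translate
this into convergence of states. A left limit with \<open>chart None\<close> tending to 0 is the point at infinity, unless the
path has been absorbed, and a compact \<open>D\<close> bounds \<open>chart None\<close> away from 0.\<close>

lemma regularized_cadlag:
  assumes \<omega>: "\<omega> \<in> \<Omega>"
  shows "cadlag_path D (\<lambda>t. regularized t \<omega>)"
proof -
  let ?y = "\<lambda>t. regularized t \<omega>"
  have right: "limitin (cem_topology D) ?y (?y t) (at_right t)" if t: "t \<ge> 0" for t
  proof (cases "?y t")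
    case Cemetery
    have "\<forall>\<^sub>F s in at_right t. ?y s = Cemetery"
      unfolding eventually_at_right_field using regularized_absorbed[OF \<omega> t _ Cemetery] by (intro exI[of _ "t + 1"]) auto
    then show ?thesis unfolding Cemetery by (rule limitin_cem_Cemetery)
  next
    case (Pt x)
    have reg: "regular \<omega>" using Pt by (auto simp: regularized_def split: if_splits)
    have cont: "((\<lambda>s. zext (chart i) (?y s)) \<longlongrightarrow> zext (chart i) (?y t)) (at_right t)" if i: "i \<in> chart_index" for i
    proof (rule right_limits_right_continuous[OF _ t])
      show "((\<lambda>q. zext (chart i) (X q \<omega>)) \<longlongrightarrow> zext (chart i) (?y s)) (at_right_rat s)" if "s \<ge> 0" for s
        using regularized_right_limit[OF reg \<omega> that] i by (simp add: right_limit_state_def)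
    qed
    have state: "\<forall>\<^sub>F s in at_right t. ?y s \<in> cem D"
      unfolding eventually_at_right_field using regularized_state[OF \<omega>] t by (intro exI[of _ "t + 1"]) auto
    have "zext (chart None) (?y t) > 0" using Pt chart_None_pos[of x] by simp
    from chart_limit_finite[OF closed_D trivial_limit_at_right_real state cont this]
    obtain x' where x': "x' \<in> D" "\<forall>\<^sub>F s in at_right t. ?y s \<in> Pt ` D" "((\<lambda>s. unPt (?y s)) \<longlongrightarrow> x') (at_right t)"
       "\<forall>i\<in>chart_index. zext (chart i) (?y t) = chart i x'" by blast
    have "?y t = Pt x'" by (rule chart_determines_state) (use x'(4) in simp)
    then show ?thesis using limitin_cem_finite[OF x'(1-3)] by simp
  qed
  have left: "(\<exists>l. limitin (cem_topology D) ?y l (at_left t)) \<or>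
      (\<not> compact D \<and> limitin (Alexandroff_compactification (cem_topology D)) (\<lambda>s. Some (?y s)) None (at_left t))"
    if t: "t > 0" for t
  proof (cases "\<exists>s\<in>{0..<t}. ?y s = Cemetery")
    case True
    then obtain s where s: "0 \<le> s" "s < t" "?y s = Cemetery" by auto
    have "\<forall>\<^sub>F r in at_left t. ?y r = Cemetery"
      unfolding eventually_at_left_field using regularized_absorbed[OF \<omega> s(1) _ s(3)] s by (intro exI[of _ s]) auto
    then have "limitin (cem_topology D) ?y Cemetery (at_left t)" by (rule limitin_cem_Cemetery)
    then show ?thesis by blast
  next
    case False
    have alive: "?y s \<in> Pt ` D" if "0 \<le> s" "s < t" for s
      using regularized_state[OF \<omega> that(1)] False that by (auto simp: cem_def)
    have reg: "regular \<omega>" using False t by (auto simp: regularized_def split: if_splits)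
    have "\<exists>l. ((\<lambda>s. zext (chart i) (?y s)) \<longlongrightarrow> l) (at_left t)" if i: "i \<in> chart_index" for i
    proof -
      obtain l where l: "((\<lambda>q. zext (chart i) (X q \<omega>)) \<longlongrightarrow> l) (at_left_rat t)"
        using regular_left_limit[OF reg \<omega> t i] by blast
      have "((\<lambda>s. zext (chart i) (?y s)) \<longlongrightarrow> l) (at_left t)"
      proof (rule right_limits_left_limit[OF _ t l])
        show "((\<lambda>q. zext (chart i) (X q \<omega>)) \<longlongrightarrow> zext (chart i) (?y s)) (at_right_rat s)" if "s \<ge> 0" for s
          using regularized_right_limit[OF reg \<omega> that] i by (simp add: right_limit_state_def)
      qed
      then show ?thesis ..
    qed
    then obtain L where L: "\<And>i. i \<in> chart_index \<Longrightarrow> ((\<lambda>s. zext (chart i) (?y s)) \<longlongrightarrow> L i) (at_left t)" by metis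
    have fin: "\<forall>\<^sub>F s in at_left t. ?y s \<in> Pt ` D"
      unfolding eventually_at_left_field using alive t by (intro exI[of _ 0]) auto
    then have state: "\<forall>\<^sub>F s in at_left t. ?y s \<in> cem D" by eventually_elim (auto simp: cem_def)
    have "L None \<ge> 0"
      by (rule tendsto_lowerbound[OF L[OF None_chart_index] _ trivial_limit_at_left_real]) (simp add: chart_state_nonneg)
    then consider "L None > 0" | "L None = 0" by linarith
    then show ?thesis
    proof cases
      case 1
      from chart_limit_finite[OF closed_D trivial_limit_at_left_real state L 1]
      obtain x' where "x' \<in> D" "((\<lambda>s. unPt (?y s)) \<longlongrightarrow> x') (at_left t)" by blast
      then show ?thesis using limitin_cem_finite[OF _ fin] by blast
    next
      case 2
      have inf: "limitin (Alexandroff_compactification (cem_topology D)) (\<lambda>s. Some (?y s)) None (at_left t)"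
        using limitin_Alexandroff_infinity[OF fin] L[OF None_chart_index] 2 by simp
      have "\<not> compact D"
      proof
        assume "compact D"
        then have "bounded D" by (rule compact_imp_bounded)
        then obtain r where r: "\<And>x. x \<in> D \<Longrightarrow> norm x \<le> r" unfolding bounded_iff by blast
        have "1 / (1 + r\<^sup>2) \<le> L None"
        proof (rule tendsto_lowerbound[OF L[OF None_chart_index] _ trivial_limit_at_left_real])
          show "\<forall>\<^sub>F s in at_left t. 1 / (1 + r\<^sup>2) \<le> zext (chart None) (?y s)"
            using fin
          proof eventually_elim
            case (elim s)
            then obtain u where u: "?y s = Pt u" "u \<in> D" by auto
            then have "(norm u)\<^sup>2 \<le> r\<^sup>2" using r by (intro power_mono) auto
            then have "1 / (1 + r\<^sup>2) \<le> 1 / (1 + (norm u)\<^sup>2)" by (intro divide_left_mono) (auto simp: add_pos_nonneg)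
            then show ?case using u by (simp add: chart.simps)
          qed
        qed
        moreover have "1 / (1 + r\<^sup>2) > 0" by (simp add: add_pos_nonneg)
        ultimately show False using 2 by simp
      qed
      then show ?thesis using inf by blast
    qed
  qed
  show ?thesis
  proof (cases "compact D")
    case True
    then show ?thesis unfolding cadlag_path_def cadlag_in_def using right left by simp
  next
    case False
    have "limitin (Alexandroff_compactification (cem_topology D)) (\<lambda>s. Some (?y s)) (Some (?y t)) (at_right t)" if "t \<ge> 0" for t
      by (rule limitin_Alexandroff_Some[OF right[OF that]])
    moreover have "\<exists>l. limitin (Alexandroff_compactification (cem_topology D)) (\<lambda>s. Some (?y s)) l (at_left t)" if "t > 0" for t
      using left[OF that]
    proof
      assume "\<exists>l. limitin (cem_topology D) ?y l (at_left t)"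
      then obtain l where "limitin (cem_topology D) ?y l (at_left t)" ..
      then show ?thesis by (intro exI[of _ "Some l"] limitin_Alexandroff_Some)
    qed blast
    ultimately show ?thesis unfolding cadlag_path_def cadlag_in_def using False by simp
  qed
qed

text \<open>Expanding the square and applying the Markov property at time \<open>t\<close> leaves differences between \<open>chart i\<close> or
its square and their images under the transition operator.\<close>

lemma square_increment_small:
  assumes x: "x \<in> cem D" and t: "t \<ge> 0" and i: "i \<in> chart_index" and e: "e > 0"
  shows "\<exists>\<delta>>0. \<forall>r\<in>{0..\<delta>}. (LINT \<omega>|P x. (zext (chart i) (X (r + t) \<omega>) - zext (chart i) (X t \<omega>))\<^sup>2) \<le> e"
proof -
  interpret prob_space "P x" by (rule P_prob[OF x])
  let ?h = "zext (chart i)"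
  let ?g = "zext (\<lambda>x. (chart i x)\<^sup>2)"
  have g_eq: "?g y = (?h y)\<^sup>2" for y by (cases y) auto
  have sq_le: "(chart i x)\<^sup>2 \<le> 1" for x
    using chart_le_inverse_norm(1)[OF i, of x] by (simp add: abs_square_le_1)
  have g_cont: "continuous_on UNIV (\<lambda>x. (chart i x)\<^sup>2)" by (intro continuous_intros chart_cont)
  have g_lim: "((\<lambda>x. (chart i x)\<^sup>2) \<longlongrightarrow> 0) at_infinity"
    using tendsto_power[OF chart_tendsto_0[OF i], of 2] by simp
  have g_meas: "?g \<in> borel_measurable (cem_algebra D)"
    by (rule zext_measurable[OF closed_D borel_measurable_continuous_onI[OF g_cont]])
  have g_bound: "\<bar>?g y\<bar> \<le> 1" for y using sq_le by (cases y) auto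
  have e4: "e / 4 > 0" using e by simp
  obtain d1 where d1: "d1 > 0" "\<And>s y. s \<in> {0..d1} \<Longrightarrow> y \<in> cem D \<Longrightarrow> \<bar>trans s ?h y - ?h y\<bar> \<le> e / 4"
    using chart_close_to_martingale[OF i e4] by blast
  have "\<bar>(chart i x)\<^sup>2\<bar> \<le> 1" for x using sq_le by simp
  from trans_strongly_continuous[OF g_cont this g_lim e4]
  obtain d2 where d2: "d2 > 0" "\<And>s y. s \<in> {0..d2} \<Longrightarrow> y \<in> cem D \<Longrightarrow> \<bar>trans s ?g y - ?g y\<bar> \<le> e / 4"
    by blast
  have "(LINT \<omega>|P x. (?h (X (r + t) \<omega>) - ?h (X t \<omega>))\<^sup>2) \<le> e" if r: "r \<in> {0..min d1 d2}" for r
  proof -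
    have r0: "r \<ge> 0" "r + t \<ge> 0" using r t by auto
    have hm: "(\<lambda>\<omega>. f (X s \<omega>)) \<in> borel_measurable (P x)" if "f \<in> borel_measurable (cem_algebra D)" "s \<ge> 0" for s and f :: "'v state \<Rightarrow> real"
      by (rule measurable_compose[OF X_measurable_P[OF x that(2)] that(1)])
    have hF: "(\<lambda>\<omega>. ?h (X t \<omega>)) \<in> borel_measurable (\<F> t)"
      by (rule measurable_compose[OF X_measurable[OF x t] chart_state_measurable])
    note hb = chart_state_bound[OF i]
    have mult_bound: "\<bar>a * b\<bar> \<le> 1" if "\<bar>a\<bar> \<le> 1" "\<bar>b\<bar> \<le> 1" for a b :: real
      using mult_mono[OF that] by (simp add: abs_mult)
    have int: "integrable (P x) f" if "f \<in> borel_measurable (P x)" "\<And>\<omega>. \<bar>f \<omega>\<bar> \<le> 1" for f :: "'w \<Rightarrow> real"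
      using that by (intro integrable_const_bound[where B=1]) auto
    have tb: "\<bar>trans r ?h y\<bar> \<le> 1" "\<bar>trans r ?g y\<bar> \<le> 1" for y
      by (rule trans_bound[OF chart_state_measurable _ hb], simp) (rule trans_bound[OF g_meas _ g_bound], simp)
    have tm: "trans r ?h \<in> borel_measurable (cem_algebra D)" "trans r ?g \<in> borel_measurable (cem_algebra D)"
      by (rule trans_measurable[OF r0(1) chart_state_measurable], simp) (rule trans_measurable[OF r0(1) g_meas], simp)
    have i1: "integrable (P x) (\<lambda>\<omega>. ?g (X s \<omega>))" if "s \<ge> 0" for s by (rule int[OF hm[OF g_meas that] g_bound])
    have i2: "integrable (P x) (\<lambda>\<omega>. ?h (X (r + t) \<omega>) * ?h (X t \<omega>))"
      by (rule int[OF borel_measurable_times[OF hm[OF chart_state_measurable r0(2)] hm[OF chart_state_measurable t]] mult_bound[OF hb hb]])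
    have i3: "integrable (P x) (\<lambda>\<omega>. trans r ?h (X t \<omega>) * ?h (X t \<omega>))"
      by (rule int[OF borel_measurable_times[OF hm[OF tm(1) t] hm[OF chart_state_measurable t]] mult_bound[OF tb(1) hb]])
    have i4: "integrable (P x) (\<lambda>\<omega>. trans r ?g (X t \<omega>))" by (rule int[OF hm[OF tm(2) t] tb(2)])
    have "(LINT \<omega>|P x. (?h (X (r + t) \<omega>) - ?h (X t \<omega>))\<^sup>2)
        = (LINT \<omega>|P x. ?g (X (r + t) \<omega>) - 2 * (?h (X (r + t) \<omega>) * ?h (X t \<omega>)) + ?g (X t \<omega>))"
      by (rule Bochner_Integration.integral_cong[OF refl]) (simp add: g_eq power2_diff)
    also have "\<dots> = (LINT \<omega>|P x. ?g (X (r + t) \<omega>)) - 2 * (LINT \<omega>|P x. ?h (X (r + t) \<omega>) * ?h (X t \<omega>)) + (LINT \<omega>|P x. ?g (X t \<omega>))"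
      by (simp only: Bochner_Integration.integral_add Bochner_Integration.integral_diff Bochner_Integration.integrable_diff
          integrable_mult_right integral_mult_right_zero i1[OF r0(2)] i1[OF t] i2)
    also have "(LINT \<omega>|P x. ?g (X (r + t) \<omega>)) = (LINT \<omega>|P x. trans r ?g (X t \<omega>))"
      using markov_projection[OF x t r0(1) g_meas g_bound _ borel_measurable_const, of 1 1] by simp
    also have "(LINT \<omega>|P x. ?h (X (r + t) \<omega>) * ?h (X t \<omega>)) = (LINT \<omega>|P x. trans r ?h (X t \<omega>) * ?h (X t \<omega>))"
      by (rule markov_projection[OF x t r0(1) chart_state_measurable hb _ hF hb]) simp
    also have "(LINT \<omega>|P x. trans r ?g (X t \<omega>)) - 2 * (LINT \<omega>|P x. trans r ?h (X t \<omega>) * ?h (X t \<omega>)) + (LINT \<omega>|P x. ?g (X t \<omega>))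
        = (LINT \<omega>|P x. trans r ?g (X t \<omega>) - 2 * (trans r ?h (X t \<omega>) * ?h (X t \<omega>)) + ?g (X t \<omega>))"
      by (simp only: Bochner_Integration.integral_add Bochner_Integration.integral_diff Bochner_Integration.integrable_diff
          integrable_mult_right integral_mult_right_zero i1[OF t] i3 i4)
    also have "\<dots> \<le> (LINT \<omega>|P x. e)"
    proof (rule integral_mono)
      show "integrable (P x) (\<lambda>\<omega>. trans r ?g (X t \<omega>) - 2 * (trans r ?h (X t \<omega>) * ?h (X t \<omega>)) + ?g (X t \<omega>))"
        by (intro Bochner_Integration.integrable_add Bochner_Integration.integrable_diff integrable_mult_right i1[OF t] i3 i4)
      fix \<omega> assume "\<omega> \<in> space (P x)"
      then have y: "X t \<omega> \<in> cem D" using X_state[OF t] P_space[OF x] by simp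
      define y where "y = X t \<omega>"
      have a: "\<bar>trans r ?g y - ?g y\<bar> \<le> e / 4" using r y by (intro d2(2)) (auto simp: y_def)
      have b: "\<bar>trans r ?h y - ?h y\<bar> \<le> e / 4" using r y by (intro d1(2)) (auto simp: y_def)
      have "\<bar>(trans r ?h y - ?h y) * ?h y\<bar> \<le> (e / 4) * 1"
        unfolding abs_mult using b hb[of y] e by (intro mult_mono) auto
      moreover have "trans r ?g y - 2 * (trans r ?h y * ?h y) + ?g y = (trans r ?g y - ?g y) - 2 * ((trans r ?h y - ?h y) * ?h y)"
        unfolding g_eq by (simp add: power2_eq_square algebra_simps)
      ultimately show "trans r ?g (X t \<omega>) - 2 * (trans r ?h (X t \<omega>) * ?h (X t \<omega>)) + ?g (X t \<omega>) \<le> e"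
        using a e unfolding y_def by linarith
    qed simp
    finally show ?thesis by (simp add: prob_space)
  qed
  then show ?thesis using d1(1) d2(1) by (intro exI[of _ "min d1 d2"]) auto
qed

text \<open>Along rational times that decrease to \<open>t\<close>, the coordinates converge to those of the right limit along the path
and to those of \<open>X t\<close> in mean square. Fatou identifies the limits; it is applied to squared differences of values
of \<open>X\<close>, so that measurability of the right limit need not be known.\<close>

lemma regularized_version:
  assumes x: "x \<in> cem D" and t: "t \<ge> 0"
  shows "AE \<omega> in P x. regularized t \<omega> = X t \<omega>"
proof -
  interpret prob_space "P x" by (rule P_prob[OF x])
  obtain q where q: "\<And>n::nat. q n \<in> (\<rat> \<inter> {t<..}) - {t}" "q \<longlonglongrightarrow> t"
    using islimpt_rat_right[of t] unfolding islimpt_sequential by blast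
  have q_filter: "filterlim q (at_right_rat t) sequentially"
    unfolding filterlim_at using q by (auto intro!: always_eventually)
  have "AE \<omega> in P x. zext (chart i) (regularized t \<omega>) = zext (chart i) (X t \<omega>)" if i: "i \<in> chart_index" for i
  proof -
    let ?h = "zext (chart i)"
    let ?D = "\<lambda>n \<omega>. (?h (X (q n) \<omega>) - ?h (X t \<omega>))\<^sup>2"
    have qt: "q n > t" "q n \<ge> 0" for n using q(1)[of n] t by auto
    have hm: "(\<lambda>\<omega>. ?h (X s \<omega>)) \<in> borel_measurable (P x)" if "s \<ge> 0" for s
      by (rule measurable_compose[OF X_measurable_P[OF x that] chart_state_measurable])
    have D_meas: "?D n \<in> borel_measurable (P x)" for n
      by (intro borel_measurable_power borel_measurable_diff hm qt t)
    have D_int: "integrable (P x) (?D n)" for n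
    proof (rule integrable_const_bound[where B="2\<^sup>2"])
      have "\<bar>?h (X (q n) \<omega>) - ?h (X t \<omega>)\<bar> \<le> 2" for \<omega>
        using chart_state_bound[OF i, of "X (q n) \<omega>"] chart_state_bound[OF i, of "X t \<omega>"] by linarith
      then show "AE \<omega> in P x. norm (?D n \<omega>) \<le> 2\<^sup>2"
        by (intro AE_I2) (simp only: real_norm_def abs_power2 abs_le_square_iff[symmetric] abs_numeral)
    qed (rule D_meas)
    have D_lim: "(\<lambda>n. \<integral>\<^sup>+\<omega>. ennreal (?D n \<omega>) \<partial>P x) \<longlonglongrightarrow> 0"
    proof -
      have eq: "(\<integral>\<^sup>+\<omega>. ennreal (?D n \<omega>) \<partial>P x) = ennreal (LINT \<omega>|P x. ?D n \<omega>)" for n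
        by (rule nn_integral_eq_integral[OF D_int]) simp
      have "(\<lambda>n. LINT \<omega>|P x. ?D n \<omega>) \<longlonglongrightarrow> 0"
      proof (rule LIMSEQ_I)
        fix e :: real assume e: "e > 0"
        obtain \<delta> where \<delta>: "\<delta> > 0" "\<And>r. r \<in> {0..\<delta>} \<Longrightarrow> (LINT \<omega>|P x. (?h (X (r + t) \<omega>) - ?h (X t \<omega>))\<^sup>2) \<le> e / 2"
          using square_increment_small[OF x t i half_gt_zero[OF e]] by blast
        obtain N where N: "\<And>n. n \<ge> N \<Longrightarrow> dist (q n) t < \<delta>" using metric_LIMSEQ_D[OF q(2) \<delta>(1)] by blast
        have "norm ((LINT \<omega>|P x. ?D n \<omega>) - 0) < e" if "n \<ge> N" for n
        proof -
          have "q n - t \<in> {0..\<delta>}" using N[OF that] qt(1)[of n] by (simp add: dist_real_def)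
          from \<delta>(2)[OF this] have "(LINT \<omega>|P x. ?D n \<omega>) \<le> e / 2" by simp
          moreover have "(LINT \<omega>|P x. ?D n \<omega>) \<ge> 0" by (rule Bochner_Integration.integral_nonneg) simp
          ultimately show ?thesis using e by simp
        qed
        then show "\<exists>N. \<forall>n\<ge>N. norm ((LINT \<omega>|P x. ?D n \<omega>) - 0) < e" by blast
      qed
      then have "(\<lambda>n. ennreal (LINT \<omega>|P x. ?D n \<omega>)) \<longlonglongrightarrow> ennreal 0" by (rule tendsto_ennrealI)
      then show ?thesis by (simp only: eq ennreal_0)
    qed
    have "(\<integral>\<^sup>+\<omega>. liminf (\<lambda>n. ennreal (?D n \<omega>)) \<partial>P x) \<le> liminf (\<lambda>n. \<integral>\<^sup>+\<omega>. ennreal (?D n \<omega>) \<partial>P x)"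
      using D_meas by (intro nn_integral_liminf) simp
    also have "\<dots> = 0" by (rule lim_imp_Liminf[OF sequentially_bot D_lim])
    finally have "(\<integral>\<^sup>+\<omega>. liminf (\<lambda>n. ennreal (?D n \<omega>)) \<partial>P x) = 0" by simp
    moreover have "(\<lambda>\<omega>. liminf (\<lambda>n. ennreal (?D n \<omega>))) \<in> borel_measurable (P x)"
      using D_meas by (intro borel_measurable_liminf) simp
    ultimately have "AE \<omega> in P x. liminf (\<lambda>n. ennreal (?D n \<omega>)) = 0"
      by (simp only: nn_integral_0_iff_AE)
    moreover have "AE \<omega> in P x. regular \<omega>" by (rule AE_regular[OF x])
    ultimately show ?thesis
    proof (rule AE_mp[OF AE_conjI], intro AE_I2 impI)
      fix \<omega> assume \<omega>: "\<omega> \<in> space (P x)" and h: "liminf (\<lambda>n. ennreal (?D n \<omega>)) = 0 \<and> regular \<omega>"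
      have "\<omega> \<in> \<Omega>" using \<omega> P_space[OF x] by simp
      then have "((\<lambda>q. ?h (X q \<omega>)) \<longlongrightarrow> ?h (regularized t \<omega>)) (at_right_rat t)"
        using regularized_right_limit[OF _ _ t] h i by (simp add: right_limit_state_def)
      from filterlim_compose[OF this q_filter]
      have "(\<lambda>n. ennreal (?D n \<omega>)) \<longlonglongrightarrow> ennreal ((?h (regularized t \<omega>) - ?h (X t \<omega>))\<^sup>2)"
        by (intro tendsto_ennrealI tendsto_intros)
      then have "liminf (\<lambda>n. ennreal (?D n \<omega>)) = ennreal ((?h (regularized t \<omega>) - ?h (X t \<omega>))\<^sup>2)"
        by (rule lim_imp_Liminf[OF sequentially_bot])
      then show "?h (regularized t \<omega>) = ?h (X t \<omega>)" using h by (simp add: ennreal_eq_0_iff)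
    qed
  qed
  then have "AE \<omega> in P x. \<forall>i\<in>chart_index. zext (chart i) (regularized t \<omega>) = zext (chart i) (X t \<omega>)"
    by (subst AE_ball_countable[OF countable_finite[OF chart_index_finite]]) blast
  then show ?thesis
    by (rule AE_mp) (intro AE_I2 impI chart_determines_state, blast)
qed

end

section \<open>The completed and augmented Markov process\<close>

context feller_markov_process
begin

abbreviation "\<G> \<equiv> aug_filt D \<Omega> P X"

lemma augmentation_generators:
  assumes x: "x \<in> cem D" and t: "t \<ge> 0"
  shows "sets (\<F> t) \<union> null_sets (completion (P x)) \<subseteq> sets (completion (P x))"
    and "sets (completion (P x)) \<subseteq> Pow \<Omega>"
proof -
  have "sets (\<F> t) \<subseteq> sets (P x)" using F_subalgebra[OF x t] by (simp add: subalgebra_def)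
  then show "sets (\<F> t) \<union> null_sets (completion (P x)) \<subseteq> sets (completion (P x))"
    by (auto simp: null_sets_def)
  show "sets (completion (P x)) \<subseteq> Pow \<Omega>"
    using sets.sets_into_space[of _ "completion (P x)"] P_space[OF x] by auto
qed

lemma sets_augmentation:
  assumes x: "x \<in> cem D" and t: "t \<ge> 0"
  shows "sets (\<G> x t) = sigma_sets \<Omega> (sets (\<F> t) \<union> null_sets (completion (P x)))"
    and "space (\<G> x t) = \<Omega>"
proof -
  have "sets (\<F> t) \<union> null_sets (completion (P x)) \<subseteq> Pow \<Omega>"
    using augmentation_generators[OF x t] by (rule order_trans)
  then show "sets (\<G> x t) = sigma_sets \<Omega> (sets (\<F> t) \<union> null_sets (completion (P x)))" "space (\<G> x t) = \<Omega>"
    unfolding aug_filt_def by (rule sets_measure_of, rule space_measure_of)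
qed

lemma augmentation_subalgebra:
  assumes x: "x \<in> cem D" and t: "t \<ge> 0"
  shows "subalgebra (completion (P x)) (\<G> x t)"
  unfolding subalgebra_def
proof
  show "space (\<G> x t) = space (completion (P x))"
    using sets_augmentation(2)[OF x t] P_space[OF x] by simp
  have "sigma_sets (space (completion (P x))) (sets (\<F> t) \<union> null_sets (completion (P x))) \<subseteq> sets (completion (P x))"
    by (rule sets.sigma_sets_subset[OF augmentation_generators(1)[OF x t]])
  then show "sets (\<G> x t) \<subseteq> sets (completion (P x))"
    using sets_augmentation(1)[OF x t] P_space[OF x] by simp
qed

lemma augmentation_contains:
  assumes x: "x \<in> cem D" and t: "t \<ge> 0"
  shows "A \<in> sets (\<F> t) \<Longrightarrow> A \<in> sets (\<G> x t)" and "A \<in> null_sets (completion (P x)) \<Longrightarrow> A \<in> sets (\<G> x t)"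
  unfolding sets_augmentation(1)[OF x t] by (auto intro: sigma_sets.Basic)

lemma augmentation_mono:
  assumes x: "x \<in> cem D" and st: "0 \<le> s" "s \<le> t"
  shows "sets (\<G> x s) \<subseteq> sets (\<G> x t)"
proof -
  have t: "t \<ge> 0" using st by simp
  have "sets (\<F> s) \<union> null_sets (completion (P x)) \<subseteq> sets (\<F> t) \<union> null_sets (completion (P x))"
    using F_mono[OF x st] by (rule Un_mono) simp
  then show ?thesis
    unfolding sets_augmentation(1)[OF x st(1)] sets_augmentation(1)[OF x t] by (rule sigma_sets_mono')
qed

text \<open>The sets that agree almost surely with a set of the natural filtration form a \<open>\<sigma>\<close>-algebra.\<close>

lemma augmentation_approximation:
  assumes x: "x \<in> cem D" and t: "t \<ge> 0" and A: "A \<in> sets (\<G> x t)"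
  shows "\<exists>B\<in>sets (\<F> t). AE \<omega> in completion (P x). \<omega> \<in> A \<longleftrightarrow> \<omega> \<in> B"
proof -
  have sp: "space (\<F> t) = \<Omega>" using F_subalgebra[OF x t] P_space[OF x] by (simp add: subalgebra_def)
  from A have "A \<in> sigma_sets \<Omega> (sets (\<F> t) \<union> null_sets (completion (P x)))"
    by (simp only: sets_augmentation(1)[OF x t])
  then show ?thesis
  proof (induction rule: sigma_sets.induct)
    case (Basic a)
    then show ?case
    proof
      assume "a \<in> null_sets (completion (P x))"
      then have "AE \<omega> in completion (P x). \<omega> \<notin> a" by (rule AE_not_in)
      then have "AE \<omega> in completion (P x). \<omega> \<in> a \<longleftrightarrow> \<omega> \<in> {}" by (rule AE_mp) (intro AE_I2 impI, simp)
      then show ?thesis by (intro bexI[of _ "{}"]) auto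
    qed (intro bexI[of _ a] AE_I2, auto)
  next
    case Empty
    show ?case by (intro bexI[of _ "{}"] AE_I2) auto
  next
    case (Compl a)
    then obtain B where B: "B \<in> sets (\<F> t)" "AE \<omega> in completion (P x). \<omega> \<in> a \<longleftrightarrow> \<omega> \<in> B" by blast
    have "\<Omega> - B \<in> sets (\<F> t)" using sets.compl_sets[OF B(1)] sp by simp
    moreover have "AE \<omega> in completion (P x). \<omega> \<in> \<Omega> - a \<longleftrightarrow> \<omega> \<in> \<Omega> - B"
      using B(2) by (rule AE_mp) (intro AE_I2 impI, simp)
    ultimately show ?case by blast
  next
    case (Union a)
    then have "\<forall>n. \<exists>B. B \<in> sets (\<F> t) \<and> (AE \<omega> in completion (P x). \<omega> \<in> a n \<longleftrightarrow> \<omega> \<in> B)" by blast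
    then obtain B where B: "\<And>n. B n \<in> sets (\<F> t)" "\<And>n. AE \<omega> in completion (P x). \<omega> \<in> a n \<longleftrightarrow> \<omega> \<in> B n"
      by metis
    have "AE \<omega> in completion (P x). \<forall>n. \<omega> \<in> a n \<longleftrightarrow> \<omega> \<in> B n"
      using B(2) by (subst AE_all_countable) blast
    then have "AE \<omega> in completion (P x). \<omega> \<in> (\<Union>n. a n) \<longleftrightarrow> \<omega> \<in> (\<Union>n. B n)"
      by (rule AE_mp) (intro AE_I2 impI, simp)
    moreover have "(\<Union>n. B n) \<in> sets (\<F> t)" using B(1) by auto
    ultimately show ?case by blast
  qed
qed

lemma regularized_version_completion:
  assumes "x \<in> cem D" "t \<ge> 0"
  shows "AE \<omega> in completion (P x). regularized t \<omega> = X t \<omega>"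
  using regularized_version[OF assms] by (rule AE_completion)

text \<open>An event of the new process differs from one of the old process by a null set, which the augmentation contains.\<close>

lemma regularized_measurable:
  assumes x: "x \<in> cem D" and t: "t \<ge> 0"
  shows "regularized t \<in> measurable (\<G> x t) (cem_algebra D)"
proof (rule measurableI)
  fix \<omega> assume "\<omega> \<in> space (\<G> x t)"
  then show "regularized t \<omega> \<in> space (cem_algebra D)"
    using regularized_state t sets_augmentation(2)[OF x t] by (simp add: space_cem)
next
  fix A assume A: "A \<in> sets (cem_algebra D)"
  let ?N = "{\<omega> \<in> space (P x). \<not> regularized t \<omega> = X t \<omega>}"
  let ?pre = "regularized t -` A \<inter> \<Omega>"
  from regularized_version[OF x t] obtain N where N: "?N \<subseteq> N" "N \<in> null_sets (P x)"
    by (auto elim: AE_E3 simp: eventually_ae_filter)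
  have null: "B \<in> null_sets (completion (P x))" if "B \<subseteq> ?N" for B
    using that N(1) by (intro null_sets_completion_subset[OF _ null_sets_completionI[OF N(2)]]) blast
  have XA: "X t -` A \<inter> \<Omega> \<in> sets (\<F> t)"
    using measurable_sets[OF X_measurable[OF x t] A] F_subalgebra[OF x t] P_space[OF x] by (simp add: subalgebra_def)
  have "(X t -` A \<inter> \<Omega> - ?N) \<union> (?pre \<inter> ?N) \<in> sets (\<G> x t)"
    by (intro sets.Un sets.Diff augmentation_contains(1)[OF x t XA] augmentation_contains(2)[OF x t] null) auto
  also have "(X t -` A \<inter> \<Omega> - ?N) \<union> (?pre \<inter> ?N) = ?pre"
    using P_space[OF x] by auto
  finally show "regularized t -` A \<inter> space (\<G> x t) \<in> sets (\<G> x t)"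
    by (simp only: sets_augmentation(2)[OF x t])
qed

lemma regularized_measurable_completion:
  "x \<in> cem D \<Longrightarrow> t \<ge> 0 \<Longrightarrow> regularized t \<in> measurable (completion (P x)) (cem_algebra D)"
  by (rule measurable_from_subalg[OF augmentation_subalgebra regularized_measurable])

lemma integral_regularized:
  fixes f :: "'v state \<Rightarrow> 'b::{banach, second_countable_topology}"
  assumes x: "x \<in> cem D" and t: "t \<ge> 0" and f: "f \<in> borel_measurable (cem_algebra D)"
  shows "(LINT \<omega>|completion (P x). f (regularized t \<omega>)) = (LINT \<omega>|P x. f (X t \<omega>))"
proof -
  have fX: "(\<lambda>\<omega>. f (X t \<omega>)) \<in> borel_measurable (P x)" by (rule measurable_compose[OF X_measurable_P[OF x t] f])
  have "(LINT \<omega>|completion (P x). f (regularized t \<omega>)) = (LINT \<omega>|completion (P x). f (X t \<omega>))"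
  proof (rule integral_cong_AE)
    show "(\<lambda>\<omega>. f (regularized t \<omega>)) \<in> borel_measurable (completion (P x))"
      by (rule measurable_compose[OF regularized_measurable_completion[OF x t] f])
    show "AE \<omega> in completion (P x). f (regularized t \<omega>) = f (X t \<omega>)"
      using regularized_version_completion[OF x t] by (rule AE_mp) (intro AE_I2 impI, simp)
  qed (rule measurable_completion[OF fX])
  also have "\<dots> = (LINT \<omega>|P x. f (X t \<omega>))" by (rule integral_completion[OF fX])
  finally show ?thesis .
qed

lemma prob_space_completed: "x \<in> cem D \<Longrightarrow> prob_space (completion (P x))"
  using P_prob by (rule prob_space.prob_space_completion)

text \<open>Both the events of the augmented filtration and the values of the new process may be replaced by those of
the old one, up to null sets.\<close>

lemma completed_markov_property:
  assumes x: "x \<in> cem D" and st: "s \<ge> 0" "t \<ge> 0"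
    and f: "f \<in> borel_measurable (cem_algebra D)" "bounded (f ` cem D)" "f Cemetery = (0::real)"
  shows "AE \<omega> in completion (P x). real_cond_exp (completion (P x)) (\<G> x s) (\<lambda>\<omega>'. f (regularized (t + s) \<omega>')) \<omega>
     = trans t f (regularized s \<omega>)"
proof -
  let ?M = "completion (P x)"
  interpret M: prob_space ?M by (rule prob_space_completed[OF x])
  interpret S: finite_measure_subalgebra ?M "\<G> x s"
    by unfold_locales (rule augmentation_subalgebra[OF x st(1)])
  have ts: "t + s \<ge> 0" using st by simp
  \<comment> \<open>Outside the state space \<open>f\<close> is arbitrary and may be unbounded.\<close>
  define g where "g y = (if y \<in> cem D then f y else 0)" for y
  have g_eq: "y \<in> cem D \<Longrightarrow> g y = f y" for y by (simp add: g_def)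
  obtain B where B: "\<And>y. \<bar>g y\<bar> \<le> B"
  proof -
    obtain b where b: "\<And>y. y \<in> cem D \<Longrightarrow> \<bar>f y\<bar> \<le> b" using f(2) unfolding bounded_iff by auto
    have "b \<ge> 0" using b[OF Cem_in_cem] f(3) by simp
    then show ?thesis using b by (intro that[of b]) (auto simp: g_def)
  qed
  have g: "g \<in> borel_measurable (cem_algebra D)"
    using f(1) by (subst measurable_cong[where g=f]) (simp_all add: g_eq space_cem)
  have g0: "g Cemetery = 0" using g_eq[OF Cem_in_cem] f(3) by simp
  have trans_g: "trans t g y = trans t f y" for y
    unfolding trans_def set_lebesgue_integral_def by (auto intro!: Bochner_Integration.integral_cong simp: g_eq space_p)
  have tg: "trans t g \<in> borel_measurable (cem_algebra D)" by (rule trans_measurable[OF st(2) g g0])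
  have tg_bound: "\<bar>trans t g y\<bar> \<le> B" for y by (rule trans_bound[OF g g0 B])
  have gR: "(\<lambda>\<omega>. g (regularized (t + s) \<omega>)) \<in> borel_measurable ?M"
    by (rule measurable_compose[OF regularized_measurable_completion[OF x ts] g])
  have tgR: "(\<lambda>\<omega>. trans t g (regularized s \<omega>)) \<in> borel_measurable ?M"
    by (rule measurable_compose[OF regularized_measurable_completion[OF x st(1)] tg])
  have sp: "space ?M = \<Omega>" using P_space[OF x] by simp
  have fR: "f (regularized (t + s) \<omega>) = g (regularized (t + s) \<omega>)" if "\<omega> \<in> space ?M" for \<omega>
    using regularized_state[OF _ ts] that sp by (simp add: g_eq)
  have "AE \<omega> in ?M. real_cond_exp ?M (\<G> x s) (\<lambda>\<omega>'. f (regularized (t + s) \<omega>')) \<omega> = trans t g (regularized s \<omega>)"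
  proof (rule S.real_cond_exp_charact)
    fix A assume A: "A \<in> sets (\<G> x s)"
    obtain C where C: "C \<in> sets (\<F> s)" "AE \<omega> in ?M. \<omega> \<in> A \<longleftrightarrow> \<omega> \<in> C"
      using augmentation_approximation[OF x st(1) A] by blast
    have A_M: "A \<in> sets ?M" using A augmentation_subalgebra[OF x st(1)] by (auto simp: subalgebra_def)
    have C_F: "(indicator C :: 'w \<Rightarrow> real) \<in> borel_measurable (\<F> s)" using C(1) by simp
    have C_P: "(indicator C :: 'w \<Rightarrow> real) \<in> borel_measurable (P x)"
      by (rule measurable_from_subalg[OF F_subalgebra[OF x st(1)] C_F])
    have move: "(LINT \<omega>|?M. indicator A \<omega> * k (regularized r \<omega>)) = (LINT \<omega>|P x. k (X r \<omega>) * indicator C \<omega>)"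
      if k: "k \<in> borel_measurable (cem_algebra D)" and r: "r \<ge> 0" for k :: "'v state \<Rightarrow> real" and r
    proof -
      have kX: "(\<lambda>\<omega>. k (X r \<omega>) * indicator C \<omega>) \<in> borel_measurable (P x)"
        by (rule borel_measurable_times[OF measurable_compose[OF X_measurable_P[OF x r] k] C_P])
      have "(LINT \<omega>|?M. indicator A \<omega> * k (regularized r \<omega>)) = (LINT \<omega>|?M. k (X r \<omega>) * indicator C \<omega>)"
      proof (rule integral_cong_AE)
        show "(\<lambda>\<omega>. indicator A \<omega> * k (regularized r \<omega>)) \<in> borel_measurable ?M"
          using A_M by (intro borel_measurable_times borel_measurable_indicator measurable_compose[OF regularized_measurable_completion[OF x r] k])
        show "AE \<omega> in ?M. indicator A \<omega> * k (regularized r \<omega>) = k (X r \<omega>) * indicator C \<omega>"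
          using AE_conjI[OF C(2) regularized_version_completion[OF x r]]
          by (rule AE_mp) (intro AE_I2 impI, auto simp: indicator_def)
      qed (rule measurable_completion[OF kX])
      also have "\<dots> = (LINT \<omega>|P x. k (X r \<omega>) * indicator C \<omega>)" by (rule integral_completion[OF kX])
      finally show ?thesis .
    qed
    have "set_lebesgue_integral ?M A (\<lambda>\<omega>. f (regularized (t + s) \<omega>)) = (LINT \<omega>|?M. indicator A \<omega> * g (regularized (t + s) \<omega>))"
      unfolding set_lebesgue_integral_def by (rule Bochner_Integration.integral_cong[OF refl]) (simp add: fR)
    also have "\<dots> = (LINT \<omega>|P x. g (X (t + s) \<omega>) * indicator C \<omega>)" by (rule move[OF g ts])
    also have "\<dots> = (LINT \<omega>|P x. trans t g (X s \<omega>) * indicator C \<omega>)"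
      by (rule markov_projection[OF x st g B g0 C_F, of 1]) (simp add: indicator_def)
    also have "\<dots> = (LINT \<omega>|?M. indicator A \<omega> * trans t g (regularized s \<omega>))" by (rule move[OF tg st(1), symmetric])
    also have "\<dots> = set_lebesgue_integral ?M A (\<lambda>\<omega>. trans t g (regularized s \<omega>))"
      by (simp add: set_lebesgue_integral_def)
    finally show "set_lebesgue_integral ?M A (\<lambda>\<omega>. f (regularized (t + s) \<omega>)) = set_lebesgue_integral ?M A (\<lambda>\<omega>. trans t g (regularized s \<omega>))" .
  next
    have "integrable ?M (\<lambda>\<omega>. g (regularized (t + s) \<omega>))"
      using B gR by (intro M.integrable_const_bound[where B=B]) auto
    then show "integrable ?M (\<lambda>\<omega>. f (regularized (t + s) \<omega>))"
      by (subst Bochner_Integration.integrable_cong[OF refl fR])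
    show "integrable ?M (\<lambda>\<omega>. trans t g (regularized s \<omega>))"
      using tg_bound tgR by (intro M.integrable_const_bound[where B=B]) auto
    show "(\<lambda>\<omega>. trans t g (regularized s \<omega>)) \<in> borel_measurable (\<G> x s)"
      by (rule measurable_compose[OF regularized_measurable[OF x st(1)] tg])
  qed
  then show ?thesis by (simp only: trans_g)
qed

lemma completed_markov_process:
  "markov_process D \<Omega> (\<lambda>x. completion (P x)) \<G> regularized p"
  unfolding markov_process_def
proof (intro conjI allI ballI impI)
  show "transition_function D p" by (rule transition)
  show "regularized s \<omega> \<in> cem D" if "0 \<le> s" "\<omega> \<in> \<Omega>" for s \<omega> by (rule regularized_state[OF that(2,1)])
  show "regularized t \<omega> = Cemetery" if "0 \<le> s" "s \<le> t" "\<omega> \<in> \<Omega>" "regularized s \<omega> = Cemetery" for s t \<omega>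
    by (rule regularized_absorbed[OF that(3,1,2,4)])
  fix x assume x: "x \<in> cem D"
  show "prob_space (completion (P x))" by (rule prob_space_completed[OF x])
  show "space (completion (P x)) = \<Omega>" using P_space[OF x] by simp
  show "subalgebra (completion (P x)) (\<G> x t)" if "0 \<le> t" for t by (rule augmentation_subalgebra[OF x that])
  show "sets (\<G> x s) \<subseteq> sets (\<G> x t)" if "0 \<le> s" "s \<le> t" for s t by (rule augmentation_mono[OF x that])
  show "regularized t \<in> measurable (\<G> x t) (cem_algebra D)" if "0 \<le> t" for t by (rule regularized_measurable[OF x that])
  fix s t :: real and f :: "'v state \<Rightarrow> real"
  assume st: "0 \<le> s" "0 \<le> t" and f: "f \<in> borel_measurable (cem_algebra D)" "bounded (f ` cem D)" "f Cemetery = 0"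
  let ?M = "completion (P x)"
  have original: "AE \<omega> in ?M. (\<integral>\<omega>'. f (X t \<omega>') \<partial>(P (X s \<omega>))) = set_lebesgue_integral (p t (X s \<omega>)) (Pt ` D) f"
    using AE_completion[OF markov_processD(9)[OF markov x st f]] by (rule AE_mp) (intro AE_I2 impI, blast)
  have cond: "AE \<omega> in ?M. real_cond_exp ?M (\<G> x s) (\<lambda>\<omega>'. f (regularized (t + s) \<omega>')) \<omega> = trans t f (regularized s \<omega>)"
    by (rule completed_markov_property[OF x st f])
  show "AE \<omega> in ?M. real_cond_exp ?M (\<G> x s) (\<lambda>\<omega>'. f (regularized (t + s) \<omega>')) \<omega>
          = (\<integral>\<omega>'. f (regularized t \<omega>') \<partial>completion (P (regularized s \<omega>))) \<and>
        (\<integral>\<omega>'. f (regularized t \<omega>') \<partial>completion (P (regularized s \<omega>)))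
          = set_lebesgue_integral (p t (regularized s \<omega>)) (Pt ` D) f"
  proof (rule AE_mp[OF AE_conjI[OF cond AE_conjI[OF original regularized_version_completion[OF x st(1)]]]], intro AE_I2 impI)
    fix \<omega> assume "\<omega> \<in> space ?M"
    then have "\<omega> \<in> \<Omega>" using P_space[OF x] by simp
    then have y: "regularized s \<omega> \<in> cem D" by (rule regularized_state[OF _ st(1)])
    assume h: "real_cond_exp ?M (\<G> x s) (\<lambda>\<omega>'. f (regularized (t + s) \<omega>')) \<omega> = trans t f (regularized s \<omega>) \<and>
      (\<integral>\<omega>'. f (X t \<omega>') \<partial>(P (X s \<omega>))) = set_lebesgue_integral (p t (X s \<omega>)) (Pt ` D) f \<and> regularized s \<omega> = X s \<omega>"
    have "(\<integral>\<omega>'. f (regularized t \<omega>') \<partial>completion (P (regularized s \<omega>))) = (\<integral>\<omega>'. f (X t \<omega>') \<partial>P (regularized s \<omega>))"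
      by (rule integral_regularized[OF y st(2) f(1)])
    moreover have "trans t f (regularized s \<omega>) = set_lebesgue_integral (p t (regularized s \<omega>)) (Pt ` D) f"
      using y st by (simp add: trans_def)
    ultimately show "real_cond_exp ?M (\<G> x s) (\<lambda>\<omega>'. f (regularized (t + s) \<omega>')) \<omega>
          = (\<integral>\<omega>'. f (regularized t \<omega>') \<partial>completion (P (regularized s \<omega>))) \<and>
        (\<integral>\<omega>'. f (regularized t \<omega>') \<partial>completion (P (regularized s \<omega>)))
          = set_lebesgue_integral (p t (regularized s \<omega>)) (Pt ` D) f"
      using h by simp
  qed
qed

end

section \<open>Affine processes\<close>

text \<open>The statements about integrals over \<open>D\<close> are those for the kernels on the vector space.\<close>

lemma feller_of_affine_process:
  fixes D :: "'v::euclidean_space set"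
  assumes "closed D" and "\<exists>S\<subseteq>D. finite S \<and> card S = DIM('v) + 1 \<and> \<not> affine_dependent S"
    and aff: "affine_process D \<Omega> P (\<lambda>x. nat_filt D \<Omega> X) X p"
  shows "feller_markov_process D \<Omega> P X p"
proof -
  have markov: "markov_process D \<Omega> P (\<lambda>x. nat_filt D \<Omega> X) X p"
    using aff by (simp only: affine_process_def)
  interpret K: state_kernel D p
    using assms(1) markov_processD(1)[OF markov] by (rule state_kernel.intro)
  obtain \<Phi> \<psi>R \<psi>I y0 where "affine_kernel D K.\<kappa> \<Phi> \<psi>R \<psi>I y0"
    using affine_kernel_of_affine_process[OF assms] by blast
  then interpret A: affine_kernel D K.\<kappa> \<Phi> \<psi>R \<psi>I y0 .
  have int: "(LINT \<xi>|K.\<kappa> s x. h \<xi>) = set_lebesgue_integral (p s (Pt x)) (Pt ` D) (zext h)"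
    if "s \<ge> 0" "x \<in> D" "continuous_on UNIV h" for s x and h :: "'v \<Rightarrow> real"
    by (rule K.integral_kappa[OF that(1,2) borel_measurable_continuous_onI[OF that(3)]])
  show ?thesis
  proof (rule feller_markov_process.intro[OF assms(1) markov])
    fix h :: "'v \<Rightarrow> real" and B e :: real
    assume h: "continuous_on UNIV h" "\<And>x. \<bar>h x\<bar> \<le> B" "(h \<longlongrightarrow> 0) at_infinity" "e > 0"
    obtain \<delta> where "\<delta> > 0" "\<And>s x. s \<in> {0..\<delta>} \<Longrightarrow> x \<in> D \<Longrightarrow> \<bar>(LINT \<xi>|K.\<kappa> s x. h \<xi>) - h x\<bar> \<le> e"
      using A.feller_strongly_continuous[OF h] by blast
    then show "\<exists>\<delta>>0. \<forall>s\<in>{0..\<delta>}. \<forall>x\<in>D. \<bar>set_lebesgue_integral (p s (Pt x)) (Pt ` D) (zext h) - h x\<bar> \<le> e"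
      using int[OF _ _ h(1)] by (intro exI[of _ \<delta>]) auto
  next
    obtain \<delta> where \<delta>: "\<delta> > 0" and van: "\<And>h B e. continuous_on UNIV h \<Longrightarrow> (\<forall>x. \<bar>h x\<bar> \<le> B) \<Longrightarrow> (h \<longlongrightarrow> (0::real)) at_infinity \<Longrightarrow> e > 0 \<Longrightarrow>
        \<exists>M. \<forall>s\<in>{0..\<delta>}. \<forall>x\<in>D. norm x \<ge> M \<longrightarrow> \<bar>LINT \<xi>|K.\<kappa> s x. h \<xi>\<bar> \<le> e"
      using A.feller_vanishing by metis
    show "\<exists>\<delta>>0. \<forall>h B. continuous_on UNIV h \<longrightarrow> (\<forall>x. \<bar>h x\<bar> \<le> B) \<longrightarrow> (h \<longlongrightarrow> (0::real)) at_infinity \<longrightarrow>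
        (\<forall>e>0. \<exists>M. \<forall>s\<in>{0..\<delta>}. \<forall>x\<in>D. norm x \<ge> M \<longrightarrow> \<bar>set_lebesgue_integral (p s (Pt x)) (Pt ` D) (zext h)\<bar> \<le> e)"
    proof (rule exI[of _ \<delta>], intro conjI allI impI \<delta>)
      fix h :: "'v \<Rightarrow> real" and B e :: real
      assume h: "continuous_on UNIV h" "\<forall>x. \<bar>h x\<bar> \<le> B" "(h \<longlongrightarrow> 0) at_infinity" "e > 0"
      obtain M where M: "\<And>s x. s \<in> {0..\<delta>} \<Longrightarrow> x \<in> D \<Longrightarrow> norm x \<ge> M \<Longrightarrow> \<bar>LINT \<xi>|K.\<kappa> s x. h \<xi>\<bar> \<le> e"
        using van[OF h] by blast
      have "\<bar>set_lebesgue_integral (p s (Pt x)) (Pt ` D) (zext h)\<bar> \<le> e" if "s \<in> {0..\<delta>}" "x \<in> D" "norm x \<ge> M" for s x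
        using M[OF that] int[OF _ that(2) h(1), of s] that(1) by simp
      then show "\<exists>M. \<forall>s\<in>{0..\<delta>}. \<forall>x\<in>D. norm x \<ge> M \<longrightarrow> \<bar>set_lebesgue_integral (p s (Pt x)) (Pt ` D) (zext h)\<bar> \<le> e"
        by blast
    qed
  qed
qed

theorem theorem3p6:
  fixes D :: "'v::euclidean_space set"
    and \<Omega> :: "'w set"
    and P :: "'v state \<Rightarrow> 'w measure"
    and X :: "real \<Rightarrow> 'w \<Rightarrow> 'v state"
    and p :: "real \<Rightarrow> 'v state \<Rightarrow> 'v state measure"
  assumes "closed D" and "D \<noteq> {}"
    and "\<exists>S\<subseteq>D. finite S \<and> card S = DIM('v) + 1 \<and> \<not> affine_dependent S"
    and "\<forall>x\<in>cem D. sets (P x) = sets (nat_algebra D \<Omega> X)"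
    and "affine_process D \<Omega> P (\<lambda>x. nat_filt D \<Omega> X) X p"
  shows "\<exists>X' :: real \<Rightarrow> 'w \<Rightarrow> 'v state.
    (\<forall>x\<in>cem D. \<forall>t\<ge>0. AE \<omega> in P x. X' t \<omega> = X t \<omega>) \<and>
    (\<forall>\<omega>\<in>\<Omega>. cadlag_path D (\<lambda>t. X' t \<omega>)) \<and>
    affine_process D \<Omega> (\<lambda>x. completion (P x)) (aug_filt D \<Omega> P X) X' p"
proof -
  interpret feller_markov_process D \<Omega> P X p
    using assms(1,3,5) by (rule feller_of_affine_process)
  have same: "(\<integral>\<omega>. zext (\<lambda>\<xi>. exp (pairing u \<xi>)) (regularized t \<omega>) \<partial>completion (P (Pt x)))
      = (\<integral>\<omega>. zext (\<lambda>\<xi>. exp (pairing u \<xi>)) (X t \<omega>) \<partial>(P (Pt x)))" if "x \<in> D" "t \<ge> 0" for x t u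
  proof (rule integral_regularized[OF Pt_in_cem[OF that(1)] that(2)], rule zext_measurable[OF closed_D])
    show "(\<lambda>\<xi>. exp (pairing u \<xi>)) \<in> borel_measurable borel"
      unfolding pairing_def Complex_eq by (intro borel_measurable_continuous_onI continuous_intros)
  qed
  have "affine_process D \<Omega> (\<lambda>x. completion (P x)) (aug_filt D \<Omega> P X) regularized p"
    using assms(5) completed_markov_process same unfolding affine_process_def by (simp cong: conj_cong)
  then show ?thesis
    using regularized_version regularized_cadlag by (intro exI[of _ regularized]) blast
qed

end
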